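(* Fix $p,q\in[1,\infty)$ and consider the infinite interconnection $\Sigma:\ \dot x=f(x,u)$ of the subsystems $\Sigma_i:\ \dot x_i=f_i(x_i,\bar x,u_i)$, $i\in\mathbb{N}$ (setting in the context). Suppose: (i) $\Sigma$ is well-posed with state space $X=\ell^p(\mathbb{N},(n_i))$, space of input values $U=\ell^q(\mathbb{N},(m_i))$ and external input space $\mathcal{U}$. (ii) For each $i\in\mathbb{N}$ there are a nonempty closed set $\mathcal{A}_i\subset\mathbb{R}^{n_i}$ and a continuous function $V_i:\mathbb{R}^{n_i}\to\mathbb{R}_+$ such that: - there are constants $\underline\alpha_i,\overline\alpha_i>0$ with $\underline{\alpha}_i|x_i|^p_{\mathcal{A}_i}\le V_i(x_i)\le\overline{\alpha}_i|x_i|^p_{\mathcal{A}_i}$ for all $x_i\in\mathbb{R}^{n_i}$; - there are constants $\lambda_i,\gamma_{iu}>0$ and $\gamma_{ij}>0$ ($j\in I_i$) such that for each $x_i\in\mathbb{R}^{n_i}\setminus\mathcal{A}_i$, each $u_i\in L^\infty(\mathbb{R}_+,\mathbb{R}^{m_i})$, each $\bar x=(x_j(\cdot))_{j}\in C^0(\mathbb{R}_+,X)$, and almost all $t$ in the maximal interval of existence of $\phi_i(t):=\phi_i(t,x_i,(\bar x,u_i))$, $$\mathrm{D}^+(V_i\circ\phi_i)(t)\le-\lambda_iV_i(\phi_i(t))+\sum_{j\in I_i}\gamma_{ij}V_j(x_j(t))+\gamma_{iu}|u_i(t)|^q$$ (the right-hand side is allowed to be $+\infty$); - $\mathrm{D}_+(V_i\circ\phi_i)(t)<\infty$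 for all $t$ in the maximal interval of existence of $\phi_i$; and there are constants $\underline\alpha,\overline\alpha,\underline\lambda,\overline\gamma_u>0$ such that $\underline\alpha\le\underline\alpha_i\le\overline\alpha_i\le\overline\alpha$, $\underline\lambda\le\lambda_i$ and $\gamma_{iu}\le\overline\gamma_u$ for all $i\in\mathbb{N}$. (iii) With $\gamma_{ij}:=0$ for $j\notin I_i$, the matrix $\Gamma=(\gamma_{ij})_{i,j\in\mathbb{N}}$ satisfies $\sup_{j\in\mathbb{N}}\sum_{i=1}^\infty\gamma_{ij}<\infty$ (i.e. $\Gamma:\ell^1\to\ell^1$ is bounded). (iv) The operator $\Psi:\ell^1\to\ell^1$, $(\Psi x)_i=\sum_{j=1}^\infty\frac{\gamma_{ij}}{\lambda_i}x_j$, has spectral radius $r(\Psi)<1$. Let $\mathcal{A}:=X\cap(\mathcal{A}_1\times\mathcal{A}_2\times\cdots)$ and assume $\mathcal{A}\neq\emptyset$. Then $\Sigma$ admits an eISS Lyapunov function with respect to $\mathcal{A}$ of the form $$V:X\to\mathbb{R}_+,\qquad V(x)=\sum_{i=1}^\infty\mu_iV_i(x_i),$$ for some $\mu=(\mu_i)_{i\in\mathbb{N}}\in\ell^\infty$ satisfying $\underline\mu\le\mu_i\le\overline\mu$ for all $i$ with constants $\underline\mu,\overline\mu>0$. In particular: (a) $V$ is continuous on $X\setminus\mathcal{A}$; (b) there is $\lambda_\infty>0$ such that for all $x^0\in X\setminus\mathcal{A}$ and $u\in\mathcal{U}$: $\ \mathrm{D}^+V_u(x^0)\le-\lambda_\infty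 V(x^0)+\overline\mu\,\overline\gamma_u|u|_{q,\infty}^q$; (c) for all $x\in X$: $\ \underline\mu\,\underline\alpha|x|_{\mathcal{A}}^p\le V(x)\le\overline\mu\,\overline\alpha|x|_{\mathcal{A}}^p$. In particular, $\Sigma$ is eISS with respect to $\mathcal{A}$.
   Context: Spaces. For a sequence $(n_i)_{i\in\mathbb{N}}$ of positive integers, with a fixed norm on each $\mathbb{R}^{n_i}$ (all written $|\cdot|$), and $p\in[1,\infty)$, $\ell^p(\mathbb{N},(n_i))$ is the Banach space of $x=(x_i)_{i\in\mathbb{N}}$, $x_i\in\mathbb{R}^{n_i}$, with $|x|_p:=(\sum_i|x_i|^p)^{1/p}<\infty$. Similarly $U=\ell^q(\mathbb{N},(m_i))$. $\ell^1,\ell^\infty$ are the usual real sequence spaces. $C^0(Y,Z)$ denotes continuous maps. Distances. $|x_i|_{\mathcal{A}_i}:=\inf_{y_i\in\mathcal{A}_i}|x_i-y_i|$ and $|x|_{\mathcal{A}}:=\inf_{y\in\mathcal{A}}|x-y|_p$. Subsystems. For each $i\in\mathbb{N}$, $f_i:\mathbb{R}^{n_i}\times X\times\mathbb{R}^{m_i}\to\mathbb{R}^{n_i}$ is continuous; $\bar x\in X$ is the internal input and $u_i$ the external input of $\dot x_i=f_i(x_i,\bar x,u_i)$. For all initial states $x_{i0}\in\mathbb{R}^{n_i}$, continuous $\bar x(\cdot)$ and locally essentially bounded $u_i(\cdot)$ (regarded as time-dependent inputs), a unique local solution exists, denoted $\phi_i(\cdot,x_{i0},(\bar x,u_i))$.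 $I_i$ is the set of $j\in\mathbb{N}$ such that $f_i(x_i,\bar x,u_i)$ is non-constant with respect to the component $x_j$ of $\bar x$; it is assumed that $i\notin I_i$. $I_i$ may be infinite. Interconnection. $f(x,u):=(f_i(x_i,x,u_i))_{i\in\mathbb{N}}$ for $x\in X$, $u=(u_i)\in U$ (the internal input $\bar x$ is the overall state $x$). $\mathcal{U}$ is the set of strongly measurable, essentially bounded $u:\mathbb{R}_+\to U$, with $|u|_{q,\infty}:=\operatorname{ess\,sup}_{t\ge0}|u(t)|_q$. A solution of $\Sigma$ with initial value $x^0\in X$ and input $u\in\mathcal{U}$ is a continuous $\xi:[0,T_* )\to X$, $T_*\in(0,\infty]$, with $f(\xi(t),u(t))\in X$ and $\xi(t)=x^0+\int_0^tf(\xi(s),u(s))\,ds$ (Bochner integral) for all $t$. $\Sigma$ is well-posed if for each $(x^0,u)\in X\times\mathcal{U}$ a unique local solution exists; its maximal extension is denoted $\phi(\cdot,x^0,u)$. $\Sigma$ is forward complete if all maximal solutions are defined on $\mathbb{R}_+$. Dini derivatives. $\mathrm{D}^+g(t)=\limsup_{h\to0+}\frac{g(t+h)-g(t)}h$, $\mathrm{D}_+g(t)=\liminf_{h\to0+}\frac{g(t+h)-g(t)}h$. For $V:X\to\mathbb{R}$ continuous on $X\setminus\mathcal{A}$, $x\in X\setminus\mathcal{A}$ and $u\in\mathcal{U}$: $\mathrm{D}^+V_u(x):=\mathrm{D}^+\big(t\mapsto V(\phi(t,x,u))\big)\big|_{t=0}$. eISS. For a nonempty closed $\mathcal{A}\subset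 X$, $\Sigma$ is exponentially input-to-state stable (eISS) w.r.t. $\mathcal{A}$ if it is forward complete and there are $a,M>0$ and $\gamma\in\mathcal{K}$ (continuous, strictly increasing on $\mathbb{R}_+$, $\gamma(0)=0$) such that $|\phi(t,x^0,u)|_{\mathcal{A}}\le Me^{-at}|x^0|_{\mathcal{A}}+\gamma(|u|_{q,\infty})$ for all $t\ge0$, $x^0\in X$, $u\in\mathcal{U}$. eISS Lyapunov function. A function $V:X\to\mathbb{R}_+$, continuous on $X\setminus\mathcal{A}$, is an eISS Lyapunov function for $\Sigma$ w.r.t. $\mathcal{A}$ if there are $\underline\omega,\overline\omega,b,\kappa>0$ and an unbounded $\gamma\in\mathcal{K}$ with $\underline\omega|x|_{\mathcal{A}}^b\le V(x)\le\overline\omega|x|_{\mathcal{A}}^b$ for all $x\in X$ and $\mathrm{D}^+V_u(x)\le-\kappa V(x)+\gamma(|u|_{q,\infty})$ for all $x\in X\setminus\mathcal{A}$, $u\in\mathcal{U}$.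
   Formalization: The last sentence "Σ is eISS" is proved under the added assumption that Σ is forward complete, which the hypotheses do not imply (finite-time blow-up inside A is possible); without it the eISS estimate is proved on the maximal interval of existence. *)

theory Defs
  imports "HOL-Analysis.Analysis" "HOL-Probability.Essential_Supremum"
begin

section \<open>The spaces\<close>

text \<open>
  The dimensions of the subsystems vary with the index, so a vector of dimension n is
  a function of type nat to real that vanishes from n on, and the norms are
  functions on such vectors. Topologies are the metric topologies of these norms.
\<close>

type_synonym vect = "nat \<Rightarrow> real"
type_synonym vseq = "nat \<Rightarrow> nat \<Rightarrow> real"

definition Rn :: "nat \<Rightarrow> vect set" where
  "Rn n = {v. \<forall>k\<ge>n. v k = 0}"

definition is_norm_on_Rn :: "nat \<Rightarrow> (vect \<Rightarrow> real) \<Rightarrow> bool" where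
  "is_norm_on_Rn n N \<longleftrightarrow>
     (\<forall>v\<in>Rn n. 0 \<le> N v \<and> (N v = 0 \<longleftrightarrow> v = (\<lambda>k. 0))) \<and>
     (\<forall>c. \<forall>v\<in>Rn n. N (\<lambda>k. c * v k) = \<bar>c\<bar> * N v) \<and>
     (\<forall>v\<in>Rn n. \<forall>w\<in>Rn n. N (\<lambda>k. v k + w k) \<le> N v + N w)"

definition lp_space :: "real \<Rightarrow> (nat \<Rightarrow> nat) \<Rightarrow> (nat \<Rightarrow> vect \<Rightarrow> real) \<Rightarrow> vseq set" where
  "lp_space p d N = {x. (\<forall>i. x i \<in> Rn (d i)) \<and> summable (\<lambda>i. N i (x i) powr p)}"

definition lp_norm :: "real \<Rightarrow> (nat \<Rightarrow> vect \<Rightarrow> real) \<Rightarrow> vseq \<Rightarrow> real" where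
  "lp_norm p N x = (\<Sum>i. N i (x i) powr p) powr (1 / p)"

text \<open>
  The locale Metric_space wants a symmetric, nonnegative distance on the whole type, and N is
  arbitrary outside C.
\<close>

definition norm_topology :: "'v set \<Rightarrow> ('v::minus \<Rightarrow> real) \<Rightarrow> 'v topology" where
  "norm_topology C N =
     Metric_space.mtopology C (\<lambda>x y. if x \<in> C \<and> y \<in> C then N (x - y) else 0)"

definition set_distance :: "('v::minus \<Rightarrow> real) \<Rightarrow> 'v set \<Rightarrow> 'v \<Rightarrow> real" where
  "set_distance N A x = (INF y\<in>A. N (x - y))"


section \<open>Strong measurability and Bochner integral in a space of sequences\<close>

text \<open>
  The library's Bochner integral needs a Banach space given by a type, whereas here the space
  depends on the exponent, the dimensions and the norms. The following are the usual
  definitions, relative to a carrier C with norm N and a domain D of Lebesgue measure.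
\<close>

definition simple_on :: "vseq set \<Rightarrow> real set \<Rightarrow> (real \<Rightarrow> vseq) \<Rightarrow> bool" where
  "simple_on C D s \<longleftrightarrow>
     s ` D \<subseteq> C \<and> finite (s ` D) \<and> (\<forall>v. {t \<in> D. s t = v} \<in> sets lebesgue)"

definition simple_integral_on :: "real set \<Rightarrow> (real \<Rightarrow> vseq) \<Rightarrow> vseq" where
  "simple_integral_on D s = (\<lambda>i k. \<Sum>v\<in>s ` D. measure lebesgue {t \<in> D. s t = v} * v i k)"

definition strongly_measurable_on ::
  "vseq set \<Rightarrow> (vseq \<Rightarrow> real) \<Rightarrow> real set \<Rightarrow> (real \<Rightarrow> vseq) \<Rightarrow> bool" where
  "strongly_measurable_on C N D g \<longleftrightarrow>
     g ` D \<subseteq> C \<and>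
     (\<exists>s. (\<forall>m. simple_on C D (s m)) \<and>
          (AE t in lebesgue_on D. (\<lambda>m::nat. N (g t - s m t)) \<longlonglongrightarrow> 0))"

text \<open>For domains D of finite measure, which is all that is used.\<close>

definition has_bochner_integral_on ::
  "vseq set \<Rightarrow> (vseq \<Rightarrow> real) \<Rightarrow> real set \<Rightarrow> (real \<Rightarrow> vseq) \<Rightarrow> vseq \<Rightarrow> bool" where
  "has_bochner_integral_on C N D g J \<longleftrightarrow>
     strongly_measurable_on C N D g \<and> J \<in> C \<and>
     (\<exists>s. (\<forall>m. simple_on C D (s m)) \<and>
          (\<lambda>m::nat. \<integral>\<^sup>+t. ennreal (N (g t - s m t)) \<partial>lebesgue_on D) \<longlonglongrightarrow> 0 \<and>
          (\<lambda>m. N (J - simple_integral_on D (s m))) \<longlonglongrightarrow> 0)"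


section \<open>Maximal solutions\<close>

text \<open>
  In the following, sol T x means that x is a solution on the half-open interval from 0 to T.
\<close>

definition uniquely_solvable :: "(ereal \<Rightarrow> (real \<Rightarrow> 'a) \<Rightarrow> bool) \<Rightarrow> bool" where
  "uniquely_solvable sol \<longleftrightarrow>
     (\<exists>T x. sol T x) \<and>
     (\<forall>T x T' x'. sol T x \<and> sol T' x' \<longrightarrow>
        (\<forall>t. 0 \<le> t \<and> ereal t < T \<and> ereal t < T' \<longrightarrow> x t = x' t))"

definition max_time :: "(ereal \<Rightarrow> (real \<Rightarrow> 'a) \<Rightarrow> bool) \<Rightarrow> ereal" where
  "max_time sol = Sup {T. \<exists>x. sol T x}"

definition max_solution :: "(ereal \<Rightarrow> (real \<Rightarrow> 'a) \<Rightarrow> bool) \<Rightarrow> real \<Rightarrow> 'a" where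
  "max_solution sol t = (THE v. \<exists>T x. sol T x \<and> ereal t < T \<and> x t = v)"


section \<open>The network\<close>

record network =
  exp_p :: real
  exp_q :: real
  dim_x :: "nat \<Rightarrow> nat"
  dim_u :: "nat \<Rightarrow> nat"
  norm_x :: "nat \<Rightarrow> vect \<Rightarrow> real"
  norm_u :: "nat \<Rightarrow> vect \<Rightarrow> real"
  rhs :: "nat \<Rightarrow> vect \<Rightarrow> vseq \<Rightarrow> vect \<Rightarrow> vect"

definition sub_states :: "network \<Rightarrow> nat \<Rightarrow> vect set" where
  "sub_states S i = Rn (dim_x S i)"

definition sub_inputs :: "network \<Rightarrow> nat \<Rightarrow> vect set" where
  "sub_inputs S i = Rn (dim_u S i)"

definition sub_state_top :: "network \<Rightarrow> nat \<Rightarrow> vect topology" where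
  "sub_state_top S i = norm_topology (sub_states S i) (norm_x S i)"

definition sub_input_top :: "network \<Rightarrow> nat \<Rightarrow> vect topology" where
  "sub_input_top S i = norm_topology (sub_inputs S i) (norm_u S i)"

definition state_space :: "network \<Rightarrow> vseq set" where
  "state_space S = lp_space (exp_p S) (dim_x S) (norm_x S)"

definition state_norm :: "network \<Rightarrow> vseq \<Rightarrow> real" where
  "state_norm S = lp_norm (exp_p S) (norm_x S)"

definition state_top :: "network \<Rightarrow> vseq topology" where
  "state_top S = norm_topology (state_space S) (state_norm S)"

definition input_values :: "network \<Rightarrow> vseq set" where
  "input_values S = lp_space (exp_q S) (dim_u S) (norm_u S)"

definition input_value_norm :: "network \<Rightarrow> vseq \<Rightarrow> real" where
  "input_value_norm S = lp_norm (exp_q S) (norm_u S)"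

definition inputs :: "network \<Rightarrow> (real \<Rightarrow> vseq) set" where
  "inputs S = {u. strongly_measurable_on (input_values S) (input_value_norm S) {0..} u \<and>
                  (\<exists>c. AE t in lebesgue_on {0..}. input_value_norm S (u t) \<le> c)}"

definition input_norm :: "network \<Rightarrow> (real \<Rightarrow> vseq) \<Rightarrow> real" where
  "input_norm S u =
     real_of_ereal (esssup (lebesgue_on {0..}) (\<lambda>t. ereal (input_value_norm S (u t))))"


subsection \<open>Subsystems\<close>

definition internal_inputs :: "network \<Rightarrow> (real \<Rightarrow> vseq) set" where
  "internal_inputs S = {w. continuous_map (top_of_set {0..}) (state_top S) w}"

definition measurable_sub_input :: "network \<Rightarrow> nat \<Rightarrow> (real \<Rightarrow> vect) \<Rightarrow> bool" where
  "measurable_sub_input S i v \<longleftrightarrow>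
     (\<forall>t\<ge>0. v t \<in> sub_inputs S i) \<and>
     (\<forall>k. (\<lambda>t. v t k) \<in> borel_measurable (lebesgue_on {0..}))"

definition Linf_loc_sub_inputs :: "network \<Rightarrow> nat \<Rightarrow> (real \<Rightarrow> vect) set" where
  "Linf_loc_sub_inputs S i = {v. measurable_sub_input S i v \<and>
     (\<forall>T\<ge>0. \<exists>c. AE t in lebesgue_on {0..T}. norm_u S i (v t) \<le> c)}"

definition Linf_sub_inputs :: "network \<Rightarrow> nat \<Rightarrow> (real \<Rightarrow> vect) set" where
  "Linf_sub_inputs S i = {v. measurable_sub_input S i v \<and>
     (\<exists>c. AE t in lebesgue_on {0..}. norm_u S i (v t) \<le> c)}"

definition sub_solution ::
  "network \<Rightarrow> nat \<Rightarrow> vect \<Rightarrow> (real \<Rightarrow> vseq) \<Rightarrow> (real \<Rightarrow> vect) \<Rightarrow> ereal \<Rightarrow> (real \<Rightarrow> vect) \<Rightarrow> bool" where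
  "sub_solution S i x0 w v T x \<longleftrightarrow>
     0 < T \<and>
     continuous_map (top_of_set {t. 0 \<le> t \<and> ereal t < T}) (sub_state_top S i) x \<and>
     (\<forall>t. 0 \<le> t \<and> ereal t < T \<longrightarrow>
        (\<forall>k < dim_x S i.
           set_integrable lebesgue {0..t} (\<lambda>s. rhs S i (x s) (w s) (v s) k) \<and>
           x t k = x0 k + (LINT s:{0..t}|lebesgue. rhs S i (x s) (w s) (v s) k)))"

definition sub_max_time ::
  "network \<Rightarrow> nat \<Rightarrow> vect \<Rightarrow> (real \<Rightarrow> vseq) \<Rightarrow> (real \<Rightarrow> vect) \<Rightarrow> ereal" where
  "sub_max_time S i x0 w v = max_time (sub_solution S i x0 w v)"

definition sub_flow ::
  "network \<Rightarrow> nat \<Rightarrow> vect \<Rightarrow> (real \<Rightarrow> vseq) \<Rightarrow> (real \<Rightarrow> vect) \<Rightarrow> real \<Rightarrow> vect" where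
  "sub_flow S i x0 w v = max_solution (sub_solution S i x0 w v)"

definition neighbors :: "network \<Rightarrow> nat \<Rightarrow> nat set" where
  "neighbors S i = {j. \<exists>x\<in>sub_states S i. \<exists>v\<in>sub_inputs S i.
     \<exists>w\<in>state_space S. \<exists>w'\<in>state_space S.
       (\<forall>k. k \<noteq> j \<longrightarrow> w k = w' k) \<and> rhs S i x w v \<noteq> rhs S i x w' v}"

text \<open>Standing assumptions; well-posedness of the interconnection is not among them.\<close>

definition infinite_network :: "network \<Rightarrow> bool" where
  "infinite_network S \<longleftrightarrow>
     1 \<le> exp_p S \<and> 1 \<le> exp_q S \<and>
     (\<forall>i. 0 < dim_x S i \<and> is_norm_on_Rn (dim_x S i) (norm_x S i)) \<and>
     (\<forall>i. 0 < dim_u S i \<and> is_norm_on_Rn (dim_u S i) (norm_u S i)) \<and>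
     (\<forall>i. continuous_map
            (prod_topology (sub_state_top S i) (prod_topology (state_top S) (sub_input_top S i)))
            (sub_state_top S i) (\<lambda>(x, w, v). rhs S i x w v)) \<and>
     (\<forall>i. \<forall>x0\<in>sub_states S i. \<forall>w\<in>internal_inputs S. \<forall>v\<in>Linf_loc_sub_inputs S i.
            uniquely_solvable (sub_solution S i x0 w v)) \<and>
     (\<forall>i. i \<notin> neighbors S i)"


subsection \<open>Interconnection\<close>

definition network_rhs :: "network \<Rightarrow> vseq \<Rightarrow> vseq \<Rightarrow> vseq" where
  "network_rhs S x u = (\<lambda>i. rhs S i (x i) x (u i))"

definition network_solution ::
  "network \<Rightarrow> vseq \<Rightarrow> (real \<Rightarrow> vseq) \<Rightarrow> ereal \<Rightarrow> (real \<Rightarrow> vseq) \<Rightarrow> bool" where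
  "network_solution S x0 u T x \<longleftrightarrow>
     0 < T \<and>
     continuous_map (top_of_set {t. 0 \<le> t \<and> ereal t < T}) (state_top S) x \<and>
     (\<forall>t. 0 \<le> t \<and> ereal t < T \<longrightarrow>
        network_rhs S (x t) (u t) \<in> state_space S \<and>
        has_bochner_integral_on (state_space S) (state_norm S) {0..t}
          (\<lambda>s. network_rhs S (x s) (u s)) (x t - x0))"

definition well_posed :: "network \<Rightarrow> bool" where
  "well_posed S \<longleftrightarrow>
     (\<forall>x0\<in>state_space S. \<forall>u\<in>inputs S. uniquely_solvable (network_solution S x0 u))"

definition flow_time :: "network \<Rightarrow> vseq \<Rightarrow> (real \<Rightarrow> vseq) \<Rightarrow> ereal" where
  "flow_time S x0 u = max_time (network_solution S x0 u)"

definition flow :: "network \<Rightarrow> vseq \<Rightarrow> (real \<Rightarrow> vseq) \<Rightarrow> real \<Rightarrow> vseq" where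
  "flow S x0 u = max_solution (network_solution S x0 u)"

definition forward_complete :: "network \<Rightarrow> bool" where
  "forward_complete S \<longleftrightarrow> (\<forall>x0\<in>state_space S. \<forall>u\<in>inputs S. flow_time S x0 u = \<infinity>)"


section \<open>Exponential input-to-state stability\<close>

definition upper_dini :: "(real \<Rightarrow> real) \<Rightarrow> real \<Rightarrow> ereal" where
  "upper_dini g t = Limsup (at_right 0) (\<lambda>h. ereal ((g (t + h) - g t) / h))"

definition lower_dini :: "(real \<Rightarrow> real) \<Rightarrow> real \<Rightarrow> ereal" where
  "lower_dini g t = Liminf (at_right 0) (\<lambda>h. ereal ((g (t + h) - g t) / h))"

definition orbital_dini :: "network \<Rightarrow> (vseq \<Rightarrow> real) \<Rightarrow> (real \<Rightarrow> vseq) \<Rightarrow> vseq \<Rightarrow> ereal" where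
  "orbital_dini S V u x = upper_dini (\<lambda>t. V (flow S x u t)) 0"

definition class_K :: "(real \<Rightarrow> real) \<Rightarrow> bool" where
  "class_K g \<longleftrightarrow> continuous_on {0..} g \<and> strict_mono_on {0..} g \<and> g 0 = 0"

definition state_distance :: "network \<Rightarrow> vseq set \<Rightarrow> vseq \<Rightarrow> real" where
  "state_distance S A x = set_distance (state_norm S) A x"

text \<open>
  The estimate is required wherever the maximal solution exists; for a forward complete
  network this means at all nonnegative times.
\<close>

definition eISS_estimate :: "network \<Rightarrow> vseq set \<Rightarrow> bool" where
  "eISS_estimate S A \<longleftrightarrow>
     (\<exists>a>0. \<exists>M>0. \<exists>g. class_K g \<and>
        (\<forall>x0\<in>state_space S. \<forall>u\<in>inputs S. \<forall>t. 0 \<le> t \<and> ereal t < flow_time S x0 u \<longrightarrow>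
           state_distance S A (flow S x0 u t)
             \<le> M * exp (- a * t) * state_distance S A x0 + g (input_norm S u)))"

definition eISS :: "network \<Rightarrow> vseq set \<Rightarrow> bool" where
  "eISS S A \<longleftrightarrow>
     A \<noteq> {} \<and> closedin (state_top S) A \<and> forward_complete S \<and> eISS_estimate S A"

definition eISS_Lyapunov_function :: "network \<Rightarrow> vseq set \<Rightarrow> (vseq \<Rightarrow> real) \<Rightarrow> bool" where
  "eISS_Lyapunov_function S A V \<longleftrightarrow>
     A \<noteq> {} \<and> closedin (state_top S) A \<and>
     (\<forall>x\<in>state_space S. 0 \<le> V x) \<and>
     continuous_map (subtopology (state_top S) (state_space S - A)) euclideanreal V \<and>
     (\<exists>w1>0. \<exists>w2>0. \<exists>b>0. \<exists>\<kappa>>0. \<exists>g. class_K g \<and> (\<forall>c. \<exists>r\<ge>0. c < g r) \<and>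
        (\<forall>x\<in>state_space S. w1 * state_distance S A x powr b \<le> V x \<and>
                           V x \<le> w2 * state_distance S A x powr b) \<and>
        (\<forall>x\<in>state_space S - A. \<forall>u\<in>inputs S.
           orbital_dini S V u x \<le> ereal (- \<kappa> * V x + g (input_norm S u))))"


section \<open>Spectral radius of an infinite matrix on the space of summable sequences\<close>

text \<open>
  As usual, the spectrum of a real operator is that of its complexification, which
  is the operator given by the same matrix on complex sequences.
\<close>

definition l1_space :: "(nat \<Rightarrow> complex) set" where
  "l1_space = {z. summable (\<lambda>j. cmod (z j))}"

definition l1_norm :: "(nat \<Rightarrow> complex) \<Rightarrow> real" where
  "l1_norm z = (\<Sum>j. cmod (z j))"

definition matrix_shift ::
  "complex \<Rightarrow> (nat \<Rightarrow> nat \<Rightarrow> real) \<Rightarrow> (nat \<Rightarrow> complex) \<Rightarrow> nat \<Rightarrow> complex" where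
  "matrix_shift l B z = (\<lambda>i. l * z i - (\<Sum>j. complex_of_real (B i j) * z j))"

definition l1_spectrum :: "(nat \<Rightarrow> nat \<Rightarrow> real) \<Rightarrow> complex set" where
  "l1_spectrum B = {l. \<not> (bij_betw (matrix_shift l B) l1_space l1_space \<and>
     (\<exists>c. \<forall>z\<in>l1_space. l1_norm z \<le> c * l1_norm (matrix_shift l B z)))}"

definition l1_spectral_radius :: "(nat \<Rightarrow> nat \<Rightarrow> real) \<Rightarrow> ereal" where
  "l1_spectral_radius B = (SUP l\<in>l1_spectrum B. ereal (cmod l))"

end

theory Submission
  imports Defs
begin

text \<open>
  Since the spectral radius of the gain operator is less than 1, there are bounded weights that its
  transpose contracts pointwise. Indeed, let l be the infimum of the numbers for which bounded
  weights are multiplied by at most that number; if l were at least 1, the resolvent bound at l would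
  show that the Neumann series of the transpose, applied to the constant 1 slightly above l,
  stays bounded, and its sum would be a weight for a number below l. Adding a multiple of these
  weights, divided by the decay rates, to the constant 1 keeps the weights away from 0.

  Each subsystem estimate holds only almost everywhere and off the attractor, but together with the
  finiteness of the lower Dini derivative it can be integrated along the trajectories of the network.
  The weighted sum of the integrated estimates yields
  V(x(t)) + k * (integral of V(x) from s to t) <= V(x(s)) + c * (t - s), which gives the
  Dini derivative at 0 and, by comparison, exponential decay. The distance to the product set is the
  p-norm of the distances of the components, whence the two-sided bound of V.
\<close>

section \<open>Subinvariant weights of a nonnegative matrix\<close>

text \<open>When weighted estimates are added, \<open>V_j\<close> collects column j of the weighted
  gains; so the weights live in the dual space of bounded sequences, and the transpose has to
  contract them. From the spectrum only real points from 1 on are used: nonnegativity of the matrix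
  and the infimum argument take the place of a spectral radius formula. Unbounded decay rates are
  the main obstacle. Weights divided by the rates may tend to 0, hence the added constant 1; and the
  series of rate times weight times \<open>V_i\<close> may diverge, so only integrated partial sums
  are added, with a reduced coupling weight whose total is finite and cancels. Each subsystem
  estimate starts outside \<open>A_i\<close> and has a null set depending on the start, while a
  network trajectory may enter and leave \<open>A_i\<close>. Truncation and restarts at rational
  times handle this. Finiteness of the lower Dini derivative at every time excludes growth hidden in
  a null set, as for the Cantor function. The decay estimate is obtained on the interval of
  existence; forward completeness is the premise of the final eISS claim.\<close>

lemma infsum_UNIV_nat_eq_suminf:
  fixes f :: "nat \<Rightarrow> 'a::banach"
  assumes "f summable_on UNIV"
  shows "infsum f UNIV = suminf f"
  using sums_unique[OF has_sum_imp_sums[OF has_sum_infsum[OF assms]]] .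

text \<open>Fubini for absolutely convergent double series: unordered sums over pairs are symmetric
  in the two indices, and they agree with ordered series once absolute summability is known.\<close>

lemma sums_suminf_swap:
  fixes a :: "nat \<Rightarrow> nat \<Rightarrow> 'a::banach"
  assumes col: "\<And>j. summable (\<lambda>i. norm (a i j))"
    and tot: "summable (\<lambda>j. \<Sum>i. norm (a i j))"
  shows "(\<lambda>i. \<Sum>j. a i j) sums (\<Sum>j. \<Sum>i. a i j)"
proof -
  have cs: "(\<lambda>i. norm (a i j)) summable_on UNIV" for j
    using col[of j] by (intro norm_summable_imp_summable_on) simp
  have ceq: "(\<Sum>\<^sub>\<infinity>i. norm (a i j)) = (\<Sum>i. norm (a i j))" for j
    using cs[of j] by (intro infsum_UNIV_nat_eq_suminf) simp
  have "(\<lambda>j. norm (\<Sum>i. norm (a i j))) summable_on UNIV"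
    using tot by (intro norm_summable_imp_summable_on) (simp add: suminf_nonneg col)
  then have J: "(\<lambda>x. norm (case x of (j, i) \<Rightarrow> a i j)) summable_on UNIV \<times> UNIV"
    using cs by (subst Infinite_Sum.abs_summable_on_Sigma_iff) (simp add: ceq)
  then have J1: "(\<lambda>(j, i). a i j) summable_on UNIV \<times> UNIV"
    by (rule Infinite_Sum.abs_summable_summable)
  then have J2: "(\<lambda>(i, j). a i j) summable_on UNIV \<times> UNIV"
    by (subst product_swap[symmetric], subst summable_on_reindex) (simp_all add: o_def case_prod_unfold)
  \<comment> \<open>Every entry of a row is at most the absolute sum of its column, and these column
    totals are summable by \<open>tot\<close>.\<close>
  have rs: "a i summable_on UNIV" for i
  proof (intro norm_summable_imp_summable_on summable_comparison_test[OF _ tot] exI allI impI)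
    fix j
    show "norm (norm (a i j)) \<le> (\<Sum>i. norm (a i j))"
      using sum_le_suminf[OF col, of "{i}" j] by simp
  qed
  have "(\<lambda>i. infsum (a i) UNIV) summable_on UNIV"
    by (rule summable_on_Sigma_banach[OF J2])
  then have "(\<lambda>i. infsum (a i) UNIV) sums (\<Sum>\<^sub>\<infinity>i. infsum (a i) UNIV)"
    by (intro has_sum_imp_sums has_sum_infsum)
  also have "(\<Sum>\<^sub>\<infinity>i. infsum (a i) UNIV) = (\<Sum>\<^sub>\<infinity>j. \<Sum>\<^sub>\<infinity>i. a i j)"
    by (rule infsum_swap_banach[OF J2])
  also have "\<dots> = (\<Sum>j. \<Sum>\<^sub>\<infinity>i. a i j)"
    by (intro infsum_UNIV_nat_eq_suminf summable_on_Sigma_banach[OF J1])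
  also have "\<dots> = (\<Sum>j. \<Sum>i. a i j)"
    using Infinite_Sum.abs_summable_summable[OF cs] by (simp add: infsum_UNIV_nat_eq_suminf)
  finally show ?thesis
    by (simp add: infsum_UNIV_nat_eq_suminf[OF rs])
qed

text \<open>Bounding the partial sums includes the convergence of the column sums.\<close>

definition subinvariant :: "(nat \<Rightarrow> nat \<Rightarrow> real) \<Rightarrow> real \<Rightarrow> (nat \<Rightarrow> real) \<Rightarrow> bool" where
  "subinvariant B l m \<longleftrightarrow> (\<forall>n j. (\<Sum>i<n. m i * B i j) \<le> l * m j)"

lemma subinvariant_nonneg:
  assumes "subinvariant B l m" "1 \<le> m 0"
  shows "0 \<le> l"
proof -
  have "0 \<le> l * m 0"
    using assms(1) unfolding subinvariant_def by (metis lessThan_0 sum.empty)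
  then show ?thesis using assms(2) by (simp add: zero_le_mult_iff)
qed

text \<open>The column sums of the k-th power of B; equivalently, the k-th iterate of the transpose
  applied to the constant sequence 1.\<close>

primrec power_column_sum :: "(nat \<Rightarrow> nat \<Rightarrow> real) \<Rightarrow> nat \<Rightarrow> nat \<Rightarrow> real" where
  "power_column_sum B 0 j = 1"
| "power_column_sum B (Suc k) j = (\<Sum>i. power_column_sum B k i * B i j)"

lemma nonneg_bounded_partial_sums:
  fixes f :: "nat \<Rightarrow> real"
  assumes "\<And>i. 0 \<le> f i" "\<And>n. (\<Sum>i<n. f i) \<le> c"
  shows "summable f" "suminf f \<le> c"
proof -
  show "summable f"
    by (rule bounded_imp_summable[of f c]) (use assms(1) assms(2)[of "Suc _"] in \<open>auto simp: lessThan_Suc_atMost\<close>)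
  then show "suminf f \<le> c"
    by (rule suminf_le_const) (rule assms(2))
qed

section \<open>Duality and Neumann series for a nonnegative matrix that is bounded on summable
  sequences\<close>

locale nonneg_matrix =
  fixes B :: "nat \<Rightarrow> nat \<Rightarrow> real" and K :: real
  assumes nonneg: "0 \<le> B i j"
    and column_sum_le: "(\<Sum>i<n. B i j) \<le> K"
begin

lemma K_nonneg: "0 \<le> K"
  using column_sum_le[where n = 0] by simp

lemma weighted_column_summable:
  assumes "\<And>i. \<bar>w i\<bar> \<le> W"
  shows "summable (\<lambda>i. \<bar>w i * B i j\<bar>)" "(\<Sum>i. \<bar>w i * B i j\<bar>) \<le> W * K"
proof -
  have W: "0 \<le> W" using assms[of 0] by linarith
  have "(\<Sum>i<n. \<bar>w i * B i j\<bar>) \<le> (\<Sum>i<n. W * B i j)" for n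
    by (intro sum_mono) (use assms nonneg in \<open>simp add: abs_mult mult_right_mono\<close>)
  also have "(\<Sum>i<n. W * B i j) \<le> W * K" for n
    using column_sum_le[where n = n and j = j] W by (simp add: sum_distrib_left[symmetric] mult_left_mono)
  finally have "(\<Sum>i<n. \<bar>w i * B i j\<bar>) \<le> W * K" for n .
  then show "summable (\<lambda>i. \<bar>w i * B i j\<bar>)" "(\<Sum>i. \<bar>w i * B i j\<bar>) \<le> W * K"
    by (auto intro!: nonneg_bounded_partial_sums)
qed

text \<open>The transpose is monotone and 1 lies below \<open>m\<close>, so the iterates on 1 lie
  below those on \<open>m\<close>, where each application costs at most the factor
  \<open>l\<close>.\<close>

lemma power_column_sum_bounds:
  assumes m: "\<And>i. 1 \<le> m i" "\<And>i. m i \<le> C" and sub: "subinvariant B l m"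
  shows "0 \<le> power_column_sum B k j \<and> power_column_sum B k j \<le> l ^ k * m j"
proof (induction k arbitrary: j)
  case 0
  then show ?case using m by simp
next
  case (Suc k)
  have C: "0 \<le> C" using m(1)[of 0] m(2)[of 0] by linarith
  have l: "0 \<le> l"
    using subinvariant_nonneg[OF sub m(1)] .
  have nn: "0 \<le> power_column_sum B k i * B i j" for i
    using Suc nonneg by simp
  have "(\<Sum>i<n. power_column_sum B k i * B i j) \<le> (\<Sum>i<n. l ^ k * (m i * B i j))" for n
    by (intro sum_mono) (use Suc nonneg in \<open>simp add: mult.assoc[symmetric] mult_right_mono\<close>)
  also have "(\<Sum>i<n. l ^ k * (m i * B i j)) \<le> l ^ k * (l * m j)" for n
    using sub l unfolding sum_distrib_left[symmetric] subinvariant_def by (simp add: mult_left_mono)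
  finally have "(\<Sum>i<n. power_column_sum B k i * B i j) \<le> l ^ Suc k * m j" for n
    by (simp add: mult_ac)
  from nonneg_bounded_partial_sums[OF nn this] nn show ?case
    by (auto intro: suminf_nonneg)
qed

text \<open>Duality: pairing a bounded \<open>w\<close> with the matrix applied to \<open>z\<close>
  equals pairing the transpose applied to \<open>w\<close> with \<open>z\<close>. The exchange of
  sums is justified by absolute convergence.\<close>

lemma pairing_sums:
  fixes z :: "nat \<Rightarrow> complex"
  assumes w: "\<And>i. \<bar>w i\<bar> \<le> W" and z: "z \<in> l1_space"
  shows "(\<lambda>i. complex_of_real (w i) * (\<Sum>j. complex_of_real (B i j) * z j))
           sums (\<Sum>j. complex_of_real (\<Sum>i. w i * B i j) * z j)"
proof -
  let ?a = "\<lambda>i j. complex_of_real (w i * B i j) * z j"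
  have zs: "summable (\<lambda>j. cmod (z j))" using z by (simp add: l1_space_def)
  have W: "0 \<le> W" using w[of 0] by linarith
  have na: "norm (?a i j) = \<bar>w i * B i j\<bar> * cmod (z j)" for i j
    by (simp only: norm_mult norm_of_real)
  have wB: "summable (\<lambda>i. \<bar>w i * B i j\<bar>)" "(\<Sum>i. \<bar>w i * B i j\<bar>) \<le> W * K" for j
    using weighted_column_summable[OF w, where j = j] by auto
  have tot: "summable (\<lambda>j. \<Sum>i. norm (?a i j))"
  proof (rule summable_comparison_test[OF _ summable_mult[OF zs, of "W * K"]], intro exI allI impI)
    fix j
    have "(\<Sum>i. norm (?a i j)) = (\<Sum>i. \<bar>w i * B i j\<bar>) * cmod (z j)"
      unfolding na using suminf_mult2[OF wB(1)[of j], of "cmod (z j)"] by simp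
    moreover have "0 \<le> (\<Sum>i. \<bar>w i * B i j\<bar>)"
      using wB(1) by (intro suminf_nonneg) auto
    ultimately show "norm (\<Sum>i. norm (?a i j)) \<le> W * K * cmod (z j)"
      using wB(2)[of j] by (simp add: mult_right_mono)
  qed
  have "(\<lambda>i. \<Sum>j. ?a i j) sums (\<Sum>j. \<Sum>i. ?a i j)"
  proof (rule sums_suminf_swap[OF _ tot])
    show "summable (\<lambda>i. norm (?a i j))" for j
      unfolding na by (rule summable_mult2[OF wB(1)])
  qed
  moreover have "(\<Sum>i. ?a i j) = complex_of_real (\<Sum>i. w i * B i j) * z j" for j
  proof -
    have "summable (\<lambda>i. w i * B i j)"
      using wB(1)[of j] by (rule summable_rabs_cancel)
    then show ?thesis
      unfolding suminf_of_real[OF \<open>summable (\<lambda>i. w i * B i j)\<close>]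
      by (intro suminf_mult2[symmetric] summable_of_real)
  qed
  moreover have "(\<Sum>j. ?a i j) = complex_of_real (w i) * (\<Sum>j. complex_of_real (B i j) * z j)" for i
  proof -
    have "B i j \<le> K" for j
      using member_le_sum[of i "{..<Suc i}" "\<lambda>i. B i j"] column_sum_le[where n="Suc i" and j=j] nonneg by auto
    then have "summable (\<lambda>j. complex_of_real (B i j) * z j)"
      using nonneg K_nonneg
      by (intro summable_norm_cancel[OF summable_comparison_test[OF _ summable_mult[OF zs, of K]]])
         (auto simp: norm_mult intro!: exI mult_right_mono)
    then show ?thesis
      by (subst suminf_mult[symmetric]) (simp_all add: mult.assoc)
  qed
  ultimately show ?thesis by simp
qed

lemma l1_norm_triangle:
  assumes "z \<in> l1_space" "y \<in> l1_space"
  shows "l1_norm (\<lambda>i. z i + e * y i) \<le> l1_norm z + cmod e * l1_norm y"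
proof -
  have s: "summable (\<lambda>i. cmod (z i))" "summable (\<lambda>i. cmod e * cmod (y i))"
    using assms by (auto simp: l1_space_def)
  have le: "cmod (z i + e * y i) \<le> cmod (z i) + cmod e * cmod (y i)" for i
    using norm_triangle_ineq[of "z i" "e * y i"] by (simp add: norm_mult)
  have "summable (\<lambda>i. cmod (z i + e * y i))"
    by (rule summable_comparison_test[OF _ summable_add[OF s]]) (use le in auto)
  then have "l1_norm (\<lambda>i. z i + e * y i) \<le> (\<Sum>i. cmod (z i) + cmod e * cmod (y i))"
    unfolding l1_norm_def by (intro suminf_le le summable_add s)
  also have "\<dots> = l1_norm z + cmod e * l1_norm y"
    using s assms unfolding l1_norm_def l1_space_def by (simp add: suminf_add[symmetric] suminf_mult)
  finally show ?thesis .
qed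

text \<open>The column j of the resolvent at l dominates the Neumann series of the transposed matrix,
  applied to the constant sequence 1.\<close>

lemma neumann_partial_sum_le_l1_norm:
  assumes m: "\<And>i. 1 \<le> m i" "\<And>i. m i \<le> C" and sub: "subinvariant B l' m"
    and l: "l' < l" and z: "z \<in> l1_space"
    and eq: "matrix_shift (complex_of_real l) B z = (\<lambda>i. if i = j then 1 else 0)"
  shows "(\<Sum>k<n. power_column_sum B k j / l ^ Suc k) \<le> l1_norm z"
proof -
  let ?w = "power_column_sum B"
  note w = power_column_sum_bounds[OF m sub]
  have l': "0 \<le> l'"
    using subinvariant_nonneg[OF sub m(1)] .
  have lpos: "0 < l" using l l' by simp
  have wb: "\<bar>?w k i\<bar> \<le> l' ^ k * C" for k i
    using w[of k i] mult_left_mono[OF m(2)[of i], of "l' ^ k"] l' by auto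
  have zs: "summable (\<lambda>j. cmod (z j))" using z by (simp add: l1_space_def)
  \<comment> \<open>The pairing of the k-th iterate of the transpose on 1 with the resolvent column
    \<open>z\<close>.\<close>
  define s where "s k = (\<Sum>i. complex_of_real (?w k i) * z i)" for k
  have ssum: "summable (\<lambda>i. cmod (complex_of_real (?w k i) * z i))" for k
    by (rule summable_comparison_test[OF _ summable_mult[OF zs, of "l' ^ k * C"]])
       (use wb in \<open>auto simp: norm_mult intro!: exI mult_right_mono\<close>)
  have snorm: "cmod (s k) \<le> l' ^ k * C * l1_norm z" for k
  proof -
    have "cmod (s k) \<le> (\<Sum>i. cmod (complex_of_real (?w k i) * z i))"
      unfolding s_def by (rule summable_norm[OF ssum])
    also have "\<dots> \<le> (\<Sum>i. l' ^ k * C * cmod (z i))"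
      using wb by (intro suminf_le ssum summable_mult zs) (simp add: norm_mult mult_right_mono)
    finally show ?thesis by (simp add: l1_norm_def suminf_mult zs)
  qed
  have "cmod (s 0) \<le> l1_norm z"
    unfolding s_def l1_norm_def using summable_norm[OF zs] by simp
  \<comment> \<open>The resolvent equation \<open>eq\<close> is paired with the k-th iterate; by
    duality the matrix term becomes the pairing with the next iterate, and the unit vector picks out
    entry j.\<close>
  moreover have rec: "l * s k = complex_of_real (?w k j) + s (Suc k)" for k
  proof -
    have 1: "(\<lambda>i. complex_of_real (?w k i) * (\<Sum>j. complex_of_real (B i j) * z j)) sums s (Suc k)"
      using pairing_sums[OF wb z] by (simp add: s_def)
    have 2: "(\<lambda>i. complex_of_real (?w k i) * (if i = j then 1 else 0)) sums complex_of_real (?w k j)"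
      using sums_single[of j "\<lambda>i. complex_of_real (?w k i)"] by (simp add: if_distrib cong: if_cong)
    have e: "complex_of_real l * z i = (\<Sum>j. complex_of_real (B i j) * z j) + (if i = j then 1 else 0)" for i
      using fun_cong[OF eq, of i] unfolding matrix_shift_def by (simp add: algebra_simps)
    have "complex_of_real (?w k i) * (\<Sum>j. complex_of_real (B i j) * z j)
         + complex_of_real (?w k i) * (if i = j then 1 else 0) = l * (complex_of_real (?w k i) * z i)" for i
      unfolding mult.left_commute[of "complex_of_real l"] e[of i] by (simp only: distrib_left)
    then have 3: "(\<lambda>i. l * (complex_of_real (?w k i) * z i)) sums (s (Suc k) + complex_of_real (?w k j))"
      using sums_add[OF 1 2] by simp
    have 4: "(\<lambda>i. l * (complex_of_real (?w k i) * z i)) sums (l * s k)"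
      unfolding s_def by (intro sums_mult summable_sums summable_norm_cancel[OF ssum])
    show ?thesis using sums_unique2[OF 4 3] by simp
  qed
  have tele: "s 0 = complex_of_real (\<Sum>k<n. ?w k j / l ^ Suc k) + s n / l ^ n" for n
  proof (induction n)
    case (Suc n)
    have "s n = (complex_of_real (?w n j) + s (Suc n)) / l"
      using rec[of n] lpos by (simp add: field_simps)
    with Suc show ?case using lpos by (simp add: field_simps)
  qed simp
  \<comment> \<open>The remainder after \<open>N\<close> steps is of order
    \<open>(l' / l) ^ N\<close>, because the iterates grow at most like powers of \<open>l'\<close>,
    which is smaller than \<open>l\<close>.\<close>
  have upper: "(\<Sum>k<N. ?w k j / l ^ Suc k) \<le> cmod (s 0) + C * l1_norm z * (l' / l) ^ N" for N
  proof -
    have "(\<Sum>k<N. ?w k j / l ^ Suc k) \<le> cmod (complex_of_real (\<Sum>k<N. ?w k j / l ^ Suc k))"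
      unfolding norm_of_real by simp
    also have "\<dots> = cmod (s 0 - s N / l ^ N)"
      using tele[of N] by simp
    also have "\<dots> \<le> cmod (s 0) + cmod (s N / l ^ N)"
      by (rule norm_triangle_ineq4)
    also have "cmod (s N / l ^ N) \<le> C * l1_norm z * (l' / l) ^ N"
      using snorm[of N] lpos by (simp add: norm_divide norm_power field_simps)
    finally show ?thesis by simp
  qed
  have lim: "(\<lambda>N. cmod (s 0) + C * l1_norm z * (l' / l) ^ N) \<longlonglongrightarrow> cmod (s 0) + C * l1_norm z * 0"
    by (intro tendsto_intros LIMSEQ_power_zero) (use l l' in auto)
  have "(\<Sum>k<n. ?w k j / l ^ Suc k) \<le> cmod (s 0) + C * l1_norm z * 0"
  proof (rule LIMSEQ_le_const[OF lim], intro exI allI impI)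
    fix N assume "n \<le> N"
    then have "(\<Sum>k<n. ?w k j / l ^ Suc k) \<le> (\<Sum>k<N. ?w k j / l ^ Suc k)"
      using w lpos by (intro sum_mono2) auto
    with upper[of N] show "(\<Sum>k<n. ?w k j / l ^ Suc k) \<le> cmod (s 0) + C * l1_norm z * (l' / l) ^ N"
      by simp
  qed
  ultimately show ?thesis by simp
qed

text \<open>The Neumann sum \<open>nu\<close> of the transpose at \<open>l\<close> solves "transpose
  of \<open>nu\<close> equals \<open>l * nu - 1\<close>". Since \<open>nu\<close> is at most
  \<open>c\<close>, the subtracted 1 is at least \<open>nu / c\<close>, which lowers the factor from
  \<open>l\<close> to \<open>l - 1 / c\<close>.\<close>

lemma resolvent_weights:
  assumes m: "\<And>i. 1 \<le> m i" "\<And>i. m i \<le> C" and sub: "subinvariant B l' m"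
    and l: "l' < l" and c: "0 < c"
    and res: "\<And>j. \<exists>z\<in>l1_space. l1_norm z \<le> c \<and>
                matrix_shift (complex_of_real l) B z = (\<lambda>i. if i = j then 1 else 0)"
  shows "\<exists>m' C'. (\<forall>i. 1 \<le> m' i \<and> m' i \<le> C') \<and> subinvariant B (l - 1 / c) m'"
proof -
  let ?w = "power_column_sum B"
  note w = power_column_sum_bounds[OF m sub]
  have l': "0 \<le> l'"
    using subinvariant_nonneg[OF sub m(1)] .
  have lpos: "0 < l" using l l' by simp
  have part: "(\<Sum>k<n. ?w k j / l ^ Suc k) \<le> c" for n j
    using res[of j] neumann_partial_sum_le_l1_norm[OF m sub l, of _ j n] by force
  define nu where "nu j = (\<Sum>k. ?w k j / l ^ Suc k)" for j
  have nn: "0 \<le> ?w k j / l ^ Suc k" for k j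
    using w lpos by simp
  have sm: "summable (\<lambda>k. ?w k j / l ^ Suc k)" and nu_le: "nu j \<le> c" for j
    using nonneg_bounded_partial_sums[OF nn part, of j] unfolding nu_def by auto
  \<comment> \<open>Applying the transpose shifts the Neumann series by one index; the term lost is
    the one at k = 0, which equals 1 after multiplication by \<open>l\<close>.\<close>
  have shift: "(\<Sum>k. ?w (Suc k) j / l ^ Suc k) = l * nu j - 1"
    and shift_sm: "summable (\<lambda>k. ?w (Suc k) j / l ^ Suc k)" for j
  proof -
    have s1: "summable (\<lambda>k. l * (?w k j / l ^ Suc k))"
      by (intro summable_mult sm)
    have e: "l * (?w k j / l ^ Suc k) = ?w k j / l ^ k" for k
      using lpos by simp
    have s2: "summable (\<lambda>k. ?w k j / l ^ k)" using s1 unfolding e .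
    show "summable (\<lambda>k. ?w (Suc k) j / l ^ Suc k)"
      using s2 by (subst summable_Suc_iff[of "\<lambda>k. ?w k j / l ^ k"])
    have "(\<Sum>k. ?w (Suc k) j / l ^ Suc k) = (\<Sum>k. ?w k j / l ^ k) - 1"
      using suminf_split_head[OF s2] by simp
    also have "(\<Sum>k. ?w k j / l ^ k) = l * nu j"
      unfolding nu_def using suminf_mult[OF sm, of l j] unfolding e by simp
    finally show "(\<Sum>k. ?w (Suc k) j / l ^ Suc k) = l * nu j - 1" .
  qed
  have nu_ge: "1 \<le> l * nu j" for j
  proof -
    have "(\<Sum>k<1. ?w k j / l ^ Suc k) \<le> nu j"
      unfolding nu_def using nn by (intro sum_le_suminf sm) auto
    then show ?thesis using lpos by (simp add: field_simps)
  qed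
  have "(\<Sum>i<n. nu i * B i j) \<le> (l - 1 / c) * nu j" for n j
  proof -
    have "(\<Sum>i<n. nu i * B i j) = (\<Sum>i<n. \<Sum>k. ?w k i / l ^ Suc k * B i j)"
      unfolding nu_def by (simp only: suminf_mult2[OF sm])
    also have "\<dots> = (\<Sum>k. \<Sum>i<n. ?w k i / l ^ Suc k * B i j)"
      by (intro suminf_sum[symmetric] summable_mult2 sm)
    also have "\<dots> \<le> (\<Sum>k. ?w (Suc k) j / l ^ Suc k)"
    proof (intro suminf_le shift_sm summable_sum summable_mult2 sm)
      fix k
      have wb: "\<bar>?w k i\<bar> \<le> l' ^ k * C" for i
        using w[of k i] mult_left_mono[OF m(2)[of i], of "l' ^ k"] l' by auto
      have "summable (\<lambda>i. ?w k i * B i j)"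
        using summable_rabs_cancel[OF weighted_column_summable(1)[OF wb]] .
      then have "(\<Sum>i<n. ?w k i * B i j) \<le> ?w (Suc k) j"
        using w nonneg by (simp add: sum_le_suminf)
      then have "(\<Sum>i<n. ?w k i * B i j) / l ^ Suc k \<le> ?w (Suc k) j / l ^ Suc k"
        using lpos by (intro divide_right_mono) auto
      then show "(\<Sum>i<n. ?w k i / l ^ Suc k * B i j) \<le> ?w (Suc k) j / l ^ Suc k"
        by (simp add: sum_divide_distrib)
    qed
    also have "\<dots> = l * nu j - 1" by (rule shift)
    also have "\<dots> \<le> (l - 1 / c) * nu j"
      using nu_le[of j] c by (simp add: field_simps)
    finally show ?thesis .
  qed
  \<comment> \<open>The factor \<open>l\<close> normalises the weights: the first Neumann term alone
    gives \<open>nu\<close> at least \<open>1 / l\<close>.\<close>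
  then have "(\<Sum>i<n. l * nu i * B i j) \<le> (l - 1 / c) * (l * nu j)" for n j
    using mult_left_mono[of "\<Sum>i<n. nu i * B i j" "(l - 1 / c) * nu j" l] lpos
    by (simp add: sum_distrib_left mult_ac)
  then have "subinvariant B (l - 1 / c) (\<lambda>i. l * nu i)"
    by (simp add: subinvariant_def)
  moreover have "l * nu i \<le> l * c" for i
    using nu_le lpos by simp
  ultimately show ?thesis
    using nu_ge by (intro exI[of _ "\<lambda>i. l * nu i"] exI[of _ "l * c"]) auto
qed

text \<open>The infimum of the admissible factors cannot be at least 1: there the resolvent exists,
  and \<open>resolvent_weights\<close> slightly above the infimum produces an admissible factor
  strictly below it.\<close>

lemma subinvariant_weights:
  assumes rad: "l1_spectral_radius B < 1"
  shows "\<exists>l m C. 0 \<le> l \<and> l < 1 \<and> (\<forall>i. 1 \<le> m i \<and> m i \<le> C) \<and> subinvariant B l m"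
proof -
  define L where "L = {l. \<exists>m C. (\<forall>i. 1 \<le> m i \<and> m i \<le> C) \<and> subinvariant B l m}"
  have K: "K \<in> L"
    unfolding L_def subinvariant_def using column_sum_le by (intro CollectI exI[of _ "\<lambda>_. 1"] exI[of _ 1]) auto
  have Lpos: "0 \<le> l" if "l \<in> L" for l
    using that subinvariant_nonneg unfolding L_def by blast
  have "\<exists>l\<in>L. l < 1"
  proof (rule ccontr)
    assume "\<not> (\<exists>l\<in>L. l < 1)"
    then have ge: "1 \<le> l" if "l \<in> L" for l using that by force
    define l0 where "l0 = Inf L"
    have l0: "1 \<le> l0" unfolding l0_def using K ge by (intro cInf_greatest) auto
    have bdd: "bdd_below L" using ge by (auto simp: bdd_below_def)
    have notin: "complex_of_real l \<notin> l1_spectrum B" if "1 \<le> l" for l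
    proof
      assume "complex_of_real l \<in> l1_spectrum B"
      then have "ereal (cmod (complex_of_real l)) \<le> l1_spectral_radius B"
        unfolding l1_spectral_radius_def by (rule SUP_upper)
      then have "ereal (cmod (complex_of_real l)) < 1"
        using rad by (rule le_less_trans)
      then show False using that by simp
    qed
    \<comment> \<open>The bound must come from the resolvent at \<open>l0\<close> itself; the one at
      a larger \<open>l\<close> may be too large for the gain \<open>1 / (2 * c)\<close> to reach
      below \<open>l0\<close>.\<close>
    obtain c0 where c0: "\<And>z. z \<in> l1_space \<Longrightarrow> l1_norm z \<le> c0 * l1_norm (matrix_shift (complex_of_real l0) B z)"
      using notin[OF l0] unfolding l1_spectrum_def by blast
    define c where "c = max c0 1"
    have cpos: "0 < c" unfolding c_def by simp
    \<comment> \<open>Small enough that the resolvent bound at \<open>l\<close> is at most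
      \<open>2 * c\<close>, and only half of the gain \<open>1 / (2 * c)\<close> that
      \<open>resolvent_weights\<close> then yields.\<close>
    define l where "l = l0 + 1 / (4 * c)"
    have ll: "l0 < l" "1 \<le> l" unfolding l_def using cpos l0 by (auto simp: add_increasing2)
    \<comment> \<open>The infimum need not be attained, but some admissible factor lies strictly
      below \<open>l\<close>, as the convergence of the Neumann remainder requires.\<close>
    obtain l' where l': "l' \<in> L" "l' < l"
      using cInf_lessD[of L l] ll K unfolding l0_def by auto
    obtain m C where m: "\<And>i. 1 \<le> m i" "\<And>i. m i \<le> C" and sub: "subinvariant B l' m"
      using l'(1) unfolding L_def by blast
    have res: "\<exists>z\<in>l1_space. l1_norm z \<le> 2 * c \<and>
                matrix_shift (complex_of_real l) B z = (\<lambda>i. if i = j then 1 else 0)" for j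
    proof -
      let ?e = "\<lambda>i. if i = j then 1 else 0 :: complex"
      have esum: "(\<lambda>i. cmod (?e i)) sums 1"
        using sums_single[of j "\<lambda>i. 1::real"] by (simp add: if_distrib cong: if_cong)
      have e: "?e \<in> l1_space" "l1_norm ?e = 1"
        using esum unfolding l1_space_def l1_norm_def by (auto simp: sums_iff)
      have "bij_betw (matrix_shift (complex_of_real l) B) l1_space l1_space"
        using notin[OF ll(2)] unfolding l1_spectrum_def by blast
      then obtain z where z: "z \<in> l1_space" "matrix_shift (complex_of_real l) B z = ?e"
        using e(1) unfolding bij_betw_def by (metis imageE)
      let ?d = "complex_of_real (l0 - l)"
      \<comment> \<open>The solution at \<open>l\<close> is read as a solution at \<open>l0\<close>
        with perturbed right-hand side, so that \<open>c0\<close> applies; the perturbation is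
        absorbed since its coefficient times \<open>c\<close> is 1/4.\<close>
      have "matrix_shift (complex_of_real l0) B z = (\<lambda>i. ?e i + ?d * z i)"
        using z(2) unfolding matrix_shift_def by (auto simp: fun_eq_iff algebra_simps split: if_splits)
      then have "l1_norm z \<le> c0 * l1_norm (\<lambda>i. ?e i + ?d * z i)"
        using c0[OF z(1)] by simp
      also have "\<dots> \<le> c * l1_norm (\<lambda>i. ?e i + ?d * z i)"
      proof (rule mult_right_mono)
        have "summable (\<lambda>i. cmod (?e i + ?d * z i))"
          by (rule summable_comparison_test[OF _ summable_add[OF sums_summable[OF esum] summable_mult[of "\<lambda>i. cmod (z i)" "cmod ?d"]]])
             (use z(1) norm_triangle_ineq[of "?e _" "?d * z _"] in \<open>auto simp: l1_space_def norm_mult\<close>)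
        then show "0 \<le> l1_norm (\<lambda>i. ?e i + ?d * z i)"
          unfolding l1_norm_def by (intro suminf_nonneg) auto
      qed (simp add: c_def)
      also have "\<dots> \<le> c * (1 + cmod ?d * l1_norm z)"
        using l1_norm_triangle[OF e(1) z(1), of ?d] e(2) cpos by (intro mult_left_mono) auto
      also have "cmod ?d = 1 / (4 * c)"
        unfolding norm_of_real l_def using cpos by simp
      finally have "l1_norm z \<le> c + l1_norm z / 4"
        using cpos by (simp add: field_simps)
      then have "l1_norm z \<le> 2 * c" using cpos by simp
      then show ?thesis using z by blast
    qed
    have "l - 1 / (2 * c) \<in> L"
      using resolvent_weights[OF m sub l'(2) _ res] cpos unfolding L_def by auto
    then have "l0 \<le> l - 1 / (2 * c)"
      unfolding l0_def using bdd by (rule cInf_lower)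
    then show False unfolding l_def using cpos by (simp add: field_simps)
  qed
  then show ?thesis using Lpos unfolding L_def by blast
qed

end

text \<open>Contraction of \<open>m\<close> by the transpose of \<open>G i j / lam i\<close> becomes
  a statement about \<open>G\<close> for the weights \<open>m i / lam i\<close>. Adding 1 bounds
  these away from 0; the extra column sum, at most \<open>K\<close>, is paid for by raising the
  factor from \<open>l\<close> to \<open>th\<close>.\<close>

lemma network_weights:
  fixes G :: "nat \<Rightarrow> nat \<Rightarrow> real"
  assumes G: "\<And>i j. 0 \<le> G i j" "\<And>n j. (\<Sum>i<n. G i j) \<le> K"
    and lam: "0 < lam_low" "\<And>i. lam_low \<le> lam i"
    and rad: "l1_spectral_radius (\<lambda>i j. G i j / lam i) < 1"
  shows "\<exists>th mu C. 0 \<le> th \<and> th < 1 \<and> (\<forall>i. 1 \<le> mu i \<and> mu i \<le> C) \<and>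
           (\<forall>n j. (\<Sum>i<n. mu i * G i j) \<le> th * (lam j * mu j))"
proof -
  have lp: "0 < lam i" for i using lam(1) lam(2)[of i] by linarith
  interpret nonneg_matrix "\<lambda>i j. G i j / lam i" "K / lam_low"
  proof
    show "0 \<le> G i j / lam i" for i j using G(1) lp[of i] by simp
    show "(\<Sum>i<n. G i j / lam i) \<le> K / lam_low" for n j
    proof -
      have "(\<Sum>i<n. G i j / lam i) \<le> (\<Sum>i<n. G i j / lam_low)"
        using lam G(1) by (intro sum_mono divide_left_mono) (auto simp: lp)
      also have "\<dots> \<le> K / lam_low"
        using G(2)[where n = n and j = j] lam(1) by (simp add: sum_divide_distrib[symmetric] divide_right_mono)
      finally show ?thesis .
    qed
  qed
  obtain l m C where l: "0 \<le> l" "l < 1" and m: "\<And>i. 1 \<le> m i" "\<And>i. m i \<le> C"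
    and sub: "subinvariant (\<lambda>i j. G i j / lam i) l m"
    using subinvariant_weights[OF rad] by blast
  have K: "0 \<le> K" using G(2)[where n = 0] by simp
  define th where "th = (1 + l) / 2"
  \<comment> \<open>Chosen with \<open>a * (th - l) = K\<close>: as \<open>m j\<close> is at least
    1, raising \<open>l\<close> to \<open>th\<close> absorbs the column sum
    \<open>K\<close>.\<close>
  define a where "a = K / (th - l)"
  have th: "l < th" "th < 1" "0 \<le> th" unfolding th_def using l by auto
  have a: "0 \<le> a" "a * (th - l) = K" unfolding a_def using th K by auto
  define mu where "mu i = 1 + a * m i / lam i" for i
  have "1 \<le> mu i" for i
    unfolding mu_def using a(1) m(1)[of i] lp[of i] by simp
  moreover have "mu i \<le> 1 + a * C / lam_low" for i
  proof -
    have "a * m i / lam i \<le> a * C / lam_low"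
      using a(1) m(1)[of i] m(2)[of i] lam by (intro frac_le mult_left_mono) auto
    then show ?thesis by (simp add: mu_def)
  qed
  moreover have "(\<Sum>i<n. mu i * G i j) \<le> th * (lam j * mu j)" for n j
  proof -
    have "(\<Sum>i<n. mu i * G i j) = (\<Sum>i<n. G i j) + a * (\<Sum>i<n. m i * (G i j / lam i))"
      unfolding mu_def by (simp add: sum_distrib_left algebra_simps flip: sum.distrib)
    also have "\<dots> \<le> K + a * (l * m j)"
      using G(2) sub a(1) unfolding subinvariant_def by (intro add_mono mult_left_mono) auto
    also have "\<dots> \<le> a * th * m j"
      using a(2) mult_left_mono[OF m(1)[of j] K] by (simp add: algebra_simps)
    also have "\<dots> \<le> th * (lam j * mu j)"
      unfolding mu_def using lp[of j] th by (simp add: algebra_simps)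
    finally show ?thesis .
  qed
  ultimately show ?thesis using th by blast
qed

section \<open>Lower Dini derivatives and integrals\<close>

lemma lower_dini_less_step:
  assumes "lower_dini g t < ereal c" "0 < d"
  shows "\<exists>s. 0 < s \<and> s < d \<and> g (t + s) - g t < c * s"
proof (rule ccontr)
  assume *: "\<not> ?thesis"
  have "ereal c \<le> lower_dini g t"
    unfolding lower_dini_def
  proof (rule Liminf_bounded)
    have "\<forall>\<^sub>F s in at_right 0. 0 < s \<and> s < d"
      using assms(2) by (auto simp: eventually_at_right_field)
    then show "\<forall>\<^sub>F s in at_right 0. ereal c \<le> ereal ((g (t + s) - g t) / s)"
      proof eventually_elim
      case (elim s)
      then have "c * s \<le> g (t + s) - g t" using * by force
      with elim show ?case by (simp add: le_divide_eq)
    qed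
  qed
  then show False using assms(1) by simp
qed

text \<open>The Henstock sums over fine partial divisions of the interval from a to t are bounded, so
  their supremum serves as an increasing correction term that makes the comparison of g with the
  integral local, although the pointwise bound need not be continuous.\<close>

lemma increment_le_integral:
  fixes g h :: "real \<Rightarrow> real"
  assumes ab: "a \<le> b" and g: "continuous_on {a..b} g" and h: "h integrable_on {a..b}"
    and step: "\<And>t e d. a \<le> t \<Longrightarrow> t < b \<Longrightarrow> 0 < e \<Longrightarrow> 0 < d \<Longrightarrow>
                 \<exists>s. 0 < s \<and> s < d \<and> g (t + s) - g t \<le> (h t + e) * s"
  shows "g b - g a \<le> integral {a..b} h"
proof -
  have main: "g b - g a \<le> integral {a..b} h + e * (1 + (b - a))" if e: "0 < e" for e
  proof -
    \<comment> \<open>Henstock's lemma bounds the sum of absolute errors over every fine partial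
      division, so errors cannot accumulate over arbitrarily many steps.\<close>
    obtain \<gamma> where \<gamma>: "gauge \<gamma>"
      and hen: "\<And>p. p tagged_partial_division_of cbox a b \<Longrightarrow> \<gamma> fine p \<Longrightarrow>
             (\<Sum>(x,K)\<in>p. norm (measure lborel K *\<^sub>R h x - integral K h)) < e"
      using Henstock_lemma[of h a b e] h e by auto
    define P where "P t = {p. p tagged_partial_division_of {a..t} \<and> \<gamma> fine p}" for t :: real
    define s where "s p = (\<Sum>(x,K)\<in>p. norm (measure lborel K *\<^sub>R h x - integral K h))" for p :: "(real \<times> real set) set"
    define F where "F t = (SUP p\<in>P t. s p)" for t
    have Pmono: "P t \<subseteq> P t'" if "t \<le> t'" for t t'
      unfolding P_def tagged_partial_division_of_def using that by fastforce
    have s_le: "s p \<le> e" if "p \<in> P b" for p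
      using hen[of p] that unfolding P_def s_def by auto
    have bdd: "bdd_above (s ` P t)" if "t \<le> b" for t
      using s_le Pmono[OF that] by (auto simp: bdd_above_def)
    have emp: "{} \<in> P t" for t
      by (simp add: P_def fine_def tagged_partial_division_of_def)
    have Fmono: "F t \<le> F t'" if "t \<le> t'" "t' \<le> b" for t t'
      unfolding F_def by (intro cSUP_subset_mono bdd Pmono that) (use emp in auto)
    have Fb: "F b \<le> e"
      unfolding F_def using emp s_le by (intro cSUP_least) auto
    have Fa: "0 \<le> F a"
      unfolding F_def using cSUP_upper[OF emp bdd[OF ab]] by (simp add: s_def)
    \<comment> \<open>Appending the interval from t to \<open>t + r\<close>, tagged at t, to any
      partial division of the interval from a to t stays fine; hence \<open>F\<close> grows at least
      by the error of that step.\<close>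
    have Fstep: "F t + ((h t * r) - integral {t..t + r} h) \<le> F (t + r)"
      if t: "a \<le> t" "0 < r" "t + r \<le> b" and fine: "{t..t + r} \<subseteq> \<gamma> t" for t r
    proof -
      have "F t \<le> F (t + r) - (h t * r - integral {t..t + r} h)"
        unfolding F_def[of t]
      proof (rule cSUP_least)
        fix p assume p: "p \<in> P t"
        let ?p = "insert (t, {t..t + r}) p"
        have pK: "finite p" "\<And>x K. (x, K) \<in> p \<Longrightarrow> K \<subseteq> {a..t}"
          using p unfolding P_def tagged_partial_division_of_def by auto
        have notin: "(t, {t..t + r}) \<notin> p"
          using pK(2)[of t "{t..t + r}"] t by auto
        have dis: "interior {t..t + r} \<inter> interior K = {}" if "(x, K) \<in> p" for x K
        proof -
          have "interior K \<subseteq> {a<..<t}"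
            using interior_mono[OF pK(2)[OF that]] by (simp add: interior_atLeastAtMost_real)
          moreover have "interior {t..t + r} = {t<..<t + r}"
            by (simp add: interior_atLeastAtMost_real)
          ultimately show ?thesis by fastforce
        qed
        have "?p tagged_partial_division_of {a..t + r}"
          unfolding tagged_partial_division_of_def
        proof (intro conjI allI impI; (elim conjE)?)
          show "finite ?p" using pK by simp
          fix x K assume xK: "(x, K) \<in> ?p"
          have "x \<in> K \<and> K \<subseteq> {a..t + r} \<and> (\<exists>a b. K = cbox a b)"
          proof (cases "(x, K) \<in> p")
            case True
            then have "x \<in> K" "K \<subseteq> {a..t}" "\<exists>a b. K = cbox a b"
              using p unfolding P_def tagged_partial_division_of_def by blast+
            moreover have "{a..t} \<subseteq> {a..t + r}" using t by auto
            ultimately show ?thesis by blast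
          next
            case False
            then have "x = t" "K = cbox t (t + r)" using xK by auto
            then show ?thesis using t by auto
          qed
          then show "x \<in> K" "K \<subseteq> {a..t + r}" "\<exists>a b. K = cbox a b" by auto
          fix y L assume yL: "(y, L) \<in> ?p" "(x, K) \<noteq> (y, L)"
          show "interior K \<inter> interior L = {}"
          proof (cases "(x, K) \<in> p")
            case True
            show ?thesis
            proof (cases "(y, L) \<in> p")
              case in_p: True
              have "\<forall>x1 K1 x2 K2. (x1, K1) \<in> p \<and> (x2, K2) \<in> p \<and> (x1, K1) \<noteq> (x2, K2) \<longrightarrow>
                      interior K1 \<inter> interior K2 = {}"
                using p unfolding P_def tagged_partial_division_of_def by simp
              with True in_p yL(2) show ?thesis by (elim allE impE) auto
            next
              case False
              then have "L = {t..t + r}" using yL(1) by simp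
              with dis[OF True] show ?thesis by (simp add: Int_commute)
            qed
          next
            case False
            then have K: "x = t" "K = {t..t + r}" using xK by auto
            then have "(y, L) \<in> p" using yL by auto
            with dis K show ?thesis by simp
          qed
        qed
        moreover have "\<gamma> fine ?p"
          using p fine unfolding P_def fine_def by auto
        ultimately have "?p \<in> P (t + r)" unfolding P_def by simp
        then have "s ?p \<le> F (t + r)"
          unfolding F_def using bdd[OF t(3)] by (intro cSUP_upper)
        moreover have "s ?p = norm (measure lborel {t..t + r} *\<^sub>R h t - integral {t..t + r} h) + s p"
          unfolding s_def using pK(1) notin by simp
        ultimately show "s p \<le> F (t + r) - (h t * r - integral {t..t + r} h)"
          using t by (simp add: mult.commute)
      qed (use emp in auto)
      then show ?thesis by simp
    qed
    \<comment> \<open>The slack of the claim at time t; the goal is that slack plus correction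
      \<open>F\<close> stays nonnegative up to b.\<close>
    define E where "E t = g a + integral {a..t} h + e * (t - a) - g t" for t
    have contE: "continuous_on {a..b} E"
      unfolding E_def using indefinite_integral_continuous_1[OF h] g by (intro continuous_intros)
    define Z where "Z = {t\<in>{a..b}. 0 \<le> E t + F t}"
    have aZ: "a \<in> Z" using ab Fa by (simp add: Z_def E_def)
    define c where "c = Sup Z"
    have bddZ: "bdd_above Z" by (rule bdd_aboveI[of _ b]) (simp add: Z_def)
    have c: "a \<le> c" "c \<le> b"
      unfolding c_def using cSup_upper[OF aZ bddZ] aZ by (auto intro!: cSup_least simp: Z_def)
    \<comment> \<open>\<open>F\<close> may jump, but it is increasing: together with continuity of
      \<open>E\<close> this suffices to pass to a supremum from the left.\<close>
    have cZ: "c \<in> Z"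
    proof (rule ccontr)
      assume "c \<notin> Z"
      then have "E c < - F c" using c by (simp add: Z_def)
      moreover have "(E \<longlongrightarrow> E c) (at c within {a..b})"
        using contE c by (auto simp: continuous_on_def)
      ultimately have "\<forall>\<^sub>F t in at c within {a..b}. E t < - F c"
        by (rule order_tendstoD(2)[rotated])
      then obtain d where d: "0 < d" "\<And>t. t \<in> {a..b} \<Longrightarrow> t \<noteq> c \<Longrightarrow> dist t c < d \<Longrightarrow> E t < - F c"
        unfolding eventually_at by blast
      obtain t where t: "t \<in> Z" "c - d < t"
        using less_cSupD[of Z "c - d"] aZ d(1) unfolding c_def by auto
      have "t \<le> c" using cSup_upper[OF t(1) bddZ] by (simp add: c_def)
      moreover have "t \<noteq> c" using t(1) \<open>c \<notin> Z\<close> by auto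
      ultimately have "E t < - F c"
        using d(2)[of t] t by (auto simp: Z_def dist_real_def)
      moreover have "F t \<le> F c" using \<open>t \<le> c\<close> c by (intro Fmono) auto
      ultimately show False using t(1) by (simp add: Z_def)
    qed
    have "c = b"
    proof (rule ccontr)
      assume "c \<noteq> b"
      then have cb: "c < b" using c by simp
      obtain d where d: "0 < d" "ball c d \<subseteq> \<gamma> c"
        using \<gamma> unfolding gauge_def by (meson open_contains_ball)
      obtain r where r: "0 < r" "r < min d (b - c)" "g (c + r) - g c \<le> (h c + e) * r"
        using step[OF c(1) cb e, of "min d (b - c)"] d(1) cb by auto
      have "{c..c + r} \<subseteq> \<gamma> c"
        using d(2) r by (auto simp: subset_eq dist_real_def)
      then have "F c + ((h c * r) - integral {c..c + r} h) \<le> F (c + r)"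
        using r c by (intro Fstep) auto
      moreover have "integral {a..c + r} h = integral {a..c} h + integral {c..c + r} h"
      proof -
        have "h integrable_on {a..c + r}"
          using h r c by (auto intro: integrable_subinterval_real)
        then show ?thesis using Henstock_Kurzweil_Integration.integral_combine[of a c "c + r" h] r c by simp
      qed
      ultimately have "0 \<le> E (c + r) + F (c + r)"
        using cZ r(3) by (simp add: Z_def E_def algebra_simps)
      then have "c + r \<in> Z" using r c by (simp add: Z_def)
      then show False using cSup_upper[OF _ bddZ, of "c + r"] r(1) by (simp add: c_def)
    qed
    then show ?thesis
      using cZ Fb by (simp add: Z_def E_def algebra_simps)
  qed
  have d: "0 < 1 + (b - a)" using ab by simp
  have "g b - g a \<le> integral {a..b} h + e" if "0 < e" for e
    using main[OF divide_pos_pos[OF that d]] d by simp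
  then show ?thesis by (rule field_le_epsilon)
qed

text \<open>On the exceptional null set the bound is replaced by some real number above the lower
  Dini derivative, which exists by \<open>fin\<close>. Such a change, however large, affects neither
  integrability nor the integral.\<close>

lemma dini_increment_le_integral:
  fixes g h :: "real \<Rightarrow> real"
  assumes ab: "a \<le> b" and g: "continuous_on {a..b} g" and h: "h integrable_on {a..b}"
    and fin: "\<And>t. a \<le> t \<Longrightarrow> t < b \<Longrightarrow> lower_dini g t < \<infinity>"
    and ae: "AE t in lebesgue. a \<le> t \<and> t < b \<longrightarrow> lower_dini g t \<le> ereal (h t)"
  shows "g b - g a \<le> integral {a..b} h"
proof -
  define N where "N = {t. a \<le> t \<and> t < b \<and> \<not> lower_dini g t \<le> ereal (h t)}"
  have N: "negligible N"
  proof -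
    obtain M where "M \<in> null_sets lebesgue" "N \<subseteq> M"
      using ae unfolding eventually_ae_filter N_def by auto
    then show ?thesis using negligible_iff_null_sets negligible_subset by blast
  qed
  define h' where "h' t = (if t \<in> N then SOME c. lower_dini g t < ereal c else h t)" for t
  have "h' integrable_on {a..b}"
    by (rule integrable_spike[OF h N]) (simp add: h'_def)
  moreover have "\<exists>s. 0 < s \<and> s < d \<and> g (t + s) - g t \<le> (h' t + e) * s"
    if "a \<le> t" "t < b" "0 < e" "0 < d" for t e d
  proof -
    have "lower_dini g t < ereal (h' t + e)"
    proof (cases "t \<in> N")
      case True
      have "\<exists>c. lower_dini g t < ereal c"
        using fin[OF that(1,2)] less_PInf_Ex_of_nat[of "lower_dini g t"] by auto
      then have "lower_dini g t < ereal (h' t)"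
        using someI_ex[of "\<lambda>c. lower_dini g t < ereal c"] True by (simp add: h'_def)
      also have "\<dots> < ereal (h' t + e)" using that by simp
      finally show ?thesis .
    next
      case False
      then have "lower_dini g t \<le> ereal (h' t)" using that by (simp add: N_def h'_def)
      also have "\<dots> < ereal (h' t + e)" using that by simp
      finally show ?thesis .
    qed
    from lower_dini_less_step[OF this that(4)] show ?thesis by (meson less_imp_le)
  qed
  ultimately have "g b - g a \<le> integral {a..b} h'"
    by (intro increment_le_integral[OF ab g]) auto
  also have "integral {a..b} h' = integral {a..b} h"
    by (rule integral_spike[OF N]) (simp add: h'_def)
  finally show ?thesis .
qed

lemma lower_dini_le_upper_dini: "lower_dini g t \<le> upper_dini g t"
  unfolding lower_dini_def upper_dini_def by (intro Liminf_le_Limsup) simp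

lemma lower_dini_cong:
  assumes "\<forall>\<^sub>F s in at_right 0. g (t + s) - g t = g' (t' + s) - g' t'"
  shows "lower_dini g t = lower_dini g' t'"
  unfolding lower_dini_def by (rule Liminf_eq) (use assms in \<open>auto elim: eventually_mono\<close>)

lemma upper_dini_cong:
  assumes "\<forall>\<^sub>F s in at_right 0. g (t + s) - g t = g' (t' + s) - g' t'"
  shows "upper_dini g t = upper_dini g' t'"
  unfolding upper_dini_def by (rule Limsup_eq) (use assms in \<open>auto elim: eventually_mono\<close>)

lemma lower_dini_le_zero_if_const:
  assumes "\<forall>\<^sub>F s in at_right 0. g (t + s) = g t"
  shows "lower_dini g t \<le> 0"
proof -
  have "lower_dini g t = lower_dini (\<lambda>_. 0) t"
    by (rule lower_dini_cong) (use assms in \<open>auto elim: eventually_mono\<close>)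
  also have "\<dots> \<le> 0" by (simp add: lower_dini_def Liminf_const)
  finally show ?thesis .
qed

text \<open>From a value at least \<open>e\<close>, an increment of the truncation is at most the
  positive part of the increment of \<open>g\<close>; hence the bound survives when \<open>c\<close>
  is nonnegative.\<close>

lemma lower_dini_max_const:
  assumes "e \<le> g t" "lower_dini g t < ereal c" "0 \<le> c"
  shows "lower_dini (\<lambda>s. max (g s) e) t \<le> ereal c"
proof (rule ccontr)
  assume "\<not> ?thesis"
  then have "ereal c < lower_dini (\<lambda>s. max (g s) e) t" by simp
  then have "\<forall>\<^sub>F s in at_right 0. ereal c < ereal ((max (g (t + s)) e - max (g t) e) / s)"
    unfolding lower_dini_def by (rule less_LiminfD)
  then obtain d where d: "0 < d" "\<And>s. 0 < s \<Longrightarrow> s < d \<Longrightarrow> c < (max (g (t + s)) e - max (g t) e) / s"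
    unfolding eventually_at_right_field by auto
  obtain s where s: "0 < s" "s < d" "g (t + s) - g t < c * s"
    using lower_dini_less_step[OF assms(2) d(1)] by blast
  have "max (g (t + s)) e - max (g t) e \<le> c * s"
    using assms(1) s mult_nonneg_nonneg[OF assms(3), of s] by (auto simp: max_def)
  then have "(max (g (t + s)) e - max (g t) e) / s \<le> c"
    using s(1) by (simp add: field_simps)
  then show False using d(2)[OF s(1,2)] by simp
qed

section \<open>Norms on carriers\<close>

text \<open>Only differences of vectors occur, so the same facts about distances and topologies
  serve the subsystem spaces and the sequence spaces alike.\<close>

locale normed_carrier =
  fixes C :: "'v::minus set" and N :: "'v \<Rightarrow> real"
  assumes norm_nonneg: "v \<in> C \<Longrightarrow> 0 \<le> N v"
    and norm_diff_eq_0: "v \<in> C \<Longrightarrow> w \<in> C \<Longrightarrow> N (v - w) = 0 \<longleftrightarrow> v = w"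
    and norm_diff_commute: "v \<in> C \<Longrightarrow> w \<in> C \<Longrightarrow> N (v - w) = N (w - v)"
    and norm_diff_triangle: "u \<in> C \<Longrightarrow> v \<in> C \<Longrightarrow> w \<in> C \<Longrightarrow> N (u - w) \<le> N (u - v) + N (v - w)"
    and diff_closed: "v \<in> C \<Longrightarrow> w \<in> C \<Longrightarrow> v - w \<in> C"
begin

abbreviation carrier_dist :: "'v \<Rightarrow> 'v \<Rightarrow> real" where
  "carrier_dist \<equiv> (\<lambda>x y. if x \<in> C \<and> y \<in> C then N (x - y) else 0)"

sublocale carrier: Metric_space C carrier_dist
proof
  fix x y show "0 \<le> carrier_dist x y" "carrier_dist x y = carrier_dist y x"
    using norm_nonneg diff_closed norm_diff_commute by auto
  show "(carrier_dist x y = 0) = (x = y)" if "x \<in> C" "y \<in> C"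
    using that norm_diff_eq_0 by simp
next
  fix x y z assume "x \<in> C" "y \<in> C" "z \<in> C"
  then show "carrier_dist x z \<le> carrier_dist x y + carrier_dist y z"
    using norm_diff_triangle by simp
qed

lemma topspace_norm_topology: "topspace (norm_topology C N) = C"
  by (simp add: norm_topology_def)

lemma continuous_map_into_norm_topology_iff:
  assumes "Metric_space M d"
  shows "continuous_map (Metric_space.mtopology M d) (norm_topology C N) f \<longleftrightarrow>
     f ` M \<subseteq> C \<and> (\<forall>a\<in>M. \<forall>e>0. \<exists>r>0. \<forall>x. x \<in> M \<and> d a x < r \<longrightarrow> N (f a - f x) < e)"
  unfolding norm_topology_def Metric_space.metric_continuous_map[OF assms carrier.Metric_space_axioms]
  by (intro conj_cong refl ball_cong all_cong1 imp_cong ex_cong1) (auto simp: image_subset_iff)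

lemma continuous_map_from_norm_topology_iff:
  assumes "Metric_space M d"
  shows "continuous_map (norm_topology C N) (Metric_space.mtopology M d) f \<longleftrightarrow>
     f ` C \<subseteq> M \<and> (\<forall>a\<in>C. \<forall>e>0. \<exists>r>0. \<forall>x. x \<in> C \<and> N (a - x) < r \<longrightarrow> d (f a) (f x) < e)"
  unfolding norm_topology_def carrier.metric_continuous_map[OF assms]
  by (intro conj_cong refl ball_cong all_cong1 imp_cong ex_cong1) auto

lemma continuous_map_norm_real_iff:
  "continuous_map (norm_topology C N) euclideanreal f \<longleftrightarrow>
     (\<forall>a\<in>C. \<forall>e>0. \<exists>r>0. \<forall>x. x \<in> C \<and> N (a - x) < r \<longrightarrow> dist (f a) (f x) < e)"
  using continuous_map_from_norm_topology_iff[OF Met_TC.Metric_space_axioms, where f = f] by simp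

lemma closedin_norm_topology_iff:
  "closedin (norm_topology C N) A \<longleftrightarrow>
     A \<subseteq> C \<and> (\<forall>x\<in>C - A. \<exists>r>0. \<forall>y\<in>A. r \<le> N (x - y))"
proof -
  have e: "(\<exists>r>0. \<forall>y. \<not> (y \<in> A \<and> x \<in> C \<and> y \<in> C \<and> carrier_dist x y < r))
             \<longleftrightarrow> (\<exists>r>0. \<forall>y\<in>A. r \<le> N (x - y))"
    if "A \<subseteq> C" "x \<in> C - A" for x
    using that by (intro ex_cong1) (auto simp: not_less)
  show ?thesis
    unfolding norm_topology_def carrier.closedin_metric disjnt_iff carrier.in_mball Ball_def[of "C - A"]
    by (intro conj_cong refl all_cong1 imp_cong e)
qed

end

section \<open>Norms on finite-dimensional spaces\<close>

lemma Rn_scale: "v \<in> Rn n \<Longrightarrow> (\<lambda>k. c * v k) \<in> Rn n"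
  and Rn_diff: "v \<in> Rn n \<Longrightarrow> w \<in> Rn n \<Longrightarrow> v - w \<in> Rn n"
  and Rn_zero: "(\<lambda>k. 0) \<in> Rn n"
  by (simp_all add: Rn_def)

locale vect_norm =
  fixes n :: nat and N :: "vect \<Rightarrow> real"
  assumes is_norm: "is_norm_on_Rn n N"
begin

lemma nonneg: "v \<in> Rn n \<Longrightarrow> 0 \<le> N v"
  and eq_0: "v \<in> Rn n \<Longrightarrow> N v = 0 \<longleftrightarrow> v = (\<lambda>k. 0)"
  and scale: "v \<in> Rn n \<Longrightarrow> N (\<lambda>k. c * v k) = \<bar>c\<bar> * N v"
  and add_le: "v \<in> Rn n \<Longrightarrow> w \<in> Rn n \<Longrightarrow> N (\<lambda>k. v k + w k) \<le> N v + N w"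
  using is_norm unfolding is_norm_on_Rn_def by blast+

lemma zero: "N (\<lambda>k. 0) = 0"
  using eq_0[OF Rn_zero] by simp

lemma minus_commute:
  assumes "v \<in> Rn n" "w \<in> Rn n"
  shows "N (v - w) = N (w - v)"
proof -
  have "(\<lambda>k. - 1 * (w - v) k) = v - w" by (auto simp: fun_eq_iff)
  then show ?thesis using scale[OF Rn_diff[OF assms(2,1)], of "- 1"] by simp
qed

lemma diff_triangle:
  assumes "u \<in> Rn n" "v \<in> Rn n" "w \<in> Rn n"
  shows "N (u - w) \<le> N (u - v) + N (v - w)"
proof -
  have "(\<lambda>k. (u - v) k + (v - w) k) = u - w" by (auto simp: fun_eq_iff)
  then show ?thesis using add_le[OF Rn_diff Rn_diff, of u v v w] assms by simp
qed

lemma add_diff_le: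
  assumes "u \<in> Rn n" "v \<in> Rn n"
  shows "N u \<le> N (u - v) + N v"
proof -
  have "u - (\<lambda>k. 0) = u" "v - (\<lambda>k. 0) = v" by (auto simp: fun_eq_iff)
  then show ?thesis using diff_triangle[OF assms Rn_zero] by simp
qed

sublocale normed_carrier "Rn n" N
proof
  fix v w assume *: "v \<in> Rn n" "w \<in> Rn n"
  have "v - w = (\<lambda>k. 0) \<longleftrightarrow> v = w"
    by (auto simp: fun_eq_iff)
  then show "N (v - w) = 0 \<longleftrightarrow> v = w" using eq_0[OF Rn_diff[OF *]] by simp
qed (use nonneg minus_commute diff_triangle Rn_diff in auto)

text \<open>Expansion in unit vectors. It makes \<open>N\<close> continuous with respect to
  coordinatewise convergence, which the compactness argument for \<open>coordinate_bound\<close>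
  uses.\<close>

lemma le_coordinate_sum:
  assumes "v \<in> Rn n"
  shows "N v \<le> (\<Sum>k<n. \<bar>v k\<bar> * N (\<lambda>j. if j = k then 1 else 0))"
proof -
  have e: "(\<lambda>j. if j = k then 1 else 0) \<in> Rn n" if "k < n" for k
    using that by (simp add: Rn_def)
  have "N (\<lambda>j. if j < m then v j else 0) \<le> (\<Sum>k<m. \<bar>v k\<bar> * N (\<lambda>j. if j = k then 1 else 0))"
    if "m \<le> n" for m
    using that
  proof (induction m)
    case 0
    then show ?case using zero by simp
  next
    case (Suc m)
    have *: "(\<lambda>j. if j < Suc m then v j else 0)
        = (\<lambda>k. (if k < m then v k else 0) + v m * (if k = m then 1 else 0))"
      by (auto simp: fun_eq_iff less_Suc_eq)
    have "N (\<lambda>j. if j < Suc m then v j else 0)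
        \<le> N (\<lambda>k. if k < m then v k else 0) + N (\<lambda>k. v m * (if k = m then 1 else 0))"
      unfolding * by (rule add_le) (use assms Suc.prems in \<open>auto simp: Rn_def\<close>)
    also have "N (\<lambda>k. v m * (if k = m then 1 else 0)) = \<bar>v m\<bar> * N (\<lambda>k. if k = m then 1 else 0)"
      using scale[OF e, of m "v m"] Suc.prems by simp
    finally show ?case using Suc by simp
  qed
  from this[of n] have "N (\<lambda>j. if j < n then v j else 0) \<le> (\<Sum>k<n. \<bar>v k\<bar> * N (\<lambda>j. if j = k then 1 else 0))"
    by simp
  also have "(\<lambda>j. if j < n then v j else 0) = v"
    using assms by (auto simp: Rn_def fun_eq_iff)
  finally show ?thesis .
qed

text \<open>One half of the equivalence of norms: \<open>N\<close> attains a positive minimum on the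
  unit sphere of the maximum norm, and scaling gives the bound everywhere.\<close>

lemma coordinate_bound: "\<exists>c>0. \<forall>v\<in>Rn n. \<forall>k. \<bar>v k\<bar> \<le> c * N v"
proof -
  \<comment> \<open>The unit ball of the maximum norm as a product of compact sets; the factors from
    n on are the singleton of 0, so compactness is Tychonoff's theorem.\<close>
  define K where "K = (\<Pi>\<^sub>E k\<in>UNIV. if k < n then {-1..1::real} else {0})"
  define E where "E = K \<inter> (\<Union>k<n. {v. \<bar>v k\<bar> = 1})"
  have inK: "v \<in> K \<longleftrightarrow> v \<in> Rn n \<and> (\<forall>k<n. \<bar>v k\<bar> \<le> 1)" for v
    unfolding K_def Rn_def by (auto simp: PiE_iff abs_le_iff not_less split: if_splits)
  have "compact K"
  proof -
    have "compactin (product_topology (\<lambda>i. euclidean) UNIV) K"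
      unfolding K_def compactin_PiE by auto
    then show ?thesis unfolding euclidean_product_topology by simp
  qed
  moreover have "closed (\<Union>k<n. {v::vect. \<bar>v k\<bar> = 1})"
    by (intro closed_UN ballI closed_Collect_eq continuous_intros) auto
  ultimately have E: "compact E" unfolding E_def by (rule compact_Int_closed)
  have cont: "continuous_on E N"
    unfolding continuous_on_def
  proof
    fix v assume v: "v \<in> E"
    let ?b = "\<lambda>w. \<Sum>k<n. \<bar>w k - v k\<bar> * N (\<lambda>j. if j = k then 1 else 0)"
    have "continuous_on E ?b"
      by (intro continuous_intros continuous_on_subset[OF continuous_on_product_coordinates]) auto
    then have "(?b \<longlongrightarrow> ?b v) (at v within E)" using v unfolding continuous_on_def by blast
    moreover have "?b v = 0" by simp
    ultimately have b0: "(?b \<longlongrightarrow> 0) (at v within E)" by metis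
    have "\<bar>N w - N v\<bar> \<le> ?b w" if "w \<in> E" for w
    proof -
      have Rn: "w \<in> Rn n" "v \<in> Rn n" using that v inK by (auto simp: E_def)
      have "\<bar>N w - N v\<bar> \<le> N (w - v)"
        using add_diff_le[OF Rn] add_diff_le[OF Rn(2,1)] minus_commute[OF Rn] by linarith
      also have "\<dots> \<le> ?b w" using le_coordinate_sum[OF Rn_diff[OF Rn]] by simp
      finally show ?thesis .
    qed
    then have "\<forall>\<^sub>F w in at v within E. norm (N w - N v) \<le> ?b w"
      by (auto simp: eventually_at_filter)
    from Lim_null_comparison[OF this b0] show "(N \<longlongrightarrow> N v) (at v within E)"
      by (rule LIM_zero_cancel)
  qed
  \<comment> \<open>The sphere is empty for n = 0, where any positive \<open>d\<close> will
    do.\<close>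
  obtain d where d: "0 < d" "\<And>v. v \<in> E \<Longrightarrow> d \<le> N v"
  proof (cases "E = {}")
    case True
    then show ?thesis using that[of 1] by simp
  next
    case False
    obtain v where v: "v \<in> E" "\<And>w. w \<in> E \<Longrightarrow> N v \<le> N w"
      using continuous_attains_inf[OF E False cont] by blast
    have "v \<in> Rn n" "v \<noteq> (\<lambda>k. 0)" using v(1) inK by (auto simp: E_def)
    then have "0 < N v" using nonneg[of v] eq_0[of v] by simp
    then show ?thesis using that v(2) by blast
  qed
  have "\<bar>v k\<bar> \<le> 1 / d * N v" if v: "v \<in> Rn n" for v k
  proof (cases "v k = 0")
    case True
    then show ?thesis using nonneg[OF v] d(1) by simp
  next
    case False
    then have kn: "k < n" using v not_less unfolding Rn_def by blast
    define M where "M = Max ((\<lambda>k. \<bar>v k\<bar>) ` {..<n})"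
    have fin: "finite ((\<lambda>k. \<bar>v k\<bar>) ` {..<n})" "(\<lambda>k. \<bar>v k\<bar>) ` {..<n} \<noteq> {}" using kn by auto
    have le: "\<bar>v j\<bar> \<le> M" if "j < n" for j
      unfolding M_def using fin that by (intro Max_ge) auto
    have M: "0 < M" using le[OF kn] False by linarith
    obtain l where l: "l < n" "M = \<bar>v l\<bar>"
      using Max_in[OF fin] unfolding M_def by auto
    have "\<forall>k<n. \<bar>1 / M * v k\<bar> \<le> 1"
      using le M by (auto simp: abs_mult field_simps)
    moreover have "\<bar>1 / M * v l\<bar> = 1"
      using l M by (simp add: abs_mult)
    ultimately have "(\<lambda>k. 1 / M * v k) \<in> E"
      using l(1) Rn_scale[OF v, of "1 / M"] unfolding E_def Int_iff inK by blast
    then have "d \<le> 1 / M * N v"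
      using d(2) scale[OF v, of "1 / M"] M by fastforce
    then have "d * M \<le> N v" using M by (simp add: field_simps)
    then have "d * \<bar>v k\<bar> \<le> N v"
      using le[OF kn] d(1) by (meson less_imp_le mult_left_mono order_trans)
    then show ?thesis using d(1) by (simp add: field_simps)
  qed
  then show ?thesis using d(1) by (intro exI[of _ "1 / d"]) auto
qed

end
section \<open>Spaces of p-summable sequences\<close>

lemma powr_convex_combination:
  assumes p: "1 \<le> p" and xy: "0 \<le> x" "0 \<le> y" and l: "0 < l" "l < (1::real)"
  shows "(l * x + (1 - l) * y) powr p \<le> l * x powr p + (1 - l) * y powr p"
proof -
  have scaled: "(c * z) powr p \<le> c * z powr p" if "0 < c" "c < 1" "0 \<le> z" for c z
  proof -
    have "c powr p \<le> c powr 1" using that p by (intro powr_mono') auto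
    then show ?thesis using that by (simp add: powr_mult mult_right_mono)
  qed
  consider "x = 0" | "y = 0" | "0 < x" "0 < y" using xy by linarith
  then show ?thesis
  proof cases
    case 1
    then show ?thesis using scaled[of "1 - l" y] l xy p by simp
  next
    case 2
    then show ?thesis using scaled[of l x] l xy p by simp
  next
    case 3
    then show ?thesis
      using convex_onD[OF powr_convex[OF p], of "1 - l" x y] l by (simp add: mult.commute)
  qed
qed

text \<open>Minkowski's inequality by convexity: after scaling by \<open>a + b\<close>, the sum is a
  convex combination of \<open>x / a\<close> and \<open>y / b\<close> with weight
  \<open>a / (a + b)\<close>. Positive bounds \<open>a\<close> and \<open>b\<close> instead of the
  norms avoid dividing by a zero norm.\<close>

lemma minkowski_bound:
  fixes x y :: "nat \<Rightarrow> real"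
  assumes p: "1 \<le> p" and nn: "\<And>i. 0 \<le> x i" "\<And>i. 0 \<le> y i"
    and s: "summable (\<lambda>i. x i powr p)" "summable (\<lambda>i. y i powr p)"
    and ab: "0 < a" "0 < b" "(\<Sum>i. x i powr p) \<le> a powr p" "(\<Sum>i. y i powr p) \<le> b powr p"
  shows "summable (\<lambda>i. (x i + y i) powr p) \<and> (\<Sum>i. (x i + y i) powr p) \<le> (a + b) powr p"
proof -
  define l where "l = a / (a + b)"
  have l: "0 < l" "l < 1" using ab unfolding l_def by (auto simp: field_simps)
  have l': "1 - l = b / (a + b)" using ab unfolding l_def by (simp add: field_simps)
  let ?r = "\<lambda>i. (a + b) powr p * (l / a powr p * x i powr p + (1 - l) / b powr p * y i powr p)"
  have le: "(x i + y i) powr p \<le> ?r i" for i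
  proof -
    have "(x i + y i) = (a + b) * (l * (x i / a) + (1 - l) * (y i / b))"
    proof -
      have "(a + b) * l = a" "(a + b) * (1 - l) = b" unfolding l' unfolding l_def using ab by auto
      then show ?thesis using ab by (simp add: distrib_left mult.assoc[symmetric])
    qed
    then have "(x i + y i) powr p = (a + b) powr p * (l * (x i / a) + (1 - l) * (y i / b)) powr p"
      using ab nn l by (simp add: powr_mult)
    also have "\<dots> \<le> (a + b) powr p * (l * (x i / a) powr p + (1 - l) * (y i / b) powr p)"
      using powr_convex_combination[OF p _ _ l, of "x i / a" "y i / b"] nn ab
      by (intro mult_left_mono) auto
    also have "\<dots> = ?r i" using nn ab by (simp add: powr_divide)
    finally show ?thesis .
  qed
  have rs: "summable ?r" by (intro summable_mult summable_add s)
  have sm: "summable (\<lambda>i. (x i + y i) powr p)"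
    by (rule summable_comparison_test[OF _ rs]) (use le in auto)
  have "(\<Sum>i. (x i + y i) powr p) \<le> suminf ?r"
    by (intro suminf_le le sm rs)
  also have "\<dots> = (a + b) powr p * (l / a powr p * (\<Sum>i. x i powr p) + (1 - l) / b powr p * (\<Sum>i. y i powr p))"
    by (intro sums_unique[symmetric] sums_mult sums_add summable_sums s)
  also have "\<dots> \<le> (a + b) powr p * (l / a powr p * a powr p + (1 - l) / b powr p * b powr p)"
    using ab l by (intro mult_left_mono add_mono) auto
  also have "\<dots> = (a + b) powr p" using ab by simp
  finally show ?thesis using sm by simp
qed

lemma powr_inverse_cancel:
  assumes "1 \<le> p" "0 \<le> (x::real)"
  shows "(x powr (1 / p)) powr p = x" "(x powr p) powr (1 / p) = x"
  using assms by (auto simp: powr_powr)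

locale lp_carrier =
  fixes p :: real and d :: "nat \<Rightarrow> nat" and N :: "nat \<Rightarrow> vect \<Rightarrow> real"
  assumes p: "1 \<le> p" and is_norm_i: "is_norm_on_Rn (d i) (N i)"
begin

sublocale Ni: vect_norm "d i" "N i" for i
  by unfold_locales (rule is_norm_i)

lemma component: "x \<in> lp_space p d N \<Longrightarrow> x i \<in> Rn (d i)"
  and powr_summable: "x \<in> lp_space p d N \<Longrightarrow> summable (\<lambda>i. N i (x i) powr p)"
  by (simp_all add: lp_space_def)

lemma lp_norm_powr:
  assumes "x \<in> lp_space p d N"
  shows "lp_norm p N x powr p = (\<Sum>i. N i (x i) powr p)"
  unfolding lp_norm_def using assms p by (intro powr_inverse_cancel suminf_nonneg powr_summable) auto

lemma lp_norm_nonneg: "0 \<le> lp_norm p N x"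
  by (simp add: lp_norm_def)

lemma component_le:
  assumes "x \<in> lp_space p d N"
  shows "N i (x i) \<le> lp_norm p N x"
proof -
  have "N i (x i) powr p \<le> lp_norm p N x powr p"
    unfolding lp_norm_powr[OF assms]
    using sum_le_suminf[OF powr_summable[OF assms], of "{i}"] by simp
  then show ?thesis
    using p lp_norm_nonneg[of x] powr_less_mono2[of p "lp_norm p N x" "N i (x i)"] by linarith
qed

text \<open>The strict bounds are positive even for zero sequences, as
  \<open>minkowski_bound\<close> requires; \<open>lp_norm_diff_le\<close> removes the slack
  afterwards.\<close>

lemma lp_space_diff:
  assumes x: "x \<in> lp_space p d N" and y: "y \<in> lp_space p d N"
    and ab: "lp_norm p N x < a" "lp_norm p N y < b"
  shows "x - y \<in> lp_space p d N \<and> lp_norm p N (x - y) \<le> a + b"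
proof -
  have nn: "0 \<le> N i (x i)" "0 \<le> N i (y i)" for i
    using x y by (auto intro!: Ni.nonneg component)
  have ab0: "0 < a" "0 < b" using ab lp_norm_nonneg[of x] lp_norm_nonneg[of y] by linarith+
  have "summable (\<lambda>i. (N i (x i) + N i (y i)) powr p) \<and> (\<Sum>i. (N i (x i) + N i (y i)) powr p) \<le> (a + b) powr p"
  proof (intro minkowski_bound p nn powr_summable x y ab0)
    show "(\<Sum>i. N i (x i) powr p) \<le> a powr p" "(\<Sum>i. N i (y i) powr p) \<le> b powr p"
      unfolding lp_norm_powr[OF x, symmetric] lp_norm_powr[OF y, symmetric]
      using ab p lp_norm_nonneg by (auto intro!: powr_mono2)
  qed
  then have sm: "summable (\<lambda>i. (N i (x i) + N i (y i)) powr p)"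
    and le: "(\<Sum>i. (N i (x i) + N i (y i)) powr p) \<le> (a + b) powr p" by auto
  have comp: "(x - y) i \<in> Rn (d i)" for i
    using component[OF x] component[OF y] by (simp add: Rn_diff)
  have tri: "N i ((x - y) i) \<le> N i (x i) + N i (y i)" for i
  proof -
    have "x i - (\<lambda>k. 0) = x i" "(\<lambda>k. 0) - y i = (\<lambda>k. 0) - y i" "y i - (\<lambda>k. 0) = y i"
      by (auto simp: fun_eq_iff)
    then show ?thesis
      using Ni.diff_triangle[of "x i" i "\<lambda>k. 0" "y i"] Ni.minus_commute[of "y i" i "\<lambda>k. 0"]
        component[OF x] component[OF y] Rn_zero by simp
  qed
  have pow: "N i ((x - y) i) powr p \<le> (N i (x i) + N i (y i)) powr p" for i
    using tri Ni.nonneg[OF comp] p by (intro powr_mono2) auto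
  have sm2: "summable (\<lambda>i. N i ((x - y) i) powr p)"
    by (rule summable_comparison_test[OF _ sm]) (use pow in auto)
  then have mem: "x - y \<in> lp_space p d N" using comp by (simp add: lp_space_def)
  have "lp_norm p N (x - y) powr p \<le> (a + b) powr p"
    unfolding lp_norm_powr[OF mem] using suminf_le[OF pow sm2 sm] le by linarith
  then have "lp_norm p N (x - y) \<le> a + b"
    using p lp_norm_nonneg[of "x - y"] ab0 powr_less_mono2[of p "a + b" "lp_norm p N (x - y)"] by linarith
  then show ?thesis using mem by simp
qed

lemma lp_space_diff_closed: "x \<in> lp_space p d N \<Longrightarrow> y \<in> lp_space p d N \<Longrightarrow> x - y \<in> lp_space p d N"
  using lp_space_diff[OF _ _ less_add_one less_add_one] by blast

lemma lp_norm_diff_le: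
  assumes "x \<in> lp_space p d N" "y \<in> lp_space p d N"
  shows "lp_norm p N (x - y) \<le> lp_norm p N x + lp_norm p N y"
proof (rule field_le_epsilon)
  fix e :: real assume "0 < e"
  then show "lp_norm p N (x - y) \<le> lp_norm p N x + lp_norm p N y + e"
    using lp_space_diff[OF assms, of "lp_norm p N x + e / 2" "lp_norm p N y + e / 2"] by simp
qed

lemma lp_norm_minus_commute:
  assumes "x \<in> lp_space p d N" "y \<in> lp_space p d N"
  shows "lp_norm p N (x - y) = lp_norm p N (y - x)"
  using Ni.minus_commute[OF component[OF assms(1)] component[OF assms(2)]] by (simp add: lp_norm_def)

sublocale normed_carrier "lp_space p d N" "lp_norm p N"
proof
  fix x y assume xy: "x \<in> lp_space p d N" "y \<in> lp_space p d N"
  have sm: "summable (\<lambda>i. N i ((x - y) i) powr p)"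
    using lp_space_diff_closed[OF xy] by (rule powr_summable)
  show "lp_norm p N (x - y) = 0 \<longleftrightarrow> x = y"
  proof
    assume "lp_norm p N (x - y) = 0"
    then have "(\<Sum>i. N i ((x - y) i) powr p) = 0"
      using lp_norm_powr[OF lp_space_diff_closed[OF xy]] p by simp
    then have "N i ((x - y) i) powr p = 0" for i
      using suminf_eq_zero_iff[OF sm] by simp
    then have "N i (x i - y i) = 0" for i by simp
    then show "x = y"
      using Ni.norm_diff_eq_0[OF component[OF xy(1)] component[OF xy(2)]] by auto
  next
    assume "x = y"
    moreover have "N i (y i - y i) = 0" for i
      using Ni.norm_diff_eq_0[OF component[OF xy(2)] component[OF xy(2)]] by simp
    ultimately show "lp_norm p N (x - y) = 0" by (simp add: lp_norm_def)
  qed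
next
  fix u v w assume *: "u \<in> lp_space p d N" "v \<in> lp_space p d N" "w \<in> lp_space p d N"
  have "u - w = (u - v) - (w - v)" by (auto simp: fun_eq_iff)
  then have "lp_norm p N (u - w) \<le> lp_norm p N (u - v) + lp_norm p N (w - v)"
    using lp_norm_diff_le[OF lp_space_diff_closed lp_space_diff_closed, of u v w v] * by simp
  then show "lp_norm p N (u - w) \<le> lp_norm p N (u - v) + lp_norm p N (v - w)"
    using lp_norm_minus_commute[of w v] * by simp
qed (use lp_norm_nonneg lp_norm_minus_commute lp_space_diff_closed in auto)

lemma component_diff_le:
  assumes "x \<in> lp_space p d N" "y \<in> lp_space p d N"
  shows "N i (x i - y i) \<le> lp_norm p N (x - y)"
  using component_le[OF lp_space_diff_closed[OF assms], of i] by simp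

lemma coordinate_bound: "\<exists>c>0. \<forall>x\<in>lp_space p d N. \<bar>x i k\<bar> \<le> c * lp_norm p N x"
proof -
  obtain c where c: "0 < c" "\<And>v k. v \<in> Rn (d i) \<Longrightarrow> \<bar>v k\<bar> \<le> c * N i v"
    using Ni.coordinate_bound[where i = i] by blast
  have "\<bar>x i k\<bar> \<le> c * lp_norm p N x" if "x \<in> lp_space p d N" for x
    using c(2)[OF component[OF that], of k] component_le[OF that, of i] c(1)
    by (meson less_imp_le mult_left_mono order_trans)
  then show ?thesis using c(1) by blast
qed

end

section \<open>Coordinates of strongly measurable functions and Bochner integrals\<close>

text \<open>An everywhere defined \<open>lim\<close> is measurable, and completeness of Lebesgue
  measure transfers this to a function that equals it almost everywhere.\<close>

lemma borel_measurable_AE_limit: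
  fixes f :: "real \<Rightarrow> real"
  assumes D: "D \<in> sets lebesgue" and F: "\<And>m. F m \<in> borel_measurable (lebesgue_on D)"
    and lim: "AE t in lebesgue_on D. (\<lambda>m. F m t) \<longlonglongrightarrow> f t"
  shows "f \<in> borel_measurable (lebesgue_on D)"
proof -
  have D': "D \<inter> space lebesgue \<in> sets lebesgue" using D by simp
  have "(\<lambda>t. lim (\<lambda>m. indicator D t *\<^sub>R F m t)) \<in> borel_measurable lebesgue"
    using F unfolding borel_measurable_restrict_space_iff[OF D']
    by (intro borel_measurable_lim_metric) auto
  moreover have "AE t in lebesgue. lim (\<lambda>m. indicator D t *\<^sub>R F m t) = indicator D t *\<^sub>R f t"
    using lim unfolding AE_restrict_space_iff[OF D']
    by eventually_elim (auto simp: indicator_def intro!: limI)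
  ultimately have "(\<lambda>t. indicator D t *\<^sub>R f t) \<in> borel_measurable lebesgue"
    by (rule borel_measurable_AE)
  then show ?thesis unfolding borel_measurable_restrict_space_iff[OF D'] .
qed

text \<open>\<open>\<phi>\<close> may be arbitrary, since finitely many values on measurable level
  sets remain.\<close>

lemma simple_on_borel_measurable:
  assumes D: "D \<in> sets lebesgue" and s: "simple_on C D s"
  shows "(\<lambda>t. (\<phi> (s t) :: real)) \<in> borel_measurable (lebesgue_on D)"
proof (rule measurableI)
  fix A :: "real set"
  have "(\<lambda>t. \<phi> (s t)) -` A \<inter> space (lebesgue_on D) = (\<Union>v\<in>{v\<in>s ` D. \<phi> v \<in> A}. {t \<in> D. s t = v})"
    by auto
  moreover have "\<dots> \<in> sets (lebesgue_on D)"
  proof (intro sets.finite_UN)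
    show "finite {v \<in> s ` D. \<phi> v \<in> A}" using s by (simp add: simple_on_def)
    fix v show "{t \<in> D. s t = v} \<in> sets (lebesgue_on D)"
      using s D by (subst sets_restrict_space_iff) (auto simp: simple_on_def)
  qed
  ultimately show "(\<lambda>t. \<phi> (s t)) -` A \<inter> space (lebesgue_on D) \<in> sets (lebesgue_on D)" by simp
qed simp

lemma set_integrable_iff_lebesgue_on:
  fixes f :: "real \<Rightarrow> real"
  assumes "D \<in> sets lebesgue"
  shows "set_integrable lebesgue D f \<longleftrightarrow> integrable (lebesgue_on D) f"
    and "set_lebesgue_integral lebesgue D f = integral\<^sup>L (lebesgue_on D) f"
  using assms unfolding set_integrable_def set_lebesgue_integral_def
  by (simp_all add: integrable_restrict_space integral_restrict_space)

context lp_carrier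
begin

abbreviation "lpX \<equiv> lp_space p d N"
abbreviation "lpN \<equiv> lp_norm p N"

text \<open>A Lipschitz functional sends the approximating simple functions to real approximations.
  It is applied to coordinates, to norms of components and to the full norm.\<close>

lemma strongly_measurable_imp_borel_measurable:
  assumes D: "D \<in> sets lebesgue" and g: "strongly_measurable_on lpX lpN D g"
    and lip: "\<And>x y. x \<in> lpX \<Longrightarrow> y \<in> lpX \<Longrightarrow> \<bar>\<phi> x - \<phi> y\<bar> \<le> c * lpN (x - y)"
  shows "(\<lambda>t. \<phi> (g t)) \<in> borel_measurable (lebesgue_on D)"
proof -
  obtain s where s: "\<And>m. simple_on lpX D (s m)"
    and lim: "AE t in lebesgue_on D. (\<lambda>m::nat. lpN (g t - s m t)) \<longlonglongrightarrow> 0"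
    and gX: "g ` D \<subseteq> lpX"
    using g unfolding strongly_measurable_on_def by blast
  show ?thesis
  proof (rule borel_measurable_AE_limit[OF D])
    show "(\<lambda>t. \<phi> (s m t)) \<in> borel_measurable (lebesgue_on D)" for m
      by (rule simple_on_borel_measurable[OF D s])
    show "AE t in lebesgue_on D. (\<lambda>m. \<phi> (s m t)) \<longlonglongrightarrow> \<phi> (g t)"
      using lim AE_space[of "lebesgue_on D"]
    proof eventually_elim
      case (elim t)
      then have t: "t \<in> D" by simp
      have 1: "norm (\<phi> (s m t) - \<phi> (g t)) \<le> c * lpN (g t - s m t)" for m
        using lip[of "g t" "s m t"] s[of m] gX t unfolding simple_on_def
        by (simp add: image_subset_iff abs_minus_commute)
      have 2: "(\<lambda>m. c * lpN (g t - s m t)) \<longlonglongrightarrow> 0"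
        using tendsto_mult_left[OF elim(1), of c] by simp
      show ?case
      proof (rule LIM_zero_cancel, rule Lim_null_comparison[OF _ 2])
        show "\<forall>\<^sub>F m in sequentially. norm (\<phi> (s m t) - \<phi> (g t)) \<le> c * lpN (g t - s m t)"
          using 1 by simp
      qed
    qed
  qed
qed

lemma lipschitz_component_norm:
  assumes "x \<in> lpX" "y \<in> lpX"
  shows "\<bar>N i (x i) - N i (y i)\<bar> \<le> 1 * lpN (x - y)"
proof -
  have c: "x i \<in> Rn (d i)" "y i \<in> Rn (d i)" using assms component by auto
  show ?thesis
    using Ni.add_diff_le[OF c] Ni.add_diff_le[OF c(2,1)] Ni.minus_commute[OF c]
      component_diff_le[OF assms, of i]
    by linarith
qed

lemma lp_space_scale:
  assumes "x \<in> lpX"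
  shows "(\<lambda>i k. c * x i k) \<in> lpX"
proof -
  have "N i (\<lambda>k. c * x i k) powr p = \<bar>c\<bar> powr p * N i (x i) powr p" for i
    using Ni.scale[OF component[OF assms], of i c] Ni.nonneg[OF component[OF assms]]
    by (simp add: powr_mult)
  then show ?thesis
    using component[OF assms] powr_summable[OF assms]
    by (auto simp: lp_space_def Rn_def intro!: summable_mult)
qed

lemma lp_space_zero: "(\<lambda>i k. 0) \<in> lpX"
  using Ni.zero p by (simp add: lp_space_def Rn_def)

lemma lp_space_add:
  assumes "x \<in> lpX" "y \<in> lpX"
  shows "(\<lambda>i k. x i k + y i k) \<in> lpX"
proof -
  have "x - (\<lambda>i k. - 1 * y i k) = (\<lambda>i k. x i k + y i k)"
    by (simp add: fun_eq_iff)
  then show ?thesis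
    using lp_space_diff_closed[OF assms(1) lp_space_scale[OF assms(2), of "- 1"]] by simp
qed

lemma lp_norm_lipschitz:
  assumes "x \<in> lpX" "y \<in> lpX"
  shows "\<bar>lpN x - lpN y\<bar> \<le> 1 * lpN (x - y)"
proof -
  have z: "v - (\<lambda>i k. 0) = v" for v :: vseq by (simp add: fun_eq_iff)
  show ?thesis
    using norm_diff_triangle[OF assms lp_space_zero] norm_diff_triangle[OF assms(2,1) lp_space_zero]
      norm_diff_commute[OF assms] unfolding z by linarith
qed

lemma simple_integral_on_mem:
  assumes "simple_on lpX D s"
  shows "simple_integral_on D s \<in> lpX"
proof -
  have *: "(\<lambda>i k. \<Sum>v\<in>F. a v * v i k) \<in> lpX" if "finite F" "F \<subseteq> lpX" for F and a :: "vseq \<Rightarrow> real"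
    using that by (induction F) (auto simp: lp_space_zero intro: lp_space_add[OF lp_space_scale])
  have "finite (s ` D)" "s ` D \<subseteq> lpX" using assms by (auto simp: simple_on_def)
  from *[OF this] show ?thesis
    unfolding simple_integral_on_def .
qed

lemma simple_integral_on_coordinate:
  assumes D: "D \<in> lmeasurable" and s: "simple_on lpX D s"
  shows "integrable (lebesgue_on D) (\<lambda>t. s t i k)"
    and "simple_integral_on D s i k = (\<integral>t. s t i k \<partial>lebesgue_on D)"
proof -
  let ?E = "\<lambda>v. {t \<in> D. s t = v}"
  have DL: "D \<in> sets lebesgue" using D by (rule fmeasurableD)
  have fin: "finite (s ` D)" and E: "?E v \<in> sets lebesgue" for v
    using s by (auto simp: simple_on_def)
  have Ef: "?E v \<in> lmeasurable" for v
    using fmeasurableI2[OF D _ E] by blast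
  have sum: "s t i k = (\<Sum>v\<in>s ` D. indicator (?E v) t * v i k)" if "t \<in> space (lebesgue_on D)" for t
  proof -
    have "(\<Sum>v\<in>s ` D. indicator (?E v) t * v i k) = (\<Sum>v\<in>s ` D. if v = s t then v i k else 0)"
      using that by (intro sum.cong) (auto simp: indicator_def)
    then show ?thesis using that fin by simp
  qed
  have E': "?E v \<in> sets (lebesgue_on D)" for v
    using E DL by (subst sets_restrict_space_iff) auto
  have m: "measure (lebesgue_on D) (?E v) = measure lebesgue (?E v)" for v
    using DL by (intro measure_restrict_space) auto
  have f: "emeasure (lebesgue_on D) (?E v) < \<infinity>" for v
    using Ef[of v] DL by (subst emeasure_restrict_space) (auto simp: fmeasurable_def)
  have int: "integrable (lebesgue_on D) (\<lambda>t. indicator (?E v) t * v i k)" for v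
    using integrable_real_indicator[OF E' f] by (intro integrable_mult_left) auto
  show "integrable (lebesgue_on D) (\<lambda>t. s t i k)"
    using int by (subst Bochner_Integration.integrable_cong[OF refl sum]) auto
  have "(\<integral>t. s t i k \<partial>lebesgue_on D) = (\<integral>t. (\<Sum>v\<in>s ` D. indicator (?E v) t * v i k) \<partial>lebesgue_on D)"
    by (intro Bochner_Integration.integral_cong sum refl)
  also have "\<dots> = (\<Sum>v\<in>s ` D. (\<integral>t. indicator (?E v) t * v i k \<partial>lebesgue_on D))"
    using int by (intro Bochner_Integration.integral_sum) auto
  also have "\<dots> = (\<Sum>v\<in>s ` D. measure lebesgue (?E v) * v i k)"
  proof (intro sum.cong refl)
    fix v
    have "space (lebesgue_on D) \<inter> ?E v = ?E v" by auto
    then show "(\<integral>t. indicator (?E v) t * v i k \<partial>lebesgue_on D) = measure lebesgue (?E v) * v i k"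
      using m[of v] by (simp add: Int_commute)
  qed
  finally show "simple_integral_on D s i k = (\<integral>t. s t i k \<partial>lebesgue_on D)"
    by (simp add: simple_integral_on_def)
qed

text \<open>A coordinate is a bounded linear functional, hence commutes with the Bochner integral.
  This turns the network equation into scalar integral equations of the subsystems.\<close>

lemma bochner_integral_coordinate:
  assumes D: "D \<in> lmeasurable" and J: "has_bochner_integral_on lpX lpN D g J"
  shows "integrable (lebesgue_on D) (\<lambda>t. g t i k)" and "J i k = (\<integral>t. g t i k \<partial>lebesgue_on D)"
proof -
  have DL: "D \<in> sets lebesgue" using D by (rule fmeasurableD)
  obtain c where c: "0 < c" "\<And>x. x \<in> lpX \<Longrightarrow> \<bar>x i k\<bar> \<le> c * lpN x"
    using coordinate_bound by blast
  have sm: "strongly_measurable_on lpX lpN D g" and JX: "J \<in> lpX"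
    using J by (auto simp: has_bochner_integral_on_def)
  obtain s where s: "\<And>m. simple_on lpX D (s m)"
    and lim: "(\<lambda>m::nat. \<integral>\<^sup>+t. ennreal (lpN (g t - s m t)) \<partial>lebesgue_on D) \<longlonglongrightarrow> 0"
    and limJ: "(\<lambda>m. lpN (J - simple_integral_on D (s m))) \<longlonglongrightarrow> 0"
    using J unfolding has_bochner_integral_on_def by blast
  have gX: "g t \<in> lpX" if "t \<in> D" for t
    using sm that unfolding strongly_measurable_on_def by blast
  have sX: "s m t \<in> lpX" if "t \<in> D" for t m
    using s[of m] that unfolding simple_on_def by blast
  have diff: "\<bar>x i k - y i k\<bar> \<le> c * lpN (x - y)" if "x \<in> lpX" "y \<in> lpX" for x y
    using c(2)[OF lp_space_diff_closed[OF that]] by simp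
  have gm: "(\<lambda>t. g t i k) \<in> borel_measurable (lebesgue_on D)"
    using strongly_measurable_imp_borel_measurable[OF DL sm diff] .
  note si = simple_integral_on_coordinate[OF D s]
  have nn: "(\<integral>\<^sup>+t. ennreal (\<bar>g t i k - s m t i k\<bar> / c) \<partial>lebesgue_on D)
              \<le> (\<integral>\<^sup>+t. ennreal (lpN (g t - s m t)) \<partial>lebesgue_on D)" for m
    using diff[OF gX sX] c(1) by (intro nn_integral_mono ennreal_leI) (auto simp: field_simps)
  have nnlim: "(\<lambda>m. \<integral>\<^sup>+t. ennreal (\<bar>g t i k - s m t i k\<bar> / c) \<partial>lebesgue_on D) \<longlonglongrightarrow> 0"
    by (rule tendsto_sandwich[OF _ _ tendsto_const lim]) (use nn in auto)
  \<comment> \<open>Approximation errors tending to 0 are eventually finite; one integrable error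
    plus one integrable simple function gives integrability of the coordinate.\<close>
  have "\<forall>\<^sub>F m in sequentially. (\<integral>\<^sup>+t. ennreal (\<bar>g t i k - s m t i k\<bar> / c) \<partial>lebesgue_on D) < 1"
    using nnlim by (rule order_tendstoD) simp
  then obtain m0 where m0: "\<And>m. m \<ge> m0 \<Longrightarrow> (\<integral>\<^sup>+t. ennreal (\<bar>g t i k - s m t i k\<bar> / c) \<partial>lebesgue_on D) < 1"
    unfolding eventually_sequentially by blast
  have dint: "integrable (lebesgue_on D) (\<lambda>t. (g t i k - s m t i k) / c)" if "m \<ge> m0" for m
  proof (rule integrableI_bounded)
    show "(\<lambda>t. (g t i k - s m t i k) / c) \<in> borel_measurable (lebesgue_on D)"
      using gm si(1)[of m i k] by auto
    have "(\<integral>\<^sup>+t. ennreal (norm ((g t i k - s m t i k) / c)) \<partial>lebesgue_on D) < 1"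
      using m0[OF that] c(1) by simp
    then show "(\<integral>\<^sup>+t. ennreal (norm ((g t i k - s m t i k) / c)) \<partial>lebesgue_on D) < \<infinity>"
      using order.strict_trans[of _ 1 "\<infinity>::ennreal"] by simp
  qed
  have "integrable (lebesgue_on D) (\<lambda>t. c * ((g t i k - s m0 t i k) / c) + s m0 t i k)"
    using dint[of m0] si(1) by (intro Bochner_Integration.integrable_add integrable_mult_right) auto
  then show gi: "integrable (lebesgue_on D) (\<lambda>t. g t i k)"
    using c(1) by simp
  let ?I = "\<integral>t. g t i k \<partial>lebesgue_on D"
  have le: "ennreal (\<bar>?I - simple_integral_on D (s m) i k\<bar> / c)
          \<le> (\<integral>\<^sup>+t. ennreal (\<bar>g t i k - s m t i k\<bar> / c) \<partial>lebesgue_on D)" if "m \<ge> m0" for m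
  proof -
    have "(\<integral>t. (g t i k - s m t i k) / c \<partial>lebesgue_on D) = (?I - simple_integral_on D (s m) i k) / c"
      unfolding si(2) using gi si(1) by simp
    then show ?thesis
      using integral_norm_bound_ennreal[OF dint[OF that]] c(1) by simp
  qed
  have "(\<lambda>m. ennreal (\<bar>?I - simple_integral_on D (s m) i k\<bar> / c)) \<longlonglongrightarrow> ennreal 0"
    unfolding ennreal_0
    by (rule tendsto_sandwich[OF _ _ tendsto_const nnlim]) (use le in \<open>auto simp: eventually_sequentially\<close>)
  then have "(\<lambda>m. \<bar>?I - simple_integral_on D (s m) i k\<bar> / c) \<longlonglongrightarrow> 0"
    using c(1) by (subst (asm) tendsto_ennreal_iff) auto
  from tendsto_mult_left[OF this, of c] have "(\<lambda>m. ?I - simple_integral_on D (s m) i k) \<longlonglongrightarrow> 0"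
    using c(1) by (simp add: tendsto_rabs_zero_iff)
  then have l1: "(\<lambda>m. simple_integral_on D (s m) i k) \<longlonglongrightarrow> ?I"
    using tendsto_diff[OF tendsto_const[of ?I], of "\<lambda>m. ?I - simple_integral_on D (s m) i k" 0] by simp
  have "(\<lambda>m. c * lpN (J - simple_integral_on D (s m))) \<longlonglongrightarrow> 0"
    using tendsto_mult_left[OF limJ, of c] by simp
  then have "(\<lambda>m. J i k - simple_integral_on D (s m) i k) \<longlonglongrightarrow> 0"
    by (rule Lim_null_comparison[rotated]) (use diff[OF JX simple_integral_on_mem[OF s]] in auto)
  then have l2: "(\<lambda>m. simple_integral_on D (s m) i k) \<longlonglongrightarrow> J i k"
    using tendsto_diff[OF tendsto_const[of "J i k"], of "\<lambda>m. J i k - simple_integral_on D (s m) i k" 0] by simp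
  show "J i k = ?I" using LIMSEQ_unique[OF l2 l1] .
qed

text \<open>The essential supremum lies between 0 and \<open>c\<close>, so its conversion to a real
  number in \<open>input_norm\<close> loses nothing. Nonnegativity uses that the half-line is not a
  null set.\<close>

lemma essentially_bounded_le_esssup:
  assumes g: "strongly_measurable_on lpX lpN {0..} g"
    and bd: "AE t in lebesgue_on {0..}. lpN (g t) \<le> c"
  shows "AE t in lebesgue_on {0..}. lpN (g t) \<le> real_of_ereal (esssup (lebesgue_on {0..}) (\<lambda>t. ereal (lpN (g t))))"
    and "0 \<le> real_of_ereal (esssup (lebesgue_on {0..}) (\<lambda>t. ereal (lpN (g t))))"
proof -
  let ?M = "lebesgue_on {0..} :: real measure"
  let ?e = "esssup ?M (\<lambda>t. ereal (lpN (g t)))"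
  have m: "(\<lambda>t. lpN (g t)) \<in> borel_measurable ?M"
    using strongly_measurable_imp_borel_measurable[OF _ g lp_norm_lipschitz] by auto
  have "?e \<le> ereal c"
    using m bd by (intro esssup_I) auto
  moreover have "0 \<le> ?e"
  proof -
    have "emeasure ?M (space ?M) \<noteq> 0"
      using emeasure_mono[of "{0..1::real}" "{0..}" lborel] by (auto simp: emeasure_restrict_space)
    then have "esssup ?M (\<lambda>t. 0) = (0::ereal)" by (rule esssup_const)
    moreover have "esssup ?M (\<lambda>t. 0) \<le> ?e"
      using lp_norm_nonneg by (intro esssup_mono) auto
    ultimately show ?thesis by simp
  qed
  ultimately have e: "?e = ereal (real_of_ereal ?e)" "0 \<le> real_of_ereal ?e"
    by (auto simp: real_of_ereal_pos ereal_real)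
  have "AE t in ?M. ereal (lpN (g t)) \<le> ?e" by (rule esssup_AE)
  then have "AE t in ?M. ereal (lpN (g t)) \<le> ereal (real_of_ereal ?e)" using e(1) by simp
  then show "AE t in ?M. lpN (g t) \<le> real_of_ereal ?e" by simp
  show "0 \<le> real_of_ereal ?e" by fact
qed

end

section \<open>Distances to sets and weighted sums of the subsystem functions\<close>

context normed_carrier
begin

lemma set_distance_le:
  assumes "A \<subseteq> C" "v \<in> C" "y \<in> A"
  shows "set_distance N A v \<le> N (v - y)"
  unfolding set_distance_def
  by (rule cINF_lower[OF _ assms(3)], rule bdd_belowI2[of _ 0])
     (use assms diff_closed norm_nonneg in auto)

lemma set_distance_nonneg:
  assumes "A \<subseteq> C" "A \<noteq> {}" "v \<in> C"
  shows "0 \<le> set_distance N A v"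
  unfolding set_distance_def
  by (rule cINF_greatest) (use assms diff_closed norm_nonneg in auto)

lemma set_distance_less_ex:
  assumes "A \<noteq> {}" "set_distance N A v < r"
  shows "\<exists>y\<in>A. N (v - y) < r"
proof (rule ccontr)
  assume "\<not> ?thesis"
  then have "r \<le> set_distance N A v"
    unfolding set_distance_def using assms(1) by (intro cINF_greatest) (auto simp: not_less)
  then show False using assms(2) by simp
qed

lemma set_distance_triangle:
  assumes "A \<subseteq> C" "A \<noteq> {}" "v \<in> C" "w \<in> C"
  shows "set_distance N A v \<le> N (v - w) + set_distance N A w"
proof (rule field_le_epsilon)
  fix e :: real assume "0 < e"
  then obtain y where y: "y \<in> A" "N (w - y) < set_distance N A w + e"
    using set_distance_less_ex[OF assms(2), of w "set_distance N A w + e"] by auto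
  then show "set_distance N A v \<le> N (v - w) + set_distance N A w + e"
    using set_distance_le[OF assms(1,3) y(1)] norm_diff_triangle[of v w y] assms by fastforce
qed

lemma set_distance_eq_0_iff:
  assumes A: "closedin (norm_topology C N) A" "A \<noteq> {}" and v: "v \<in> C"
  shows "set_distance N A v = 0 \<longleftrightarrow> v \<in> A"
proof
  have sub: "A \<subseteq> C" using A closedin_norm_topology_iff by blast
  {
    assume "v \<in> A"
    then show "set_distance N A v = 0"
      using set_distance_le[OF sub v, of v] set_distance_nonneg[OF sub A(2) v]
        norm_diff_eq_0[OF v v] by simp
  next
    assume 0: "set_distance N A v = 0"
    show "v \<in> A"
    proof (rule ccontr)
      assume "v \<notin> A"
      then obtain r where r: "0 < r" "\<forall>y\<in>A. r \<le> N (v - y)"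
        using A(1) v unfolding closedin_norm_topology_iff by blast
      then show False
        using set_distance_less_ex[OF A(2), of v r] 0 by force
    qed
  }
qed

end

lemma powr_add_le_double:
  assumes "0 \<le> s" "0 \<le> t" "0 \<le> (p::real)"
  shows "(s + t) powr p \<le> 2 powr p * (s powr p + t powr p)"
proof -
  have "(s + t) powr p \<le> (2 * max s t) powr p"
    using assms by (intro powr_mono2) auto
  also have "\<dots> = 2 powr p * max s t powr p"
    using assms by (simp add: powr_mult)
  also have "max s t powr p \<le> s powr p + t powr p"
    by (cases "s \<le> t") (simp_all add: max_def)
  finally show ?thesis by simp
qed

section \<open>The product attractor and the distance to it\<close>

locale network_setting =
  fixes S :: network
  assumes setting: "infinite_network S"
begin

sublocale X: lp_carrier "exp_p S" "dim_x S" "norm_x S"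
  using setting by unfold_locales (auto simp: infinite_network_def)

sublocale U: lp_carrier "exp_q S" "dim_u S" "norm_u S"
  using setting by unfold_locales (auto simp: infinite_network_def)

lemma state_component: "x \<in> state_space S \<Longrightarrow> x i \<in> sub_states S i"
  unfolding state_space_def sub_states_def by (rule X.component)

lemma continuous_map_component: "continuous_map (state_top S) (sub_state_top S i) (\<lambda>x. x i)"
  unfolding state_top_def sub_state_top_def state_space_def state_norm_def sub_states_def
    norm_topology_def[of "lp_space _ _ _"]
  unfolding X.Ni.continuous_map_into_norm_topology_iff[OF X.carrier.Metric_space_axioms]
proof (intro conjI ballI allI impI)
  show "(\<lambda>x. x i) ` X.lpX \<subseteq> Rn (dim_x S i)" using X.component by blast
  fix a :: vseq and e :: real assume a: "a \<in> X.lpX" "0 < e"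
  show "\<exists>r>0. \<forall>x. x \<in> X.lpX \<and> X.carrier_dist a x < r \<longrightarrow> norm_x S i (a i - x i) < e"
    using a X.component_diff_le[OF a(1)] by (intro exI[of _ e]) (auto intro: le_less_trans)
qed

end

locale coercive_network = network_setting +
  fixes As :: "nat \<Rightarrow> vect set" and Vs :: "nat \<Rightarrow> vect \<Rightarrow> real"
    and alpha_low alpha_up :: real and A :: "vseq set"
  assumes As_nonempty: "As i \<noteq> {}" and As_closed: "closedin (sub_state_top S i) (As i)"
    and Vs_cont: "continuous_map (sub_state_top S i) euclideanreal (Vs i)"
    and alpha_low: "0 < alpha_low"
    and Vs_lower: "x \<in> sub_states S i \<Longrightarrow>
          alpha_low * set_distance (norm_x S i) (As i) x powr exp_p S \<le> Vs i x"
    and Vs_upper: "x \<in> sub_states S i \<Longrightarrow>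
          Vs i x \<le> alpha_up * set_distance (norm_x S i) (As i) x powr exp_p S"
    and A_def: "A = {x \<in> state_space S. \<forall>i. x i \<in> As i}"
    and A_nonempty: "A \<noteq> {}"
begin

abbreviation "dst i v \<equiv> set_distance (norm_x S i) (As i) v"

lemma As_closed': "closedin (norm_topology (Rn (dim_x S i)) (norm_x S i)) (As i)"
  using As_closed[of i] by (simp add: sub_state_top_def sub_states_def)

lemma As_sub: "As i \<subseteq> Rn (dim_x S i)"
  using As_closed' X.Ni.closedin_norm_topology_iff by blast

lemma A_sub: "A \<subseteq> X.lpX"
  unfolding A_def state_space_def by blast

lemma dst_nonneg: "v \<in> Rn (dim_x S i) \<Longrightarrow> 0 \<le> dst i v"
  by (rule X.Ni.set_distance_nonneg[OF As_sub As_nonempty])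

lemma Vs_nonneg: "v \<in> sub_states S i \<Longrightarrow> 0 \<le> Vs i v"
  using Vs_lower[of v i] alpha_low by (meson mult_nonneg_nonneg less_imp_le order_trans powr_ge_zero)

lemma Vs_eq_0_iff:
  assumes "v \<in> sub_states S i"
  shows "Vs i v = 0 \<longleftrightarrow> v \<in> As i"
proof -
  have "dst i v = 0 \<longleftrightarrow> v \<in> As i"
    using assms X.Ni.set_distance_eq_0_iff[OF As_closed' As_nonempty] by (simp add: sub_states_def)
  moreover have "Vs i v = 0 \<longleftrightarrow> dst i v = 0"
  proof
    assume "Vs i v = 0"
    then have "dst i v powr exp_p S \<le> 0"
      using Vs_lower[OF assms] alpha_low by (simp add: mult_le_0_iff)
    then show "dst i v = 0" using powr_ge_zero[of "dst i v" "exp_p S"] by simp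
  next
    assume "dst i v = 0"
    then show "Vs i v = 0"
      using Vs_lower[OF assms] Vs_upper[OF assms] X.p by simp
  qed
  ultimately show ?thesis by simp
qed

text \<open>Compared with the norms of the components of \<open>x - a\<close> for some
  \<open>a\<close> in \<open>A\<close>; existence of such a point is what makes the distances
  p-summable.\<close>

lemma dst_summable:
  assumes x: "x \<in> X.lpX"
  shows "summable (\<lambda>i. dst i (x i) powr exp_p S)"
proof -
  obtain a where a: "a \<in> A" using A_nonempty by blast
  then have aX: "a \<in> X.lpX" and ai: "a i \<in> As i" for i using A_sub A_def by auto
  have "summable (\<lambda>i. norm_x S i ((x - a) i) powr exp_p S)"
    by (rule X.powr_summable[OF X.lp_space_diff_closed[OF x aX]])
  then show ?thesis
  proof (rule summable_comparison_test'[where N = 0])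
    show "norm (dst i (x i) powr exp_p S) \<le> norm_x S i ((x - a) i) powr exp_p S" for i
      using X.Ni.set_distance_le[OF As_sub X.component[OF x] ai] dst_nonneg[OF X.component[OF x]] X.p
      by (auto intro!: powr_mono2)
  qed
qed

text \<open>The infimum over the product set splits into the componentwise infima. One inequality is
  termwise; for the other, near-minimisers chosen in each component form a point of the
  product.\<close>

lemma state_distance_powr:
  assumes x: "x \<in> state_space S"
  shows "state_distance S A x powr exp_p S = (\<Sum>i. dst i (x i) powr exp_p S)"
proof -
  let ?p = "exp_p S" and ?D = "\<Sum>i. dst i (x i) powr exp_p S"
  have xX: "x \<in> X.lpX" using x by (simp add: state_space_def)
  note dn = dst_nonneg[OF X.component[OF xX]]
  have sd: "state_distance S A x = set_distance X.lpN A x"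
    by (simp add: state_distance_def state_norm_def)
  have nn: "0 \<le> state_distance S A x"
    unfolding sd by (rule X.set_distance_nonneg[OF A_sub A_nonempty xX])
  have D0: "0 \<le> ?D" by (intro suminf_nonneg dst_summable xX) auto
  have "?D powr (1 / ?p) \<le> state_distance S A x"
    unfolding sd set_distance_def[of X.lpN]
  proof (rule cINF_greatest[OF A_nonempty])
    fix y assume y: "y \<in> A"
    then have yX: "y \<in> X.lpX" and yi: "y i \<in> As i" for i using A_sub A_def by auto
    have mem: "x - y \<in> X.lpX" by (rule X.lp_space_diff_closed[OF xX yX])
    have "?D \<le> (\<Sum>i. norm_x S i ((x - y) i) powr ?p)"
      using X.Ni.set_distance_le[OF As_sub X.component[OF xX] yi] dn X.p
      by (intro suminf_le dst_summable xX X.powr_summable mem powr_mono2) auto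
    then show "?D powr (1 / ?p) \<le> X.lpN (x - y)"
      unfolding lp_norm_def using X.p D0 by (intro powr_mono2) auto
  qed
  then have "?D \<le> state_distance S A x powr ?p"
    using powr_mono2[of ?p "?D powr (1 / ?p)" "state_distance S A x"] X.p D0
    by (simp add: powr_inverse_cancel)
  moreover have "state_distance S A x powr ?p \<le> ?D"
  proof (rule field_le_epsilon)
    fix e :: real assume e: "0 < e"
    \<comment> \<open>The p-th powers exceed those of the distances by errors that sum to
      \<open>e\<close>.\<close>
    define r where "r i = (dst i (x i) powr ?p + e * (1 / 2) ^ Suc i) powr (1 / ?p)" for i
    have r: "dst i (x i) < r i" "r i powr ?p = dst i (x i) powr ?p + e * (1 / 2) ^ Suc i" for i
    proof -
      have "(dst i (x i) powr ?p) powr (1 / ?p) < r i"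
        unfolding r_def using X.p e by (intro powr_less_mono2) auto
      then show "dst i (x i) < r i" using dn X.p by (simp add: powr_inverse_cancel)
      show "r i powr ?p = dst i (x i) powr ?p + e * (1 / 2) ^ Suc i"
        unfolding r_def using X.p e by (intro powr_inverse_cancel) (auto intro: add_nonneg_nonneg)
    qed
    have "\<forall>i. \<exists>y\<in>As i. norm_x S i (x i - y) < r i"
      using X.Ni.set_distance_less_ex[OF As_nonempty r(1)] by blast
    then obtain y where y: "\<And>i. y i \<in> As i" "\<And>i. norm_x S i (x i - y i) < r i" by metis
    have yR: "y i \<in> Rn (dim_x S i)" for i using y(1) As_sub by blast
    let ?r = "\<lambda>i. dst i (x i) powr ?p + e * (1 / 2) ^ Suc i"
    have rs: "?r sums (?D + e * 1)"
      by (intro sums_add sums_mult power_half_series summable_sums dst_summable xX)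
    have le: "norm_x S i ((x - y) i) powr ?p \<le> ?r i" for i
      unfolding r(2)[symmetric]
      using y(2)[of i] X.p X.Ni.nonneg[OF Rn_diff[OF X.component[OF xX] yR]]
      by (intro powr_mono2) (auto intro: less_imp_le)
    have sm: "summable (\<lambda>i. norm_x S i ((x - y) i) powr ?p)"
      by (rule summable_comparison_test[OF _ sums_summable[OF rs]]) (use le in auto)
    then have xy: "x - y \<in> X.lpX"
      unfolding lp_space_def using Rn_diff[OF X.component[OF xX] yR] by simp
    \<comment> \<open>The chosen \<open>y\<close> lies in the state space because \<open>x\<close>
      and \<open>x - y\<close> do.\<close>
    have "x - (x - y) = y" by (simp add: fun_eq_iff)
    then have "y \<in> X.lpX" using X.lp_space_diff_closed[OF xX xy] by simp
    then have yA: "y \<in> A" using y(1) by (simp add: A_def state_space_def)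
    have "state_distance S A x powr ?p \<le> X.lpN (x - y) powr ?p"
      using X.set_distance_le[OF A_sub xX yA] nn X.p unfolding sd by (intro powr_mono2) auto
    also have "\<dots> = (\<Sum>i. norm_x S i ((x - y) i) powr ?p)" by (rule X.lp_norm_powr[OF xy])
    also have "\<dots> \<le> ?D + e"
      using suminf_le[OF le sm sums_summable[OF rs]] sums_unique[OF rs] by simp
    finally show "state_distance S A x powr ?p \<le> ?D + e" .
  qed
  ultimately show ?thesis by simp
qed

lemma A_closed: "closedin (state_top S) A"
  unfolding state_top_def state_space_def state_norm_def X.closedin_norm_topology_iff
proof (intro conjI A_sub ballI)
  fix x assume x: "x \<in> X.lpX - A"
  then obtain i where i: "x i \<notin> As i" by (auto simp: A_def state_space_def)
  have xi: "x i \<in> Rn (dim_x S i)" using x X.component by blast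
  have "0 < dst i (x i)"
    using dst_nonneg[OF xi] X.Ni.set_distance_eq_0_iff[OF As_closed' As_nonempty xi] i by simp
  moreover have "dst i (x i) \<le> X.lpN (x - y)" if y: "y \<in> A" for y
  proof -
    have "y i \<in> As i" "y \<in> X.lpX" using y A_sub by (auto simp: A_def)
    then show ?thesis
      using X.Ni.set_distance_le[OF As_sub xi] X.component_diff_le[of x y i] x
      by (meson DiffD1 order_trans)
  qed
  ultimately show "\<exists>r>0. \<forall>y\<in>A. r \<le> X.lpN (x - y)" by blast
qed

end

section \<open>The weighted sum as a coercive continuous function on the state space\<close>

locale weighted_network = coercive_network +
  fixes mu :: "nat \<Rightarrow> real" and mu_up :: real
  assumes mu: "1 \<le> mu i" "mu i \<le> mu_up"
begin

definition V :: "vseq \<Rightarrow> real" where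
  "V x = (\<Sum>i. mu i * Vs i (x i))"

lemma mu_up: "1 \<le> mu_up" using mu(1)[of 0] mu(2)[of 0] by linarith

lemma weighted_term_bounds:
  assumes "v \<in> sub_states S i"
  shows "alpha_low * dst i v powr exp_p S \<le> mu i * Vs i v"
    and "mu i * Vs i v \<le> mu_up * alpha_up * dst i v powr exp_p S"
    and "0 \<le> mu i * Vs i v"
proof -
  have 0: "0 \<le> Vs i v" by (rule Vs_nonneg[OF assms])
  show "alpha_low * dst i v powr exp_p S \<le> mu i * Vs i v"
    using Vs_lower[OF assms] mult_right_mono[OF mu(1)[of i] 0] by simp
  show "mu i * Vs i v \<le> mu_up * alpha_up * dst i v powr exp_p S"
    using mult_mono[OF mu(2)[of i] Vs_upper[OF assms]] mu_up 0 by (simp add: mult.assoc)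
  show "0 \<le> mu i * Vs i v" using 0 mu(1)[of i] by simp
qed

lemma V_summable:
  assumes "x \<in> state_space S"
  shows "summable (\<lambda>i. mu i * Vs i (x i))"
proof (rule summable_comparison_test)
  have x: "x \<in> X.lpX" using assms by (simp add: state_space_def)
  show "summable (\<lambda>i. mu_up * alpha_up * dst i (x i) powr exp_p S)"
    by (intro summable_mult dst_summable x)
qed (use weighted_term_bounds[OF state_component[OF assms]] in auto)

lemma V_sums: "x \<in> state_space S \<Longrightarrow> (\<lambda>i. mu i * Vs i (x i)) sums V x"
  unfolding V_def by (intro summable_sums V_summable)

lemma V_nonneg: "x \<in> state_space S \<Longrightarrow> 0 \<le> V x"
  unfolding V_def by (intro suminf_nonneg V_summable weighted_term_bounds state_component)

lemma V_coercive:
  assumes "x \<in> state_space S"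
  shows "alpha_low * state_distance S A x powr exp_p S \<le> V x"
    and "V x \<le> mu_up * alpha_up * state_distance S A x powr exp_p S"
proof -
  have x: "x \<in> X.lpX" using assms by (simp add: state_space_def)
  show "alpha_low * state_distance S A x powr exp_p S \<le> V x"
    unfolding V_def state_distance_powr[OF assms] suminf_mult[OF dst_summable[OF x], symmetric]
    by (intro suminf_le weighted_term_bounds(1) state_component[OF assms] V_summable assms
        summable_mult dst_summable x)
  show "V x \<le> mu_up * alpha_up * state_distance S A x powr exp_p S"
    unfolding V_def state_distance_powr[OF assms] suminf_mult[OF dst_summable[OF x], symmetric]
    by (intro suminf_le weighted_term_bounds(2) state_component[OF assms] V_summable assms
        summable_mult dst_summable x)
qed

text \<open>Finite partial sums are continuous, and near \<open>a\<close> the tails are uniformly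
  small: the distance of \<open>x i\<close> to \<open>As i\<close> is at most that of
  \<open>a i\<close> plus the norm of the difference, and both are p-summable.\<close>

lemma V_continuous: "continuous_map (state_top S) euclideanreal V"
proof -
  let ?p = "exp_p S"
  define c where "c = mu_up * alpha_up * 2 powr ?p"
  have part: "continuous_map (state_top S) euclideanreal (\<lambda>x. \<Sum>i<n. mu i * Vs i (x i))" for n
    by (intro continuous_map_sum continuous_map_real_mult continuous_map_const[THEN iffD2]
        continuous_map_compose[OF continuous_map_component Vs_cont, unfolded o_def]) auto
  show ?thesis
    unfolding state_top_def state_space_def state_norm_def X.continuous_map_norm_real_iff
  proof (intro ballI allI impI)
    fix a :: vseq and e :: real assume a: "a \<in> X.lpX" and e: "0 < e"
    have aS: "a \<in> state_space S" using a by (simp add: state_space_def)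
    let ?t = "\<lambda>i. dst i (a i) powr ?p"
    \<comment> \<open>Both parts of the tail bound are kept below \<open>eta\<close>, so a tail is
      at most \<open>e / 2\<close>; as tails are nonnegative, this and \<open>e / 4\<close> for the
      partial sums stay below \<open>e\<close>.\<close>
    define eta where "eta = e / (4 * (\<bar>c\<bar> + 1))"
    have eta: "0 < eta" "\<bar>c\<bar> * eta \<le> e / 4" using e by (auto simp: eta_def field_simps)
    obtain n where n: "(\<Sum>i. ?t (i + n)) < eta"
    proof -
      have "(\<lambda>n. \<Sum>i. ?t (i + n)) \<longlonglongrightarrow> 0" by (rule suminf_exist_split2[OF dst_summable[OF a]])
      then have "\<forall>\<^sub>F n in sequentially. (\<Sum>i. ?t (i + n)) < eta"
        using eta(1) by (rule order_tendstoD)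
      then show ?thesis using that by (auto simp: eventually_sequentially)
    qed
    let ?P = "\<lambda>x. \<Sum>i<n. mu i * Vs i (x i)" and ?T = "\<lambda>x. \<Sum>i. mu (i + n) * Vs (i + n) (x (i + n))"
    have split: "V x = ?T x + ?P x" if "x \<in> state_space S" for x
      unfolding V_def by (rule suminf_split_initial_segment[OF V_summable[OF that]])
    have T0: "0 \<le> ?T x" if "x \<in> state_space S" for x
      using summable_iff_shift[THEN iffD2, OF V_summable[OF that]]
      by (intro suminf_nonneg weighted_term_bounds state_component[OF that])
    obtain r1 where r1: "0 < r1" "\<And>x. x \<in> X.lpX \<Longrightarrow> X.lpN (a - x) < r1 \<Longrightarrow> dist (?P a) (?P x) < e / 4"
    proof -
      have "\<forall>a\<in>X.lpX. \<forall>e>0. \<exists>r>0. \<forall>x. x \<in> X.lpX \<and> X.lpN (a - x) < r \<longrightarrow> dist (?P a) (?P x) < e"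
        using part[of n]
        unfolding state_top_def state_space_def state_norm_def X.continuous_map_norm_real_iff .
      then have "\<exists>r>0. \<forall>x. x \<in> X.lpX \<and> X.lpN (a - x) < r \<longrightarrow> dist (?P a) (?P x) < e / 4"
        using a divide_pos_pos[OF e, of 4] by (simp only: zero_less_numeral)
      then show ?thesis using that by blast
    qed
    define r2 where "r2 = eta powr (1 / ?p)"
    have r2: "0 < r2" using eta(1) by (simp add: r2_def)
    have T: "?T x \<le> e / 2" if x: "x \<in> X.lpX" and r: "X.lpN (a - x) < r2" for x
    proof -
      have xS: "x \<in> state_space S" using x by (simp add: state_space_def)
      have mem: "a - x \<in> X.lpX" by (rule X.lp_space_diff_closed[OF a x])
      let ?s = "\<lambda>i. norm_x S i ((a - x) i) powr ?p"
      have termwise: "mu i * Vs i (x i) \<le> \<bar>c\<bar> * (?s i + ?t i)" for i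
      proof -
        have d: "dst i (x i) \<le> norm_x S i (x i - a i) + dst i (a i)"
          by (rule X.Ni.set_distance_triangle[OF As_sub As_nonempty X.component[OF x] X.component[OF a]])
        also have "norm_x S i (x i - a i) = norm_x S i ((a - x) i)"
          using X.Ni.norm_diff_commute[OF X.component[OF x] X.component[OF a]] by simp
        finally have "dst i (x i) powr ?p \<le> (norm_x S i ((a - x) i) + dst i (a i)) powr ?p"
          using dst_nonneg[OF X.component[OF x]] X.p by (intro powr_mono2) auto
        also have "\<dots> \<le> 2 powr ?p * (?s i + ?t i)"
          using X.Ni.nonneg[OF X.component[OF mem]] dst_nonneg[OF X.component[OF a]] X.p
          by (intro powr_add_le_double) auto
        finally have *: "dst i (x i) powr ?p \<le> 2 powr ?p * (?s i + ?t i)" .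
        have "mu i * Vs i (x i) \<le> mu_up * alpha_up * dst i (x i) powr ?p"
          by (rule weighted_term_bounds(2)[OF state_component[OF xS]])
        also have "\<dots> \<le> \<bar>mu_up * alpha_up\<bar> * (2 powr ?p * (?s i + ?t i))"
          using * by (intro mult_mono) auto
        finally show ?thesis by (simp add: c_def abs_mult mult_ac)
      qed
      have s1: "summable (\<lambda>i. ?s (i + n))" "summable (\<lambda>i. ?t (i + n))"
        using summable_iff_shift[of ?s n] summable_iff_shift[of ?t n] X.powr_summable[OF mem] dst_summable[OF a]
        by auto
      have "(\<Sum>i. ?s (i + n)) \<le> (\<Sum>i. ?s i)"
        using suminf_split_initial_segment[OF X.powr_summable[OF mem], of n] by (simp add: sum_nonneg)
      also have "\<dots> = X.lpN (a - x) powr ?p" by (rule X.lp_norm_powr[OF mem, symmetric])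
      also have "\<dots> \<le> r2 powr ?p" using r X.p X.lp_norm_nonneg by (intro powr_mono2) auto
      also have "\<dots> = eta" unfolding r2_def using eta X.p by (simp add: powr_inverse_cancel)
      finally have s: "(\<Sum>i. ?s (i + n)) \<le> eta" .
      have "?T x \<le> (\<Sum>i. \<bar>c\<bar> * (?s (i + n) + ?t (i + n)))"
        using summable_iff_shift[THEN iffD2, OF V_summable[OF xS]]
        by (intro suminf_le termwise summable_mult summable_add s1)
      also have "\<dots> = \<bar>c\<bar> * ((\<Sum>i. ?s (i + n)) + (\<Sum>i. ?t (i + n)))"
        by (intro sums_unique[symmetric] sums_mult sums_add summable_sums s1)
      also have "\<dots> \<le> \<bar>c\<bar> * (eta + eta)"
        using s n by (intro mult_left_mono add_mono) auto
      finally show ?thesis using eta(2) by (simp add: algebra_simps)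
    qed
    show "\<exists>r>0. \<forall>x. x \<in> X.lpX \<and> X.lpN (a - x) < r \<longrightarrow> dist (V a) (V x) < e"
    proof (intro exI[of _ "min r1 r2"] conjI allI impI)
      fix x assume x: "x \<in> X.lpX \<and> X.lpN (a - x) < min r1 r2"
      then have xS: "x \<in> state_space S" by (simp add: state_space_def)
      have "X.lpN (a - a) = 0" using X.norm_diff_eq_0[OF a a] by simp
      then have "?T a \<le> e / 2" using T[OF a] r2 by simp
      moreover have "?T x \<le> e / 2" using T x by simp
      moreover have "dist (?P a) (?P x) < e / 4" using r1(2) x by simp
      ultimately show "dist (V a) (V x) < e"
        using split[OF aS] split[OF xS] T0[OF aS] T0[OF xS] unfolding dist_real_def by linarith
    qed (use r1 r2 in auto)
  qed
qed

end

section \<open>Maximal solutions and restarted trajectories\<close>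

lemma max_solution_eq:
  assumes "uniquely_solvable sol" "sol T x" "0 \<le> t" "ereal t < T"
  shows "max_solution sol t = x t"
  unfolding max_solution_def
proof (rule the_equality)
  show "\<exists>T y. sol T y \<and> ereal t < T \<and> y t = x t" using assms by blast
  show "v = x t" if "\<exists>T x. sol T x \<and> ereal t < T \<and> x t = v" for v
    using that assms unfolding uniquely_solvable_def by blast
qed

lemma less_max_timeE:
  assumes "t < max_time sol"
  obtains T x where "sol T x" "t < T"
  using assms unfolding max_time_def less_Sup_iff by blast

lemma le_max_time: "sol T x \<Longrightarrow> T \<le> max_time sol"
  unfolding max_time_def by (intro Sup_upper) blast

lemma borel_measurable_shift_halfline:
  fixes f :: "real \<Rightarrow> real"
  assumes f: "f \<in> borel_measurable (lebesgue_on {0..})" and a: "0 \<le> a"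
  shows "(\<lambda>t. f (a + t)) \<in> borel_measurable (lebesgue_on {0..})"
proof -
  have H: "{0::real..} \<inter> space lebesgue \<in> sets lebesgue" by simp
  have "(\<lambda>t. indicator {0..} t *\<^sub>R f t) \<in> borel_measurable lebesgue"
    using f unfolding borel_measurable_restrict_space_iff[OF H] .
  from borel_measurable_affine[OF this, of 1 a]
  have M: "(\<lambda>t. indicator {0..} (a + t) *\<^sub>R f (a + t)) \<in> borel_measurable lebesgue" by simp
  have "(\<lambda>t. indicator {0..} t *\<^sub>R (indicator {0..} (a + t) *\<^sub>R f (a + t))) \<in> borel_measurable lebesgue"
    by (rule borel_measurable_scaleR[OF borel_measurable_indicator M]) simp
  moreover have "indicator {0..} t *\<^sub>R (indicator {0..} (a + t) *\<^sub>R f (a + t)) = indicator {0..} t *\<^sub>R f (a + t)" for t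
    using a by (auto simp: indicator_def)
  ultimately show ?thesis
    unfolding borel_measurable_restrict_space_iff[OF H] by (simp only:)
qed

lemma AE_lebesgue_iff_negligible:
  fixes P :: "real \<Rightarrow> bool"
  shows "(AE t in lebesgue. P t) \<longleftrightarrow> negligible {t. \<not> P t}"
  unfolding completion.AE_iff_null_sets negligible_iff_null_sets by (simp add: Collect_neg_eq)

lemma AE_lebesgue_shift:
  fixes P :: "real \<Rightarrow> bool"
  assumes "AE t in lebesgue. P t"
  shows "AE t in lebesgue. P (a + t)"
proof -
  have "{t. \<not> P (a + t)} = (+) (- a) ` {t. \<not> P t}"
  proof (intro set_eqI iffI)
    fix t assume "t \<in> {t. \<not> P (a + t)}"
    then show "t \<in> (+) (- a) ` {t. \<not> P t}" by (intro image_eqI[of _ _ "a + t"]) auto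
  qed auto
  then show ?thesis
    using negligible_translation[of "{t. \<not> P t}" "- a"] assms unfolding AE_lebesgue_iff_negligible by simp
qed

lemma set_integral_shift:
  fixes f :: "real \<Rightarrow> real"
  shows "set_integrable lebesgue {0..t} (\<lambda>s. f (a + s)) \<longleftrightarrow> set_integrable lebesgue {a..a + t} f"
    and "(LINT s:{0..t}|lebesgue. f (a + s)) = (LINT s:{a..a + t}|lebesgue. f s)"
proof -
  have e: "indicator {0..t} s *\<^sub>R f (a + s) = (\<lambda>s. indicator {a..a + t} s *\<^sub>R f s) (a + 1 * s)" for s
    by (auto simp: indicator_def)
  show "set_integrable lebesgue {0..t} (\<lambda>s. f (a + s)) \<longleftrightarrow> set_integrable lebesgue {a..a + t} f"
    unfolding set_integrable_def e by (rule lebesgue_integrable_real_affine_iff) simp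
  show "(LINT s:{0..t}|lebesgue. f (a + s)) = (LINT s:{a..a + t}|lebesgue. f s)"
    unfolding set_lebesgue_integral_def e
    using lebesgue_integral_real_affine[of 1 "\<lambda>s. indicator {a..a + t} s *\<^sub>R f s" a] by simp
qed

section \<open>Network trajectories as subsystem trajectories\<close>

context network_setting
begin

lemma input_component:
  assumes "u \<in> inputs S" "0 \<le> t"
  shows "u t i \<in> sub_inputs S i"
proof -
  have "u t \<in> U.lpX"
    using assms unfolding inputs_def strongly_measurable_on_def input_values_def by auto
  then show ?thesis unfolding sub_inputs_def by (rule U.component)
qed

lemma input_strongly_measurable: "u \<in> inputs S \<Longrightarrow> strongly_measurable_on U.lpX U.lpN {0..} u"
  by (simp add: inputs_def input_values_def input_value_norm_def)

lemma AE_input_le_input_norm: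
  assumes "u \<in> inputs S"
  shows "AE t in lebesgue. 0 \<le> t \<longrightarrow> U.lpN (u t) \<le> input_norm S u"
    and "0 \<le> input_norm S u"
proof -
  obtain c where c: "AE t in lebesgue_on {0..}. U.lpN (u t) \<le> c"
    using assms unfolding inputs_def input_value_norm_def by blast
  have H: "{0::real..} \<inter> space lebesgue \<in> sets lebesgue" by simp
  note * = U.essentially_bounded_le_esssup[OF input_strongly_measurable[OF assms] c,
      folded input_norm_def[of S u, unfolded input_value_norm_def]]
  show "AE t in lebesgue. 0 \<le> t \<longrightarrow> U.lpN (u t) \<le> input_norm S u"
    using *(1) unfolding AE_restrict_space_iff[OF H] by simp
  show "0 \<le> input_norm S u" by (rule *(2))
qed

lemma AE_input_component_le:
  assumes "u \<in> inputs S"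
  shows "AE t in lebesgue. 0 \<le> t \<longrightarrow> norm_u S i (u t i) \<le> input_norm S u"
  using AE_input_le_input_norm(1)[OF assms]
proof eventually_elim
  case (elim t)
  show ?case
  proof
    assume t: "0 \<le> t"
    have "u t \<in> U.lpX"
      using assms t unfolding inputs_def strongly_measurable_on_def input_values_def by auto
    from U.component_le[OF this, of i] elim t show "norm_u S i (u t i) \<le> input_norm S u" by simp
  qed
qed

lemma input_norm_component_measurable:
  assumes "u \<in> inputs S"
  shows "(\<lambda>t. norm_u S i (u t i)) \<in> borel_measurable (lebesgue_on {0..})"
proof (rule U.strongly_measurable_imp_borel_measurable[where \<phi> = "\<lambda>x. norm_u S i (x i)" and c = 1])
  show "strongly_measurable_on U.lpX U.lpN {0..} u" by (rule input_strongly_measurable[OF assms])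
  show "\<bar>norm_u S i (x i) - norm_u S i (y i)\<bar> \<le> 1 * U.lpN (x - y)" if "x \<in> U.lpX" "y \<in> U.lpX" for x y
    by (rule U.lipschitz_component_norm[OF that])
qed simp

lemma input_coordinate_measurable:
  assumes "u \<in> inputs S"
  shows "(\<lambda>t. u t i k) \<in> borel_measurable (lebesgue_on {0..})"
proof -
  obtain c where c: "\<And>x. x \<in> U.lpX \<Longrightarrow> \<bar>x i k\<bar> \<le> c * U.lpN x"
    using U.coordinate_bound by blast
  have "\<bar>x i k - y i k\<bar> \<le> c * U.lpN (x - y)" if "x \<in> U.lpX" "y \<in> U.lpX" for x y
    using c[OF U.lp_space_diff_closed[OF that]] by simp
  then show ?thesis
    by (intro U.strongly_measurable_imp_borel_measurable[OF _ input_strongly_measurable[OF assms],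
        where \<phi> = "\<lambda>x. x i k" and c = c]) auto
qed

lemma shifted_sub_input:
  assumes u: "u \<in> inputs S" and a: "0 \<le> a"
  shows "(\<lambda>t. u (a + t) i) \<in> Linf_sub_inputs S i"
  unfolding Linf_sub_inputs_def measurable_sub_input_def
proof (intro CollectI conjI allI impI)
  have H: "{0::real..} \<inter> space lebesgue \<in> sets lebesgue" by simp
  show "u (a + t) i \<in> sub_inputs S i" if "0 \<le> t" for t
    using input_component[OF u] that a by simp
  show "(\<lambda>t. u (a + t) i k) \<in> borel_measurable (lebesgue_on {0..})" for k
    by (rule borel_measurable_shift_halfline[OF input_coordinate_measurable[OF u] a])
  have "AE t in lebesgue. 0 \<le> t \<longrightarrow> norm_u S i (u (a + t) i) \<le> input_norm S u"
    using AE_lebesgue_shift[OF AE_input_component_le[OF u], of a i] by eventually_elim (use a in auto)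
  then show "\<exists>c. AE t in lebesgue_on {0..}. norm_u S i (u (a + t) i) \<le> c"
    unfolding AE_restrict_space_iff[OF H] by auto
qed

lemma Linf_sub_inputs_subset: "Linf_sub_inputs S i \<subseteq> Linf_loc_sub_inputs S i"
proof
  fix v assume v: "v \<in> Linf_sub_inputs S i"
  then obtain c where c: "AE t in lebesgue_on {0..}. norm_u S i (v t) \<le> c"
    unfolding Linf_sub_inputs_def by blast
  have H: "{0::real..} \<inter> space lebesgue \<in> sets lebesgue" by simp
  have "AE t in lebesgue_on {0..T}. norm_u S i (v t) \<le> c" for T
  proof -
    have T: "{0..T} \<inter> space lebesgue \<in> sets lebesgue" by simp
    show ?thesis
      using c unfolding AE_restrict_space_iff[OF H] AE_restrict_space_iff[OF T]
      by eventually_elim auto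
  qed
  then show "v \<in> Linf_loc_sub_inputs S i"
    using v unfolding Linf_sub_inputs_def Linf_loc_sub_inputs_def by blast
qed

lemma network_solution_mem:
  assumes "network_solution S x0 u T x" "0 \<le> t" "ereal t < T"
  shows "x t \<in> state_space S"
proof -
  have "x ` topspace (top_of_set {t. 0 \<le> t \<and> ereal t < T}) \<subseteq> topspace (state_top S)"
    using assms(1) unfolding network_solution_def by (intro continuous_map_image_subset_topspace) blast
  moreover have "topspace (state_top S) = state_space S"
    unfolding state_top_def state_space_def state_norm_def by (rule X.topspace_norm_topology)
  ultimately show ?thesis using assms(2,3) by auto
qed

lemma network_solution_coordinate:
  assumes sol: "network_solution S x0 u T x" and t: "0 \<le> t" "ereal t < T"
  shows "set_integrable lebesgue {0..t} (\<lambda>s. rhs S i (x s i) (x s) (u s i) k)"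
    and "x t i k = x0 i k + (LINT s:{0..t}|lebesgue. rhs S i (x s i) (x s) (u s i) k)"
proof -
  have B: "has_bochner_integral_on X.lpX X.lpN {0..t} (\<lambda>s. network_rhs S (x s) (u s)) (x t - x0)"
    using sol t unfolding network_solution_def state_space_def state_norm_def by blast
  have L: "{0..t} \<in> lmeasurable" "{0..t} \<in> sets lebesgue" by auto
  note * = X.bochner_integral_coordinate[OF L(1) B, of i k]
  show "set_integrable lebesgue {0..t} (\<lambda>s. rhs S i (x s i) (x s) (u s i) k)"
    using *(1) unfolding set_integrable_iff_lebesgue_on(1)[OF L(2)] by (simp add: network_rhs_def)
  show "x t i k = x0 i k + (LINT s:{0..t}|lebesgue. rhs S i (x s i) (x s) (u s i) k)"
    using *(2) unfolding set_integrable_iff_lebesgue_on(2)[OF L(2)] by (simp add: network_rhs_def)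
qed

text \<open>The initial value is encoded only through the integral equation, and the integral over
  the single point 0 vanishes.\<close>

lemma network_solution_initial:
  assumes sol: "network_solution S x0 u T x"
  shows "x 0 = x0"
proof -
  have T: "ereal 0 < T" using sol by (simp add: network_solution_def zero_ereal_def)
  have "x 0 i k = x0 i k" for i k
  proof -
    have "(LINT s:{0..0}|lebesgue. rhs S i (x s i) (x s) (u s i) k) = 0"
      unfolding set_lebesgue_integral_def
    proof (rule integral_eq_zero_AE)
      have "AE t in lebesgue. t \<noteq> (0::real)" by (simp add: AE_lebesgue_iff_negligible)
      then show "AE s in lebesgue. indicator {0..0} s *\<^sub>R rhs S i (x s i) (x s) (u s i) k = 0"
        by eventually_elim simp
    qed
    then show ?thesis using network_solution_coordinate(2)[OF sol order_refl T, of i k] by simp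
  qed
  then show ?thesis by blast
qed

lemma network_solution_increment:
  assumes sol: "network_solution S x0 u T x" and t: "0 \<le> a" "a \<le> b" "ereal b < T"
  shows "set_integrable lebesgue {a..b} (\<lambda>s. rhs S i (x s i) (x s) (u s i) k)"
    and "x b i k = x a i k + (LINT s:{a..b}|lebesgue. rhs S i (x s i) (x s) (u s i) k)"
proof -
  let ?f = "\<lambda>s. rhs S i (x s i) (x s) (u s i) k"
  have aT: "ereal a < T" using t by (meson ereal_less_eq(3) le_less_trans)
  have "0 \<le> b" using t by simp
  note A = network_solution_coordinate[OF sol t(1) aT, of i k]
  note B = network_solution_coordinate[OF sol \<open>0 \<le> b\<close> t(3), of i k]
  show I: "set_integrable lebesgue {a..b} ?f"
    by (rule set_integrable_subset[OF B(1)]) (use t in auto)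
  have "(LINT s:{0..b}|lebesgue. ?f s) = (LINT s:{0..a}|lebesgue. ?f s) + (LINT s:{a..b}|lebesgue. ?f s)"
    unfolding set_lebesgue_integral_eq_integral(2)[OF A(1)] set_lebesgue_integral_eq_integral(2)[OF B(1)]
      set_lebesgue_integral_eq_integral(2)[OF I]
    using Henstock_Kurzweil_Integration.integral_combine[OF t(1,2) set_lebesgue_integral_eq_integral(1)[OF B(1)]] by simp
  then show "x b i k = x a i k + (LINT s:{a..b}|lebesgue. ?f s)"
    using A(2) B(2) by simp
qed

text \<open>From time \<open>a\<close> on, component i solves its subsystem with the network state
  as internal input; uniqueness identifies it with the subsystem flow. The state is frozen after
  \<open>b\<close> because an internal input must be continuous on the whole half-line, while
  \<open>x\<close> may exist only up to \<open>T\<close>.\<close>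

lemma restarted_trajectory:
  fixes i :: nat
  assumes sol: "network_solution S x0 u T x" and u: "u \<in> inputs S"
    and a: "0 \<le> a" "a < b" "ereal b < T"
  defines "w \<equiv> \<lambda>t. x (min (a + t) b)" and "v \<equiv> \<lambda>t. u (a + t) i"
  shows "w \<in> internal_inputs S"
    and "ereal (b - a) \<le> sub_max_time S i (x a i) w v"
    and "\<And>t. 0 \<le> t \<Longrightarrow> t < b - a \<Longrightarrow> sub_flow S i (x a i) w v t = x (a + t) i"
proof -
  let ?D = "{t. 0 \<le> t \<and> ereal t < T}"
  have inD: "t \<in> ?D" if "0 \<le> t" "t \<le> b" for t
    using that a(3) by (auto intro: le_less_trans[of "ereal t" "ereal b"])
  have xc: "continuous_map (top_of_set ?D) (state_top S) x"
    using sol by (simp add: network_solution_def)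
  have "continuous_map (top_of_set {0..}) (top_of_set ?D) (\<lambda>t. min (a + t) b)"
  proof -
    have "min (a + t) b \<in> ?D" if "t \<in> {0..}" for t
      using that a by (intro inD) auto
    then have "(\<lambda>t. min (a + t) b) \<in> {0..} \<rightarrow> ?D" by (rule Pi_I)
    then show ?thesis
      by (auto simp: continuous_map_in_subtopology intro!: continuous_intros)
  qed
  from continuous_map_compose[OF this xc] show w: "w \<in> internal_inputs S"
    by (simp add: internal_inputs_def w_def o_def)
  have v: "v \<in> Linf_sub_inputs S i"
    unfolding v_def by (rule shifted_sub_input[OF u a(1)])
  have aT: "ereal a < T" using inD[of a] a by simp
  have us: "uniquely_solvable (sub_solution S i (x a i) w v)"
    using setting w v Linf_sub_inputs_subset state_component[OF network_solution_mem[OF sol a(1) aT]]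
    unfolding infinite_network_def by blast
  have ss: "sub_solution S i (x a i) w v (ereal (b - a)) (\<lambda>t. x (a + t) i)"
    unfolding sub_solution_def
  proof (intro conjI allI impI)
    show "0 < ereal (b - a)" using a by simp
    let ?D' = "{t. 0 \<le> t \<and> ereal t < ereal (b - a)}"
    have "(\<lambda>t. a + t) \<in> ?D' \<rightarrow> ?D" using a inD by auto
    then have "continuous_map (top_of_set ?D') (top_of_set ?D) (\<lambda>t. a + t)"
      by (auto simp: continuous_map_in_subtopology intro!: continuous_intros)
    from continuous_map_compose[OF continuous_map_compose[OF this xc] continuous_map_component]
    show "continuous_map (top_of_set ?D') (sub_state_top S i) (\<lambda>t. x (a + t) i)"
      by (simp add: o_def)
    fix t k assume t: "0 \<le> t \<and> ereal t < ereal (b - a)"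
    let ?f = "\<lambda>s. rhs S i (x s i) (x s) (u s i) k"
    have atT: "ereal (a + t) < T" using inD[of "a + t"] t a by simp
    note inc = network_solution_increment[OF sol a(1) _ atT, of i k]
    have e: "rhs S i (x (a + s) i) (w s) (v s) k = ?f (a + s)" if "s \<in> {0..t}" for s
      using that t by (simp add: w_def v_def)
    have ie: "indicator {0..t} s *\<^sub>R rhs S i (x (a + s) i) (w s) (v s) k = indicator {0..t} s *\<^sub>R ?f (a + s)" for s
      using e[of s] by (simp add: indicator_def)
    have "set_integrable lebesgue {0..t} (\<lambda>s. ?f (a + s))"
      using inc(1) t by (simp add: set_integral_shift(1)[of t ?f a])
    then show "set_integrable lebesgue {0..t} (\<lambda>s. rhs S i (x (a + s) i) (w s) (v s) k)"
      unfolding set_integrable_def ie .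
    have "(LINT s:{0..t}|lebesgue. rhs S i (x (a + s) i) (w s) (v s) k) = (LINT s:{0..t}|lebesgue. ?f (a + s))"
      unfolding set_lebesgue_integral_def ie ..
    then show "x (a + t) i k = x a i k + (LINT s:{0..t}|lebesgue. rhs S i (x (a + s) i) (w s) (v s) k)"
      using inc(2) t by (simp add: set_integral_shift(2)[of t ?f a])
  qed
  show "ereal (b - a) \<le> sub_max_time S i (x a i) w v"
    unfolding sub_max_time_def 
    by (rule le_max_time[where sol = "sub_solution S i (x a i) w v" and x = "\<lambda>t. x (a + t) i"]) (rule ss)
  show "sub_flow S i (x a i) w v t = x (a + t) i" if "0 \<le> t" "t < b - a" for t
    unfolding sub_flow_def
    using max_solution_eq[where sol = "sub_solution S i (x a i) w v" and T = "ereal (b - a)"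
        and x = "\<lambda>t. x (a + t) i" and t = t] us ss that by simp
qed

end

section \<open>Dissipation along trajectories\<close>

context coercive_network
begin

lemma continuous_on_Vs_trajectory:
  assumes "network_solution S x0 u T x"
  shows "continuous_on {t. 0 \<le> t \<and> ereal t < T} (\<lambda>t. Vs i (x t i))"
proof -
  have "continuous_map (top_of_set {t. 0 \<le> t \<and> ereal t < T}) (state_top S) x"
    using assms by (simp add: network_solution_def)
  from continuous_map_compose[OF continuous_map_compose[OF this continuous_map_component] Vs_cont]
  show ?thesis by (simp add: o_def)
qed

end

lemma (in weighted_network) continuous_on_V_trajectory:
  assumes "network_solution S x0 u T x"
  shows "continuous_on {t. 0 \<le> t \<and> ereal t < T} (\<lambda>t. V (x t))"
proof -
  have "continuous_map (top_of_set {t. 0 \<le> t \<and> ereal t < T}) (state_top S) x"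
    using assms by (simp add: network_solution_def)
  from continuous_map_compose[OF this V_continuous] show ?thesis by (simp add: o_def)
qed

lemma eventually_right_of_continuous:
  fixes g :: "real \<Rightarrow> real"
  assumes "continuous_on {s..t} g" "s \<le> \<tau>" "\<tau> < t" "open U" "g \<tau> \<in> U"
  shows "\<forall>\<^sub>F h in at_right 0. g (\<tau> + h) \<in> U"
proof -
  have "(g \<longlongrightarrow> g \<tau>) (at \<tau> within {s..t})"
    using assms by (auto simp: continuous_on_def)
  then have "(g \<longlongrightarrow> g \<tau>) (at \<tau> within {\<tau>..t})"
    by (rule tendsto_within_subset) (use assms in auto)
  then have "(g \<longlongrightarrow> g \<tau>) (at_right \<tau>)"
    using assms by (simp add: at_within_Icc_at_right)
  then have "\<forall>\<^sub>F y in at_right \<tau>. g y \<in> U"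
    using assms by (auto simp: tendsto_def)
  then show ?thesis
    unfolding eventually_at_right_to_0[of _ \<tau>] by (simp add: add.commute)
qed

locale dissipative_network = weighted_network +
  fixes lam gain_u :: "nat \<Rightarrow> real" and gain :: "nat \<Rightarrow> nat \<Rightarrow> real"
    and K th lam_low gain_u_up :: real
  assumes lam: "0 < lam_low" "lam_low \<le> lam i"
    and gain_nonneg: "0 \<le> gain i j" and gain_column: "(\<Sum>i<n. gain i j) \<le> K"
    and th: "0 \<le> th" "th < 1" and gain_weights: "(\<Sum>i<n. mu i * gain i j) \<le> th * (lam j * mu j)"
    and gain_u: "0 \<le> gain_u i" "gain_u i \<le> gain_u_up"
    and dissipative: "x0 \<in> sub_states S i - As i \<Longrightarrow> w \<in> internal_inputs S \<Longrightarrow> v \<in> Linf_sub_inputs S i \<Longrightarrow>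
          AE t in lebesgue. 0 \<le> t \<and> ereal t < sub_max_time S i x0 w v \<longrightarrow>
            upper_dini (\<lambda>s. Vs i (sub_flow S i x0 w v s)) t
              \<le> ereal (- lam i * Vs i (sub_flow S i x0 w v t))
                + (\<Sum>j. ereal (gain i j * Vs j (w t j)))
                + ereal (gain_u i * norm_u S i (v t) powr exp_q S)"
    and dini_finite: "x0 \<in> sub_states S i - As i \<Longrightarrow> w \<in> internal_inputs S \<Longrightarrow> v \<in> Linf_sub_inputs S i \<Longrightarrow>
          0 \<le> t \<Longrightarrow> ereal t < sub_max_time S i x0 w v \<Longrightarrow>
            lower_dini (\<lambda>s. Vs i (sub_flow S i x0 w v s)) t < \<infinity>"
begin

lemma lam_pos: "0 < lam i"
  using lam by (rule less_le_trans)

lemma K_nonneg: "0 \<le> K"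
  using gain_column[where n = 0] by simp

lemma gain_le: "gain i j \<le> K"
  using member_le_sum[of i "{..<Suc i}" "\<lambda>i. gain i j"] gain_column[where n = "Suc i" and j = j] gain_nonneg
  by auto

definition coupling :: "nat \<Rightarrow> vseq \<Rightarrow> real" where
  "coupling i x = (\<Sum>j. gain i j * Vs j (x j))"

lemma coupling_term_bounds:
  assumes "x \<in> state_space S"
  shows "0 \<le> gain i j * Vs j (x j)" "gain i j * Vs j (x j) \<le> K * (mu j * Vs j (x j))"
proof -
  have v: "0 \<le> Vs j (x j)" by (rule Vs_nonneg[OF state_component[OF assms]])
  show "0 \<le> gain i j * Vs j (x j)" using v gain_nonneg by simp
  have "Vs j (x j) \<le> mu j * Vs j (x j)" using mu(1)[of j] v by (simp add: mult_le_cancel_right1)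
  then show "gain i j * Vs j (x j) \<le> K * (mu j * Vs j (x j))"
    using gain_le[of i j] v K_nonneg gain_nonneg by (intro mult_mono) auto
qed

lemma coupling_summable:
  assumes "x \<in> state_space S"
  shows "summable (\<lambda>j. gain i j * Vs j (x j))"
proof (rule summable_comparison_test'[where N = 0])
  show "summable (\<lambda>j. K * (mu j * Vs j (x j)))" by (intro summable_mult V_summable assms)
  show "norm (gain i j * Vs j (x j)) \<le> K * (mu j * Vs j (x j))" for j
    using coupling_term_bounds[OF assms, of i j] by simp
qed

lemma coupling_bounds:
  assumes "x \<in> state_space S"
  shows "0 \<le> coupling i x" "coupling i x \<le> K * V x"
proof -
  show "0 \<le> coupling i x"
    unfolding coupling_def by (intro suminf_nonneg coupling_summable coupling_term_bounds assms)
  have "coupling i x \<le> (\<Sum>j. K * (mu j * Vs j (x j)))"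
    unfolding coupling_def
    by (intro suminf_le coupling_summable coupling_term_bounds summable_mult V_summable assms)
  then show "coupling i x \<le> K * V x"
    unfolding V_def by (simp add: suminf_mult V_summable assms)
qed

text \<open>The coupling sum in the subsystem estimate may be infinite in general; at points of the
  state space it is finite, being dominated by \<open>K\<close> times the series of
  \<open>V\<close>.\<close>

lemma coupling_ereal:
  assumes "x \<in> state_space S"
  shows "(\<Sum>j. ereal (gain i j * Vs j (x j))) = ereal (coupling i x)"
  unfolding coupling_def
  using coupling_summable[OF assms, of i] by (intro sums_unique[symmetric]) (simp add: sums_ereal summable_sums)

definition supply_rate :: "nat \<Rightarrow> (real \<Rightarrow> vseq) \<Rightarrow> (real \<Rightarrow> vseq) \<Rightarrow> real \<Rightarrow> real" where
  "supply_rate i x u t = coupling i (x t) + gain_u i * norm_u S i (u t i) powr exp_q S"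

text \<open>Only the starting value at time \<open>a\<close> must avoid \<open>As i\<close>; after
  that the subsystem estimate covers the interval up to \<open>b\<close>. Small increments of the
  restarted flow and of the trajectory coincide, hence so do the Dini derivatives.\<close>

lemma dini_along_trajectory:
  assumes sol: "network_solution S x0 u T x" and u: "u \<in> inputs S"
    and a: "0 \<le> a" "a < b" "ereal b < T" and off: "x a i \<notin> As i"
  shows "\<And>t. a \<le> t \<Longrightarrow> t < b \<Longrightarrow> lower_dini (\<lambda>t. Vs i (x t i)) t < \<infinity>"
    and "AE t in lebesgue. a \<le> t \<and> t < b \<longrightarrow>
           upper_dini (\<lambda>t. Vs i (x t i)) t \<le> ereal (- lam i * Vs i (x t i) + supply_rate i x u t)"
proof -
  let ?g = "\<lambda>t. Vs i (x t i)"
  define w where "w = (\<lambda>t. x (min (a + t) b))"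
  define v where "v = (\<lambda>t. u (a + t) i)"
  let ?y = "sub_flow S i (x a i) w v"
  have rw: "w \<in> internal_inputs S"
    unfolding w_def by (rule restarted_trajectory(1)[OF sol u a])
  have rtime: "ereal (b - a) \<le> sub_max_time S i (x a i) w v"
    unfolding w_def v_def by (rule restarted_trajectory(2)[OF sol u a])
  have rflow: "?y t = x (a + t) i" if "0 \<le> t" "t < b - a" for t
    unfolding w_def v_def by (rule restarted_trajectory(3)[OF sol u a that])
  have v: "v \<in> Linf_sub_inputs S i"
    unfolding v_def by (rule shifted_sub_input[OF u a(1)])
  have before_T: "ereal t < T" if "t \<le> b" for t
    using that a(3) by (auto intro: le_less_trans[of "ereal t" "ereal b"])
  have mem: "x t \<in> state_space S" if "0 \<le> t" "t \<le> b" for t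
    by (rule network_solution_mem[OF sol that(1) before_T[OF that(2)]])
  have xa: "x a i \<in> sub_states S i - As i"
    using state_component[OF mem[of a]] a off by simp
  have time: "ereal t < sub_max_time S i (x a i) w v" if "t < b - a" for t
    using that rtime less_le_trans[of "ereal t" "ereal (b - a)"] by simp
  have increments: "\<forall>\<^sub>F s in at_right 0. Vs i (?y (t + s)) - Vs i (?y t) = ?g (a + t + s) - ?g (a + t)"
    if t: "0 \<le> t" "t < b - a" for t
  proof -
    have "\<forall>\<^sub>F s in at_right 0. 0 < s \<and> s < b - a - t"
      using t unfolding eventually_at_right_field by (intro exI[of _ "b - a - t"]) auto
    then show ?thesis
      by eventually_elim (use t rflow in \<open>simp add: add.assoc\<close>)
  qed
  show "lower_dini ?g t < \<infinity>" if t: "a \<le> t" "t < b" for t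
  proof -
    have "lower_dini (\<lambda>s. Vs i (?y s)) (t - a) < \<infinity>"
      by (rule dini_finite[OF xa rw v]) (use t time in auto)
    moreover have "lower_dini (\<lambda>s. Vs i (?y s)) (t - a) = lower_dini ?g (a + (t - a))"
      by (rule lower_dini_cong[OF increments]) (use t in auto)
    ultimately show ?thesis by simp
  qed
  show "AE t in lebesgue. a \<le> t \<and> t < b \<longrightarrow>
           upper_dini ?g t \<le> ereal (- lam i * ?g t + supply_rate i x u t)"
    using AE_lebesgue_shift[OF dissipative[OF xa rw v], of "- a"]
  proof eventually_elim
    case (elim t)
    show ?case
    proof
      assume t: "a \<le> t \<and> t < b"
      have "upper_dini (\<lambda>s. Vs i (?y s)) (t - a) = upper_dini ?g (a + (t - a))"
        by (rule upper_dini_cong[OF increments]) (use t in auto)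
      moreover have "?y (t - a) = x t i" using rflow[of "t - a"] t by simp
      moreover have "w (t - a) = x t" "v (t - a) = u t i" using t by (auto simp: w_def v_def)
      moreover have "0 \<le> - a + t \<and> ereal (- a + t) < sub_max_time S i (x a i) w v"
        using t time[of "- a + t"] by simp
      ultimately show "upper_dini ?g t \<le> ereal (- lam i * ?g t + supply_rate i x u t)"
        using elim coupling_ereal[OF mem[of t], of i] t a by (simp add: supply_rate_def algebra_simps)
    qed
  qed
qed

text \<open>The coupling is bounded by \<open>K\<close> times \<open>V\<close>, which is continuous
  on the compact interval; the input term is essentially bounded.\<close>

lemma supply_rate_integrable:
  assumes sol: "network_solution S x0 u T x" and u: "u \<in> inputs S"
    and st: "0 \<le> s" "s \<le> t" "ereal t < T"
  shows "integrable (lebesgue_on {s..t}) (supply_rate i x u)"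
proof -
  let ?M = "lebesgue_on {s..t}"
  have sub: "{s..t} \<subseteq> {t. 0 \<le> t \<and> ereal t < T}"
    using st by (auto intro: le_less_trans[of "ereal _" "ereal t"])
  have mem: "x \<tau> \<in> state_space S" if "\<tau> \<in> {s..t}" for \<tau>
    using network_solution_mem[OF sol] sub that by blast
  have fin: "emeasure ?M (space ?M) < \<infinity>"
    using st by (simp add: emeasure_restrict_space)
  have H: "{s..t} \<inter> space lebesgue \<in> sets lebesgue" by simp
  have bdd: "integrable ?M f" if "f \<in> borel_measurable ?M" "AE \<tau> in ?M. norm (f \<tau>) \<le> c" for f :: "real \<Rightarrow> real" and c
  proof (rule integrableI_bounded_set[of "space ?M"])
    show "AE \<tau> in ?M. \<tau> \<in> space ?M \<longrightarrow> norm (f \<tau>) \<le> c" using that(2) by eventually_elim simp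
    show "AE \<tau> in ?M. \<tau> \<notin> space ?M \<longrightarrow> f \<tau> = 0" by (rule AE_I2) simp
  qed (use that(1) fin in auto)
  have 1: "integrable ?M (\<lambda>\<tau>. coupling i (x \<tau>))"
  proof -
    have "compact ((\<lambda>\<tau>. V (x \<tau>)) ` {s..t})"
      by (intro compact_continuous_image continuous_on_subset[OF continuous_on_V_trajectory[OF sol] sub]) simp
    then obtain c where c: "\<And>\<tau>. \<tau> \<in> {s..t} \<Longrightarrow> V (x \<tau>) \<le> c"
      by (meson bounded_imp_bdd_above compact_imp_bounded bdd_above_def imageI)
    show ?thesis
    proof (rule bdd[of _ "K * c"])
      have "(\<lambda>\<tau>. gain i j * Vs j (x \<tau> j)) \<in> borel_measurable ?M" for j
        by (intro borel_measurable_times borel_measurable_const continuous_imp_measurable_on_sets_lebesgue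
            continuous_on_subset[OF continuous_on_Vs_trajectory[OF sol] sub]) simp
      then show "(\<lambda>\<tau>. coupling i (x \<tau>)) \<in> borel_measurable ?M"
        unfolding coupling_def by (rule borel_measurable_suminf)
      have "norm (coupling i (x \<tau>)) \<le> K * c" if "\<tau> \<in> {s..t}" for \<tau>
        using coupling_bounds[OF mem[OF that], of i] mult_left_mono[OF c[OF that] K_nonneg] by simp
      then show "AE \<tau> in ?M. norm (coupling i (x \<tau>)) \<le> K * c"
        by (intro AE_I2) simp
    qed
  qed
  have 2: "integrable ?M (\<lambda>\<tau>. norm_u S i (u \<tau> i) powr exp_q S)"
  proof (rule bdd[of _ "input_norm S u powr exp_q S"])
    have "(\<lambda>t. norm_u S i (u t i)) \<in> borel_measurable ?M"
      by (rule measurable_restrict_mono[OF input_norm_component_measurable[OF u]]) (use st in auto)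
    then show "(\<lambda>t. norm_u S i (u t i) powr exp_q S) \<in> borel_measurable ?M"
      by (intro powr_real_measurable) auto
    show "AE \<tau> in ?M. norm (norm_u S i (u \<tau> i) powr exp_q S) \<le> input_norm S u powr exp_q S"
      unfolding AE_restrict_space_iff[OF H]
      using AE_input_component_le[OF u, of i]
    proof eventually_elim
      case (elim \<tau>)
      show ?case
      proof
        assume "\<tau> \<in> {s..t}"
        then have "0 \<le> \<tau>" using st by simp
        moreover have "0 \<le> norm_u S i (u \<tau> i)"
          using input_component[OF u \<open>0 \<le> \<tau>\<close>] U.Ni.nonneg by (simp add: sub_inputs_def)
        ultimately show "norm (norm_u S i (u \<tau> i) powr exp_q S) \<le> input_norm S u powr exp_q S"
          using elim U.p by (simp add: powr_mono2)
      qed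
    qed
  qed
  show "integrable ?M (supply_rate i x u)"
    unfolding supply_rate_def by (intro Bochner_Integration.integrable_add integrable_mult_right 1 2)
qed

text \<open>Truncating from below at e keeps the function away from the set where the subsystem estimate is
  not available; afterwards e tends to 0.\<close>

lemma sub_dissipation_integral:
  assumes sol: "network_solution S x0 u T x" and u: "u \<in> inputs S"
    and st: "0 \<le> s" "s \<le> t" "ereal t < T"
  shows "Vs i (x t i) + lam i * (\<integral>\<tau>. Vs i (x \<tau> i) \<partial>lebesgue_on {s..t})
           \<le> Vs i (x s i) + (\<integral>\<tau>. supply_rate i x u \<tau> \<partial>lebesgue_on {s..t})"
proof (rule field_le_epsilon)
  fix e' :: real assume e': "0 < e'"
  \<comment> \<open>Truncation costs \<open>e\<close> in the initial value and
    \<open>lam i * e\<close> per unit of time in the decay term; the total is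
    \<open>e'\<close>.\<close>
  define e where "e = e' / (1 + lam i * (t - s))"
  have den: "0 < 1 + lam i * (t - s)" using lam_pos[of i] st by (intro add_pos_nonneg) auto
  have e: "0 < e" "e * (1 + lam i * (t - s)) = e'" using e' den by (auto simp: e_def)
  let ?M = "lebesgue_on {s..t}"
  let ?g = "\<lambda>\<tau>. Vs i (x \<tau> i)" and ?r = "supply_rate i x u"
  \<comment> \<open>The decay acts on the excess over \<open>e\<close> only. This makes the bound
    nonnegative below the level \<open>e\<close>, where the truncation is constant, and equal to the
    supply rate at the level \<open>e\<close>.\<close>
  let ?h = "\<lambda>\<tau>. ?r \<tau> - lam i * (?g \<tau> - e)"
  have sub: "{s..t} \<subseteq> {t. 0 \<le> t \<and> ereal t < T}"
    using st by (auto intro: le_less_trans[of "ereal _" "ereal t"])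
  have mem: "x \<tau> \<in> state_space S" if "s \<le> \<tau>" "\<tau> \<le> t" for \<tau>
    using network_solution_mem[OF sol] sub that by auto
  have g0: "0 \<le> ?g \<tau>" if "s \<le> \<tau>" "\<tau> \<le> t" for \<tau>
    by (rule Vs_nonneg[OF state_component[OF mem[OF that]]])
  have off: "x \<tau> i \<notin> As i" if "s \<le> \<tau>" "\<tau> \<le> t" "0 < ?g \<tau>" for \<tau>
    using Vs_eq_0_iff[OF state_component[OF mem[OF that(1,2)]], of i] that(3) by auto
  have gc: "continuous_on {s..t} ?g"
    by (rule continuous_on_subset[OF continuous_on_Vs_trajectory[OF sol] sub])
  have r0: "0 \<le> ?r \<tau>" if "s \<le> \<tau>" "\<tau> \<le> t" for \<tau>
    unfolding supply_rate_def using coupling_bounds[OF mem[OF that], of i] gain_u(1)[of i] by simp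
  have L: "{s..t} \<in> sets lebesgue" by simp
  have gi: "integrable ?M ?g"
    using absolutely_integrable_continuous_real[OF gc] set_integrable_iff_lebesgue_on(1)[OF L] by blast
  note ri = supply_rate_integrable[OF sol u st, of i]
  have ci: "integrable ?M (\<lambda>_. c)" for c :: real
    by (rule finite_measure.integrable_const) (simp add: finite_measure_lebesgue_on)
  have hi: "integrable ?M ?h"
    by (intro Bochner_Integration.integrable_diff integrable_mult_right ri gi ci)
  have small: "lower_dini (\<lambda>\<tau>. max (?g \<tau>) e) \<tau> \<le> 0" if "s \<le> \<tau>" "\<tau> < t" "?g \<tau> < e" for \<tau>
  proof -
    have "\<forall>\<^sub>F h in at_right 0. ?g (\<tau> + h) \<in> {..<e}"
      by (rule eventually_right_of_continuous[OF gc that(1,2)]) (use that in auto)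
    then have "\<forall>\<^sub>F h in at_right 0. max (?g (\<tau> + h)) e = max (?g \<tau>) e"
      by eventually_elim (use that in auto)
    then show ?thesis by (rule lower_dini_le_zero_if_const)
  qed
  have fin: "lower_dini (\<lambda>\<tau>. max (?g \<tau>) e) \<tau> < \<infinity>" if \<tau>: "s \<le> \<tau>" "\<tau> < t" for \<tau>
  proof (cases "?g \<tau> < e")
    case True
    then show ?thesis using small[OF \<tau>] le_less_trans[of _ 0 "\<infinity>::ereal"] by simp
  next
    case False
    have "lower_dini ?g \<tau> < \<infinity>"
      by (rule dini_along_trajectory(1)[OF sol u _ \<tau>(2) st(3)]) (use \<tau> st off[of \<tau>] False e(1) in auto)
    then obtain n where "lower_dini ?g \<tau> < ereal (real n)"
      using less_PInf_Ex_of_nat[of "lower_dini ?g \<tau>"] by auto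
    from lower_dini_max_const[OF _ this, of e] False show ?thesis
      using le_less_trans[of _ "ereal (real n)" "\<infinity>::ereal"] by simp
  qed
  \<comment> \<open>The null set of the estimate depends on the restart time, so restarts are
    limited to countably many rational times.\<close>
  define Q where "Q = {a \<in> \<rat>. s \<le> a \<and> a < t \<and> x a i \<notin> As i}"
  have "countable Q" unfolding Q_def using countable_rat by (rule countable_subset[rotated]) auto
  moreover have "AE \<tau> in lebesgue. a \<le> \<tau> \<and> \<tau> < t \<longrightarrow> upper_dini ?g \<tau> \<le> ereal (- lam i * ?g \<tau> + ?r \<tau>)"
    if "a \<in> Q" for a
    by (rule dini_along_trajectory(2)[OF sol u _ _ st(3)]) (use that st in \<open>auto simp: Q_def\<close>)
  ultimately have AEQ: "AE \<tau> in lebesgue. \<forall>a\<in>Q. a \<le> \<tau> \<and> \<tau> < t \<longrightarrow> upper_dini ?g \<tau> \<le> ereal (- lam i * ?g \<tau> + ?r \<tau>)"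
    by (subst AE_ball_countable) auto
  \<comment> \<open>A restart strictly before the time considered, yet not before s, must be
    possible.\<close>
  have "AE \<tau> in lebesgue. \<tau> \<noteq> s" by (simp add: AE_lebesgue_iff_negligible)
  with AEQ have ae: "AE \<tau> in lebesgue. s \<le> \<tau> \<and> \<tau> < t \<longrightarrow> lower_dini (\<lambda>\<tau>. max (?g \<tau>) e) \<tau> \<le> ereal (?h \<tau>)"
  proof eventually_elim
    case (elim \<tau>)
    show ?case
    proof
      assume "s \<le> \<tau> \<and> \<tau> < t"
      then have \<tau>: "s < \<tau>" "\<tau> < t" using elim(2) by auto
      show "lower_dini (\<lambda>\<tau>. max (?g \<tau>) e) \<tau> \<le> ereal (?h \<tau>)"
      proof (cases "?g \<tau> < e")
        case True
        then have "0 \<le> ?h \<tau>" using r0[of \<tau>] \<tau> lam_pos[of i] mult_nonneg_nonpos[of "lam i" "?g \<tau> - e"] by simp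
        then show ?thesis using small[of \<tau>] \<tau> True order_trans[of _ 0 "ereal (?h \<tau>)"] by simp
      next
        case False
        have "(?g \<longlongrightarrow> ?g \<tau>) (at \<tau> within {s..t})" using gc \<tau> by (auto simp: continuous_on_def)
        then have "\<forall>\<^sub>F y in at \<tau> within {s..t}. 0 < ?g y"
          by (rule order_tendstoD) (use False e(1) in simp)
        then obtain d where d: "0 < d" "\<And>y. y \<in> {s..t} \<Longrightarrow> y \<noteq> \<tau> \<Longrightarrow> dist y \<tau> < d \<Longrightarrow> 0 < ?g y"
          unfolding eventually_at by blast
        \<comment> \<open>By continuity the function is still positive shortly before
          \<open>\<tau>\<close>, so a rational restart time there lies outside
          \<open>As i\<close>.\<close>
        obtain a where a: "a \<in> \<rat>" "max s (\<tau> - d) < a" "a < \<tau>"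
          using Rats_dense_in_real[of "max s (\<tau> - d)" \<tau>] \<tau> d(1) by auto
        have "0 < ?g a" using d(2)[of a] a \<tau> by (auto simp: dist_real_def)
        then have "a \<in> Q" using a \<tau> off[of a] by (auto simp: Q_def)
        then have ub: "lower_dini ?g \<tau> \<le> ereal (- lam i * ?g \<tau> + ?r \<tau>)"
          using elim(1) a \<tau> order_trans[OF lower_dini_le_upper_dini] by (meson less_imp_le)
        \<comment> \<open>At the level \<open>e\<close> the truncation has a corner, and only the
          nonnegative bound by the supply rate survives; above the level it agrees locally with the
          function itself.\<close>
        show ?thesis
        proof (cases "?g \<tau> = e")
          case True
          have "- lam i * ?g \<tau> + ?r \<tau> < ?r \<tau>" using True e(1) lam_pos[of i] by simp
          then have "lower_dini ?g \<tau> < ereal (?r \<tau>)" using ub by (meson le_less_trans less_ereal.simps(1))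
          from lower_dini_max_const[OF _ this, of e] show ?thesis using True r0[of \<tau>] \<tau> by simp
        next
          case neq: False
          have "\<forall>\<^sub>F h in at_right 0. ?g (\<tau> + h) \<in> {e<..}"
            by (rule eventually_right_of_continuous[OF gc]) (use \<tau> False neq in auto)
          then have "\<forall>\<^sub>F h in at_right 0. max (?g (\<tau> + h)) e - max (?g \<tau>) e = ?g (\<tau> + h) - ?g \<tau>"
            by eventually_elim (use False in auto)
          then have "lower_dini (\<lambda>\<tau>. max (?g \<tau>) e) \<tau> = lower_dini ?g \<tau>" by (rule lower_dini_cong)
          also have "\<dots> \<le> ereal (- lam i * ?g \<tau> + ?r \<tau>)" by (rule ub)
          also have "\<dots> \<le> ereal (?h \<tau>)" using lam_pos[of i] e(1) by (simp add: algebra_simps)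
          finally show ?thesis .
        qed
      qed
    qed
  qed
  have HK: "(?h has_integral (\<integral>\<tau>. ?h \<tau> \<partial>?M)) {s..t}"
    by (rule has_integral_integral_lebesgue_on[OF hi L])
  have "max (?g t) e - max (?g s) e \<le> integral {s..t} ?h"
    by (rule dini_increment_le_integral[OF st(2) _ _ fin ae])
       (use HK gc in \<open>auto intro!: continuous_intros simp: integrable_on_def\<close>)
  also have "\<dots> = (\<integral>\<tau>. ?h \<tau> \<partial>?M)" using HK by (rule integral_unique)
  also have "\<dots> = (\<integral>\<tau>. ?r \<tau> \<partial>?M) - lam i * ((\<integral>\<tau>. ?g \<tau> \<partial>?M) - e * (t - s))"
    using ri gi ci st by (simp add: measure_restrict_space Bochner_Integration.integral_diff integrable_mult_right)
  finally have "max (?g t) e - max (?g s) e \<le> (\<integral>\<tau>. ?r \<tau> \<partial>?M) - lam i * ((\<integral>\<tau>. ?g \<tau> \<partial>?M) - e * (t - s))" .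
  moreover have "max (?g s) e \<le> ?g s + e" using g0[of s] st e(1) by auto
  moreover have "?g t \<le> max (?g t) e" by simp
  moreover have "lam i * ((\<integral>\<tau>. ?g \<tau> \<partial>?M) - e * (t - s)) = lam i * (\<integral>\<tau>. ?g \<tau> \<partial>?M) - e * (lam i * (t - s))"
    by (simp add: algebra_simps)
  moreover have "e + e * (lam i * (t - s)) = e'" using e(2) by (simp add: distrib_left)
  ultimately show "?g t + lam i * (\<integral>\<tau>. ?g \<tau> \<partial>?M) \<le> ?g s + (\<integral>\<tau>. ?r \<tau> \<partial>?M) + e'"
    by linarith
qed

end

section \<open>The weighted sum along trajectories\<close>

text \<open>Comparison with \<open>y\<close>, which satisfies the integral relation with equality.
  After the last time at which \<open>g\<close> is at most \<open>y\<close>, the difference is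
  nonnegative and therefore, by the inequality on subintervals, nonincreasing.\<close>

lemma gronwall_exponential:
  fixes g :: "real \<Rightarrow> real"
  assumes k: "0 < k" and t: "0 \<le> t" and g: "continuous_on {0..t} g"
    and le: "\<And>a b. 0 \<le> a \<Longrightarrow> a \<le> b \<Longrightarrow> b \<le> t \<Longrightarrow> g b + k * integral {a..b} g \<le> g a + c * (b - a)"
  shows "g t \<le> exp (- k * t) * (g 0 - c / k) + c / k"
proof (rule ccontr)
  assume contra: "\<not> ?thesis"
  define y where "y s = exp (- k * s) * (g 0 - c / k) + c / k" for s
  define G where "G s = g s - y s" for s
  have yc: "continuous_on A y" for A unfolding y_def by (intro continuous_intros)
  have Gc: "continuous_on {0..t} G" unfolding G_def using g yc by (intro continuous_on_diff)
  have yint: "k * integral {a..b} y = y a - y b + c * (b - a)" if "a \<le> b" for a b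
  proof -
    have D: "((\<lambda>s. c * s - y s) has_vector_derivative k * y s) (at s within {a..b})" for s
    proof -
      have "((\<lambda>s. c * s - y s) has_real_derivative k * y s) (at s)"
        unfolding y_def using k by (auto intro!: derivative_eq_intros simp: field_simps)
      then show ?thesis
        by (simp add: has_real_derivative_iff_has_vector_derivative has_vector_derivative_at_within)
    qed
    have "((\<lambda>s. k * y s) has_integral (c * b - y b) - (c * a - y a)) {a..b}"
      by (rule fundamental_theorem_of_calculus[OF that D])
    then have "integral {a..b} (\<lambda>s. k * y s) = (c * b - y b) - (c * a - y a)" by (rule integral_unique)
    then show ?thesis by (simp add: algebra_simps)
  qed
  have Gle: "G b \<le> G a" if ab: "0 \<le> a" "a \<le> b" "b \<le> t" and nn: "\<And>s. a < s \<Longrightarrow> s \<le> b \<Longrightarrow> 0 \<le> G s" for a b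
  proof -
    have sub: "{a..b} \<subseteq> {0..t}" using ab by auto
    have gi: "g integrable_on {a..b}" and yi: "y integrable_on {a..b}" and Gi: "G integrable_on {a..b}"
      by (intro integrable_continuous_real continuous_on_subset[OF g sub] yc continuous_on_subset[OF Gc sub])+
    \<comment> \<open>The integrand is changed at the left endpoint, where the difference may be
      negative: this endpoint will be the last point of \<open>Z\<close>.\<close>
    have "0 \<le> integral {a..b} (\<lambda>s. if s = a then 0 else G s)"
    proof (rule integral_nonneg)
      show "(\<lambda>s. if s = a then 0 else G s) integrable_on {a..b}"
        by (rule integrable_spike[OF Gi, of "{a}"]) auto
    qed (use nn in auto)
    also have "\<dots> = integral {a..b} G" by (rule integral_spike[of "{a}"]) auto
    also have "\<dots> = integral {a..b} g - integral {a..b} y"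
      unfolding G_def by (rule integral_diff[OF gi yi])
    finally have "0 \<le> k * integral {a..b} g - k * integral {a..b} y"
      using k by (simp add: right_diff_distrib[symmetric])
    then show ?thesis using le[OF ab] yint[OF ab(2)] unfolding G_def by linarith
  qed
  define Z where "Z = {s \<in> {0..t}. G s \<le> 0}"
  have "compact Z"
  proof -
    have "closed {s \<in> {0..t}. G s \<le> 0}"
      by (rule continuous_on_closed_Collect_le[OF Gc continuous_on_const]) simp
    moreover have "bounded Z" by (rule bounded_subset[OF bounded_closed_interval[of 0 t]]) (auto simp: Z_def)
    ultimately show ?thesis unfolding Z_def compact_eq_bounded_closed by simp
  qed
  moreover have "0 \<in> Z" using t by (simp add: Z_def G_def y_def)
  ultimately obtain s where s: "s \<in> Z" "\<And>r. r \<in> Z \<Longrightarrow> r \<le> s"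
    using compact_attains_sup[of Z] by blast
  have "G t \<le> G s"
  proof (rule Gle)
    show "0 \<le> G r" if "s < r" "r \<le> t" for r
      using s(2)[of r] that s(1) by (cases "G r \<le> 0") (auto simp: Z_def)
  qed (use s(1) in \<open>auto simp: Z_def\<close>)
  then have "G t \<le> 0" using s(1) by (simp add: Z_def)
  then show False using contra by (simp add: G_def y_def)
qed

context dissipative_network
begin

text \<open>The part of the slowest decay that remains after the coupling has used the fraction
  \<open>th\<close>.\<close>

definition rate :: real where
  "rate = (1 - th) * lam_low"

lemma rate_pos: "0 < rate"
  using th lam by (simp add: rate_def)

definition gain_const :: "(real \<Rightarrow> vseq) \<Rightarrow> real" where
  "gain_const u = mu_up * gain_u_up * input_norm S u powr exp_q S"

lemma gain_u_up: "0 \<le> gain_u_up"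
  using gain_u[of 0] by linarith

lemma gain_const_nonneg: "0 \<le> gain_const u"
  unfolding gain_const_def using gain_u_up mu_up by simp

text \<open>The column sums of the weighted gains are bounded both by a multiple of the decay rates, which may be
  unbounded, and by a constant, which keeps all sums finite.\<close>

definition coupling_weight :: "nat \<Rightarrow> real" where
  "coupling_weight j = min (th * (lam j * mu j)) (mu_up * K)"

lemma coupling_weight_nonneg: "0 \<le> coupling_weight j"
  unfolding coupling_weight_def using th lam_pos[of j] mu(1)[of j] mu_up K_nonneg by simp

lemma weighted_gain_le: "(\<Sum>i<n. mu i * gain i j) \<le> coupling_weight j"
proof -
  have "(\<Sum>i<n. mu i * gain i j) \<le> (\<Sum>i<n. mu_up * gain i j)"
    using mu gain_nonneg by (intro sum_mono mult_right_mono) auto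
  also have "\<dots> \<le> mu_up * K"
    using gain_column[where n = n and j = j] mu_up by (simp add: sum_distrib_left[symmetric])
  finally show ?thesis using gain_weights unfolding coupling_weight_def by simp
qed

lemma coupling_weight_term_le:
  assumes "x \<in> state_space S"
  shows "0 \<le> coupling_weight j * Vs j (x j)" "coupling_weight j * Vs j (x j) \<le> mu_up * K * (mu j * Vs j (x j))"
proof -
  have v: "0 \<le> Vs j (x j)" by (rule Vs_nonneg[OF state_component[OF assms]])
  show "0 \<le> coupling_weight j * Vs j (x j)" using v coupling_weight_nonneg by simp
  have "Vs j (x j) \<le> mu j * Vs j (x j)" using mu(1)[of j] v by (simp add: mult_le_cancel_right1)
  then show "coupling_weight j * Vs j (x j) \<le> mu_up * K * (mu j * Vs j (x j))"
    using v mu_up K_nonneg by (intro mult_mono) (auto simp: coupling_weight_def)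
qed

lemma coupling_weight_summable:
  assumes "x \<in> state_space S"
  shows "summable (\<lambda>j. coupling_weight j * Vs j (x j))"
proof (rule summable_comparison_test'[where N = 0])
  show "summable (\<lambda>j. mu_up * K * (mu j * Vs j (x j)))" by (intro summable_mult V_summable assms)
  show "norm (coupling_weight j * Vs j (x j)) \<le> mu_up * K * (mu j * Vs j (x j))" for j
    using coupling_weight_term_le[OF assms, of j] by simp
qed

text \<open>For a partial sum over i, a finite sum is exchanged with a convergent series; afterwards
  each column is bounded by its coupling weight.\<close>

lemma weighted_coupling_le:
  assumes "x \<in> state_space S"
  shows "(\<Sum>i<n. mu i * coupling i x) \<le> (\<Sum>j. coupling_weight j * Vs j (x j))"
proof -
  have "(\<Sum>i<n. mu i * coupling i x) = (\<Sum>i<n. \<Sum>j. mu i * (gain i j * Vs j (x j)))"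
    unfolding coupling_def by (intro sum.cong refl suminf_mult[symmetric] coupling_summable assms)
  also have "\<dots> = (\<Sum>j. \<Sum>i<n. mu i * (gain i j * Vs j (x j)))"
    by (intro suminf_sum[symmetric] summable_mult coupling_summable assms)
  also have "\<dots> \<le> (\<Sum>j. coupling_weight j * Vs j (x j))"
  proof (intro suminf_le coupling_weight_summable assms summable_sum summable_mult coupling_summable)
    fix j
    have "(\<Sum>i<n. mu i * (gain i j * Vs j (x j))) = (\<Sum>i<n. mu i * gain i j) * Vs j (x j)"
      by (simp add: sum_distrib_right mult.assoc)
    also have "\<dots> \<le> coupling_weight j * Vs j (x j)"
      by (intro mult_right_mono weighted_gain_le Vs_nonneg state_component assms)
    finally show "(\<Sum>i<n. mu i * (gain i j * Vs j (x j))) \<le> coupling_weight j * Vs j (x j)" .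
  qed
  finally show ?thesis .
qed

text \<open>The q-norm of the whole input bounds every partial sum, so one null set serves all
  \<open>n\<close>.\<close>

lemma weighted_input_le:
  assumes "u \<in> inputs S"
  shows "AE t in lebesgue. 0 \<le> t \<longrightarrow>
           (\<forall>n. (\<Sum>i<n. mu i * (gain_u i * norm_u S i (u t i) powr exp_q S)) \<le> gain_const u)"
  using AE_input_le_input_norm(1)[OF assms]
proof eventually_elim
  case (elim t)
  show ?case
  proof (intro impI allI)
    fix n assume t: "0 \<le> t"
    have uX: "u t \<in> U.lpX"
      using assms t unfolding inputs_def strongly_measurable_on_def input_values_def by auto
    have "(\<Sum>i<n. mu i * (gain_u i * norm_u S i (u t i) powr exp_q S))
        \<le> (\<Sum>i<n. mu_up * gain_u_up * norm_u S i (u t i) powr exp_q S)"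
      unfolding mult.assoc[symmetric]
      using mu gain_u mu_up by (intro sum_mono mult_right_mono mult_mono) auto
    also have "\<dots> = mu_up * gain_u_up * (\<Sum>i<n. norm_u S i (u t i) powr exp_q S)"
      by (simp add: sum_distrib_left)
    also have "\<dots> \<le> mu_up * gain_u_up * (\<Sum>i. norm_u S i (u t i) powr exp_q S)"
      using mu_up gain_u_up U.powr_summable[OF uX] by (intro mult_left_mono sum_le_suminf) auto
    also have "\<dots> = mu_up * gain_u_up * U.lpN (u t) powr exp_q S"
      by (simp add: U.lp_norm_powr[OF uX])
    also have "\<dots> \<le> gain_const u"
      unfolding gain_const_def using elim t mu_up gain_u_up U.p U.lp_norm_nonneg
      by (intro mult_left_mono powr_mono2) auto
    finally show "(\<Sum>i<n. mu i * (gain_u i * norm_u S i (u t i) powr exp_q S)) \<le> gain_const u" .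
  qed
qed

text \<open>All partial sums are dominated by \<open>c\<close> times \<open>V\<close>, which is
  integrable along the trajectory. It is used for the coupling weights and for the weights
  \<open>mu\<close> themselves.\<close>

lemma trajectory_sum_integral:
  assumes sol: "network_solution S x0 u T x" and st: "0 \<le> s" "s \<le> t" "ereal t < T"
    and f: "\<And>j. 0 \<le> f j" "\<And>j. f j \<le> c * mu j"
  shows "integrable (lebesgue_on {s..t}) (\<lambda>\<tau>. \<Sum>j. f j * Vs j (x \<tau> j))"
    and "(\<lambda>j. f j * (\<integral>\<tau>. Vs j (x \<tau> j) \<partial>lebesgue_on {s..t}))
           sums (\<integral>\<tau>. (\<Sum>j. f j * Vs j (x \<tau> j)) \<partial>lebesgue_on {s..t})"
proof -
  let ?M = "lebesgue_on {s..t}"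
  have sub: "{s..t} \<subseteq> {t. 0 \<le> t \<and> ereal t < T}"
    using st by (auto intro: le_less_trans[of "ereal _" "ereal t"])
  have mem: "x \<tau> \<in> state_space S" if "\<tau> \<in> {s..t}" for \<tau>
    using network_solution_mem[OF sol] sub that by blast
  have L: "{s..t} \<in> sets lebesgue" by simp
  have vi: "integrable ?M (\<lambda>\<tau>. Vs j (x \<tau> j))" for j
    using absolutely_integrable_continuous_real[OF continuous_on_subset[OF continuous_on_Vs_trajectory[OF sol] sub]]
      set_integrable_iff_lebesgue_on(1)[OF L] by blast
  have Vi: "integrable ?M (\<lambda>\<tau>. V (x \<tau>))"
    using absolutely_integrable_continuous_real[OF continuous_on_subset[OF continuous_on_V_trajectory[OF sol] sub]]
      set_integrable_iff_lebesgue_on(1)[OF L] by blast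
  have fi: "integrable ?M (\<lambda>\<tau>. f j * Vs j (x \<tau> j))" for j
    by (intro integrable_mult_right vi)
  have v0: "0 \<le> Vs j (x \<tau> j)" if "\<tau> \<in> {s..t}" for j \<tau>
    by (rule Vs_nonneg[OF state_component[OF mem[OF that]]])
  have fle: "f j * Vs j (x \<tau> j) \<le> c * (mu j * Vs j (x \<tau> j))" if "\<tau> \<in> {s..t}" for j \<tau>
    using mult_right_mono[OF f(2)[of j] v0[OF that, of j]] by (simp add: mult.assoc)
  have c0: "0 \<le> c" using f(1)[of 0] f(2)[of 0] mu(1)[of 0] by (smt (verit) zero_le_mult_iff)
  have sm: "summable (\<lambda>j. f j * Vs j (x \<tau> j))" if "\<tau> \<in> {s..t}" for \<tau>
    by (rule summable_comparison_test'[where N = 0 and g = "\<lambda>j. c * (mu j * Vs j (x \<tau> j))"])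
       (use f(1) v0[OF that] fle[OF that] V_summable[OF mem[OF that]] in \<open>auto intro: summable_mult\<close>)
  have AEs: "AE \<tau> in ?M. summable (\<lambda>j. norm (f j * Vs j (x \<tau> j)))"
    using sm f(1) v0 by (intro AE_I2) simp
  have I0: "0 \<le> (\<integral>\<tau>. Vs j (x \<tau> j) \<partial>?M)" for j
    by (rule integral_nonneg_AE) (use v0 in \<open>auto intro: AE_I2\<close>)
  have nrm: "(\<integral>\<tau>. norm (f j * Vs j (x \<tau> j)) \<partial>?M) = (\<integral>\<tau>. f j * Vs j (x \<tau> j) \<partial>?M)" for j
    by (rule Bochner_Integration.integral_cong) (use f(1) v0 in auto)
  have part: "(\<Sum>j<n. \<integral>\<tau>. f j * Vs j (x \<tau> j) \<partial>?M) \<le> (\<integral>\<tau>. c * V (x \<tau>) \<partial>?M)" for n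
  proof -
    have "(\<Sum>j<n. \<integral>\<tau>. f j * Vs j (x \<tau> j) \<partial>?M) = (\<integral>\<tau>. (\<Sum>j<n. f j * Vs j (x \<tau> j)) \<partial>?M)"
      by (rule Bochner_Integration.integral_sum[symmetric]) (rule fi)
    also have "\<dots> \<le> (\<integral>\<tau>. c * V (x \<tau>) \<partial>?M)"
    proof (rule integral_mono)
      fix \<tau> assume "\<tau> \<in> space ?M"
      then have \<tau>: "\<tau> \<in> {s..t}" by simp
      have "(\<Sum>j<n. f j * Vs j (x \<tau> j)) \<le> c * (\<Sum>j<n. mu j * Vs j (x \<tau> j))"
        unfolding sum_distrib_left using fle[OF \<tau>] by (intro sum_mono)
      also have "\<dots> \<le> c * V (x \<tau>)"
        unfolding V_def using c0 weighted_term_bounds(3)[OF state_component[OF mem[OF \<tau>]]]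
        by (intro mult_left_mono sum_le_suminf V_summable mem \<tau>) auto
      finally show "(\<Sum>j<n. f j * Vs j (x \<tau> j)) \<le> c * V (x \<tau>)" .
    qed (intro Bochner_Integration.integrable_sum fi integrable_mult_right Vi)+
    finally show ?thesis .
  qed
  have "summable (\<lambda>j. \<integral>\<tau>. f j * Vs j (x \<tau> j) \<partial>?M)"
    by (rule nonneg_bounded_partial_sums(1)[OF _ part]) (use f(1) I0 in simp)
  then have Is: "summable (\<lambda>j. \<integral>\<tau>. norm (f j * Vs j (x \<tau> j)) \<partial>?M)"
    unfolding nrm .
  show "integrable ?M (\<lambda>\<tau>. \<Sum>j. f j * Vs j (x \<tau> j))"
    by (rule integrable_suminf[OF fi AEs Is])
  show "(\<lambda>j. f j * (\<integral>\<tau>. Vs j (x \<tau> j) \<partial>?M)) sums (\<integral>\<tau>. (\<Sum>j. f j * Vs j (x \<tau> j)) \<partial>?M)"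
    using sums_integral[OF fi AEs Is] by simp
qed

text \<open>The decay of each subsystem is split into a part that pays for its influence on the
  others and a part of size \<open>rate\<close>. The integrated coupling \<open>?Q\<close> appears
  on both sides in the limit and, being finite, cancels.\<close>

lemma V_dissipation_integral:
  assumes sol: "network_solution S x0 u T x" and u: "u \<in> inputs S"
    and st: "0 \<le> s" "s \<le> t" "ereal t < T"
  shows "V (x t) + rate * integral {s..t} (\<lambda>\<tau>. V (x \<tau>)) \<le> V (x s) + gain_const u * (t - s)"
proof -
  let ?M = "lebesgue_on {s..t}"
  have sub: "{s..t} \<subseteq> {t. 0 \<le> t \<and> ereal t < T}"
    using st by (auto intro: le_less_trans[of "ereal _" "ereal t"])
  have mem: "x \<tau> \<in> state_space S" if "\<tau> \<in> {s..t}" for \<tau>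
    using network_solution_mem[OF sol] sub that by blast
  have L: "{s..t} \<in> sets lebesgue" "{s..t} \<inter> space lebesgue \<in> sets lebesgue" by auto
  let ?I = "\<lambda>j. \<integral>\<tau>. Vs j (x \<tau> j) \<partial>?M"
  let ?q = "coupling_weight"
  have q: "?q j \<le> mu_up * K * mu j" for j
  proof -
    have "mu_up * K * 1 \<le> mu_up * K * mu j"
      using mu(1) mu_up K_nonneg by (intro mult_left_mono) auto
    then show ?thesis by (simp add: coupling_weight_def)
  qed
  have m: "0 \<le> mu j" "mu j \<le> 1 * mu j" for j using mu(1)[of j] by auto
  note Q = trajectory_sum_integral[OF sol st coupling_weight_nonneg q]
  note W = trajectory_sum_integral[OF sol st m, folded V_def]
  let ?Q = "\<integral>\<tau>. (\<Sum>j. ?q j * Vs j (x \<tau> j)) \<partial>?M"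
  let ?W = "\<integral>\<tau>. V (x \<tau>) \<partial>?M"
  have I0: "0 \<le> ?I j" for j
    by (rule integral_nonneg_AE) (use Vs_nonneg[OF state_component[OF mem]] in \<open>auto intro: AE_I2\<close>)
  have ci: "integrable ?M (\<lambda>_. c)" for c :: real
    by (rule finite_measure.integrable_const) (simp add: finite_measure_lebesgue_on)
  note si = supply_rate_integrable[OF sol u st]
  \<comment> \<open>Partial sums on the left against the full coupling \<open>?Q\<close> on the
    right: for finite \<open>n\<close> the coupling received may come from components outside the
    partial sum.\<close>
  have fin: "(\<Sum>i<n. mu i * Vs i (x t i)) + ((\<Sum>i<n. ?q i * ?I i) + rate * (\<Sum>i<n. mu i * ?I i))
             \<le> (\<Sum>i<n. mu i * Vs i (x s i)) + (?Q + gain_const u * (t - s))" for n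
  proof -
    have "(\<Sum>i<n. mu i * (Vs i (x t i) + lam i * ?I i))
            \<le> (\<Sum>i<n. mu i * (Vs i (x s i) + (\<integral>\<tau>. supply_rate i x u \<tau> \<partial>?M)))"
      by (intro sum_mono mult_left_mono sub_dissipation_integral[OF sol u st] m)
    then have "(\<Sum>i<n. mu i * Vs i (x t i)) + (\<Sum>i<n. mu i * lam i * ?I i)
            \<le> (\<Sum>i<n. mu i * Vs i (x s i)) + (\<Sum>i<n. mu i * (\<integral>\<tau>. supply_rate i x u \<tau> \<partial>?M))"
      by (simp add: distrib_left sum.distrib mult.assoc)
    moreover have "(\<Sum>i<n. ?q i * ?I i) + rate * (\<Sum>i<n. mu i * ?I i) \<le> (\<Sum>i<n. mu i * lam i * ?I i)"
    proof -
      \<comment> \<open>The coupling weight takes at most the fraction \<open>th\<close> of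
        \<open>lam i * mu i\<close>, and the remaining fraction is at least
        \<open>rate * mu i\<close>.\<close>
      have "?q i * ?I i + rate * (mu i * ?I i) \<le> mu i * lam i * ?I i" for i
      proof -
        have "rate * mu i \<le> (1 - th) * lam i * mu i"
          unfolding rate_def using th lam m by (intro mult_right_mono mult_left_mono) auto
        then have "?q i + rate * mu i \<le> mu i * lam i"
          unfolding coupling_weight_def by (simp add: algebra_simps min_le_iff_disj)
        from mult_right_mono[OF this I0[of i]] show ?thesis by (simp add: algebra_simps)
      qed
      then show ?thesis unfolding sum_distrib_left sum.distrib[symmetric] by (intro sum_mono)
    qed
    moreover have "(\<Sum>i<n. mu i * (\<integral>\<tau>. supply_rate i x u \<tau> \<partial>?M)) \<le> ?Q + gain_const u * (t - s)"
    proof -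
      have "(\<Sum>i<n. mu i * (\<integral>\<tau>. supply_rate i x u \<tau> \<partial>?M)) = (\<integral>\<tau>. (\<Sum>i<n. mu i * supply_rate i x u \<tau>) \<partial>?M)"
        using si by (subst Bochner_Integration.integral_sum) auto
      also have "\<dots> \<le> (\<integral>\<tau>. (\<Sum>j. ?q j * Vs j (x \<tau> j)) + gain_const u \<partial>?M)"
      proof (rule integral_mono_AE)
        show "AE \<tau> in ?M. (\<Sum>i<n. mu i * supply_rate i x u \<tau>) \<le> (\<Sum>j. ?q j * Vs j (x \<tau> j)) + gain_const u"
          unfolding AE_restrict_space_iff[OF L(2)]
          using weighted_input_le[OF u]
        proof eventually_elim
          case (elim \<tau>)
          show ?case
          proof
            assume \<tau>: "\<tau> \<in> {s..t}"
            have "(\<Sum>i<n. mu i * supply_rate i x u \<tau>)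
                = (\<Sum>i<n. mu i * coupling i (x \<tau>)) + (\<Sum>i<n. mu i * (gain_u i * norm_u S i (u \<tau> i) powr exp_q S))"
              by (simp add: supply_rate_def distrib_left sum.distrib)
            then show "(\<Sum>i<n. mu i * supply_rate i x u \<tau>) \<le> (\<Sum>j. ?q j * Vs j (x \<tau> j)) + gain_const u"
              using weighted_coupling_le[OF mem[OF \<tau>], of n] elim \<tau> st by (auto intro: add_mono)
          qed
        qed
      qed (intro Bochner_Integration.integrable_sum Bochner_Integration.integrable_add integrable_mult_right si Q(1) ci)+
      also have "\<dots> = ?Q + gain_const u * (t - s)"
        using Q(1) ci st by (simp add: measure_restrict_space)
      finally show ?thesis .
    qed
    ultimately show ?thesis by linarith
  qed
  have "V (x t) + (?Q + rate * ?W) \<le> V (x s) + (?Q + gain_const u * (t - s))"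
  proof (rule LIMSEQ_le)
    show "(\<lambda>n. (\<Sum>i<n. mu i * Vs i (x t i)) + ((\<Sum>i<n. ?q i * ?I i) + rate * (\<Sum>i<n. mu i * ?I i)))
            \<longlonglongrightarrow> V (x t) + (?Q + rate * ?W)"
      using V_sums[OF mem[of t]] Q(2) W(2) st unfolding sums_def by (intro tendsto_intros) auto
    show "(\<lambda>n. (\<Sum>i<n. mu i * Vs i (x s i)) + (?Q + gain_const u * (t - s)))
            \<longlonglongrightarrow> V (x s) + (?Q + gain_const u * (t - s))"
      using V_sums[OF mem[of s]] st unfolding sums_def by (intro tendsto_intros) auto
  qed (use fin in blast)
  moreover have "?W = integral {s..t} (\<lambda>\<tau>. V (x \<tau>))"
    by (rule lebesgue_integral_eq_integral[OF W(1) L(1)])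
  ultimately show ?thesis by simp
qed

end

section \<open>Decay estimates\<close>

text \<open>Subadditivity of the p-th root, derived from superadditivity of the p-th power.\<close>

lemma powr_add_le_add_powr:
  fixes x y p :: real
  assumes "0 \<le> x" "0 \<le> y" "1 \<le> p"
  shows "(x + y) powr (1 / p) \<le> x powr (1 / p) + y powr (1 / p)"
proof -
  have super: "s powr p + t powr p \<le> (s + t) powr p" if st: "0 \<le> s" "0 \<le> t" for s t :: real
  proof -
    have split: "z powr p = z * z powr (p - 1)" if "0 \<le> z" for z :: real
      using powr_mult_base[OF that, of "p - 1"] by simp
    have "s powr (p - 1) \<le> (s + t) powr (p - 1)" "t powr (p - 1) \<le> (s + t) powr (p - 1)"
      using st assms by (auto intro!: powr_mono2)
    then have "s * s powr (p - 1) + t * t powr (p - 1) \<le> s * (s + t) powr (p - 1) + t * (s + t) powr (p - 1)"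
      using st by (intro add_mono mult_left_mono) auto
    then show ?thesis using split st by (simp add: distrib_right)
  qed
  have "x + y \<le> (x powr (1 / p) + y powr (1 / p)) powr p"
    using super[of "x powr (1 / p)" "y powr (1 / p)"] assms by (simp add: powr_inverse_cancel)
  then have "(x + y) powr (1 / p) \<le> ((x powr (1 / p) + y powr (1 / p)) powr p) powr (1 / p)"
    using assms by (intro powr_mono2) auto
  then show ?thesis using assms by (simp add: powr_inverse_cancel)
qed

lemma class_K_powr:
  assumes "0 < c" "0 < e"
  shows "class_K (\<lambda>r. c * r powr e)"
  unfolding class_K_def
proof (intro conjI)
  show "continuous_on {0..} (\<lambda>r. c * r powr e)"
    using assms by (intro continuous_on_mult continuous_on_const continuous_on_powr' continuous_on_id) auto
  show "strict_mono_on {0..} (\<lambda>r. c * r powr e)"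
    using assms by (intro strict_mono_onI mult_strict_left_mono powr_less_mono2) auto
qed simp

lemma powr_unbounded:
  assumes "0 < c" "0 < (e::real)"
  shows "\<exists>r\<ge>0. b < c * r powr e"
proof -
  define z where "z = (\<bar>b\<bar> + 1) / c"
  have z: "0 < z" using assms by (simp add: z_def add_nonneg_pos)
  have "c * (z powr (1 / e)) powr e = \<bar>b\<bar> + 1"
    using z assms by (simp add: powr_powr z_def)
  then show ?thesis by (intro exI[of _ "z powr (1 / e)"]) auto
qed

context dissipative_network
begin

lemma flow_eq:
  assumes wp: "well_posed S" and x0: "x0 \<in> state_space S" and u: "u \<in> inputs S"
    and sol: "network_solution S x0 u T x" and t: "0 \<le> t" "ereal t < T"
  shows "flow S x0 u t = x t"
  unfolding flow_def
  by (rule max_solution_eq[where sol = "network_solution S x0 u" and T = T])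
     (use wp x0 u sol t in \<open>auto simp: well_posed_def\<close>)

text \<open>The integrated inequality is divided by a short time h; by continuity \<open>V\<close>
  stays above \<open>V x0 - \<eta>\<close> on that interval, which bounds its integral from
  below.\<close>

lemma orbital_dini_V_le:
  assumes wp: "well_posed S" and x0: "x0 \<in> state_space S" and u: "u \<in> inputs S"
  shows "orbital_dini S V u x0 \<le> ereal (- rate * V x0 + gain_const u)"
proof (rule ereal_le_epsilon2)
  fix e :: real assume e: "0 < e"
  \<comment> \<open>The drop \<open>\<eta>\<close> of \<open>V\<close> weakens the decay by
    \<open>rate * \<eta> = e\<close>.\<close>
  define \<eta> where "\<eta> = e / rate"
  have \<eta>: "0 < \<eta>" "rate * \<eta> = e" using e rate_pos by (auto simp: \<eta>_def)
  obtain T x where sol: "network_solution S x0 u T x"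
    using wp x0 u unfolding well_posed_def uniquely_solvable_def by blast
  note init = network_solution_initial[OF sol]
  have "0 < T" using sol by (simp add: network_solution_def)
  then obtain b where b: "0 < ereal b" "ereal b < T" using ereal_dense2 by blast
  then have b0: "0 < b" by simp
  have bT: "ereal t < T" if "t \<le> b" for t
    using that b(2) by (auto intro: le_less_trans[of "ereal t" "ereal b"])
  have Vc: "continuous_on {0..b} (\<lambda>t. V (x t))"
    by (rule continuous_on_subset[OF continuous_on_V_trajectory[OF sol]]) (use bT in auto)
  then have "((\<lambda>t. V (x t)) \<longlongrightarrow> V (x 0)) (at 0 within {0..b})"
    using b0 by (simp add: continuous_on_def)
  then have "\<forall>\<^sub>F t in at 0 within {0..b}. V x0 - \<eta> < V (x t)"
    by (rule order_tendstoD) (use \<eta> init in simp)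
  then obtain d where d: "0 < d" "\<And>t. t \<in> {0..b} \<Longrightarrow> t \<noteq> 0 \<Longrightarrow> dist t 0 < d \<Longrightarrow> V x0 - \<eta> < V (x t)"
    unfolding eventually_at by blast
  have ev: "\<forall>\<^sub>F h in at_right 0. 0 < h \<and> h < min b d"
    unfolding eventually_at_right_field using b0 d(1) by (intro exI[of _ "min b d"]) auto
  show "orbital_dini S V u x0 \<le> ereal (- rate * V x0 + gain_const u) + ereal e"
    unfolding orbital_dini_def upper_dini_def
  proof (rule Limsup_bounded)
    show "\<forall>\<^sub>F h in at_right 0. ereal ((V (flow S x0 u (0 + h)) - V (flow S x0 u 0)) / h)
            \<le> ereal (- rate * V x0 + gain_const u) + ereal e"
      using ev
    proof eventually_elim
      case (elim h)
      then have h: "0 < h" "h < b" "h < d" by auto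
      have flow: "flow S x0 u h = x h" "flow S x0 u 0 = x0"
        using flow_eq[OF wp x0 u sol, of h] flow_eq[OF wp x0 u sol, of 0] bT h b0 init by auto
      have "V x0 - \<eta> \<le> V (x t)" if "t \<in> {0..h}" for t
        using d(2)[of t] that h \<eta> init by (cases "t = 0") (auto simp: dist_real_def)
      moreover have "(\<lambda>t. V (x t)) integrable_on {0..h}"
        by (intro integrable_continuous_real continuous_on_subset[OF Vc]) (use h in auto)
      ultimately have "integral {0..h} (\<lambda>_. V x0 - \<eta>) \<le> integral {0..h} (\<lambda>t. V (x t))"
        by (intro integral_le) auto
      then have "rate * (h * (V x0 - \<eta>)) \<le> rate * integral {0..h} (\<lambda>t. V (x t))"
        using h rate_pos by (intro mult_left_mono) auto
      moreover have "V (x h) + rate * integral {0..h} (\<lambda>t. V (x t)) \<le> V (x 0) + gain_const u * (h - 0)"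
        by (rule V_dissipation_integral[OF sol u]) (use h bT in auto)
      ultimately have "V (x h) - V x0 \<le> (gain_const u - rate * (V x0 - \<eta>)) * h"
        using init by (simp add: algebra_simps)
      then have "(V (x h) - V x0) / h \<le> gain_const u - rate * (V x0 - \<eta>)"
        using h by (simp add: divide_le_eq)
      also have "\<dots> = - rate * V x0 + gain_const u + e" using \<eta>(2) by (simp add: algebra_simps)
      finally show ?case by (simp add: flow)
    qed
  qed
qed

lemma V_flow_le:
  assumes wp: "well_posed S" and x0: "x0 \<in> state_space S" and u: "u \<in> inputs S"
    and t: "0 \<le> t" "ereal t < flow_time S x0 u"
  shows "flow S x0 u t \<in> state_space S"
    and "V (flow S x0 u t) \<le> exp (- rate * t) * V x0 + gain_const u / rate"
proof -
  obtain T x where sol: "network_solution S x0 u T x" and tT: "ereal t < T"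
    using t(2) unfolding flow_time_def by (rule less_max_timeE)
  have flow: "flow S x0 u t = x t" by (rule flow_eq[OF wp x0 u sol t(1) tT])
  show "flow S x0 u t \<in> state_space S"
    unfolding flow by (rule network_solution_mem[OF sol t(1) tT])
  have bT: "ereal b < T" if "b \<le> t" for b
    using that tT by (auto intro: le_less_trans[of "ereal b" "ereal t"])
  have "V (x t) \<le> exp (- rate * t) * (V (x 0) - gain_const u / rate) + gain_const u / rate"
  proof (rule gronwall_exponential[OF rate_pos t(1)])
    show "continuous_on {0..t} (\<lambda>t. V (x t))"
      by (rule continuous_on_subset[OF continuous_on_V_trajectory[OF sol]]) (use bT in auto)
    show "V (x b) + rate * integral {a..b} (\<lambda>t. V (x t)) \<le> V (x a) + gain_const u * (b - a)"
      if "0 \<le> a" "a \<le> b" "b \<le> t" for a b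
      by (rule V_dissipation_integral[OF sol u that(1,2) bT[OF that(3)]])
  qed
  also have "\<dots> \<le> exp (- rate * t) * V x0 + gain_const u / rate"
    using gain_const_nonneg[of u] rate_pos network_solution_initial[OF sol]
    by (simp add: right_diff_distrib)
  finally show "V (flow S x0 u t) \<le> exp (- rate * t) * V x0 + gain_const u / rate"
    by (simp add: flow)
qed

lemma eISS_estimate_A:
  assumes wp: "well_posed S" and pos: "0 < alpha_up" "0 < gain_u_up"
  shows "eISS_estimate S A"
proof -
  let ?p = "exp_p S" and ?q = "exp_q S"
  note p = X.p and q = U.p
  \<comment> \<open>\<open>M\<close> and \<open>c\<close> are p-th roots of the quotients obtained
    by dividing the decay estimate of \<open>V\<close> by \<open>alpha_low\<close>; likewise the
    rate becomes \<open>rate / exp_p S\<close> and the input exponent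
    \<open>exp_q S / exp_p S\<close>.\<close>
  define M where "M = (mu_up * alpha_up / alpha_low) powr (1 / ?p)"
  define c where "c = (mu_up * gain_u_up / (rate * alpha_low)) powr (1 / ?p)"
  have M: "0 < M" unfolding M_def using mu_up pos alpha_low by simp
  have c: "0 < c" unfolding c_def using mu_up pos alpha_low rate_pos by simp
  have sd0: "0 \<le> state_distance S A x" if "x \<in> state_space S" for x
    using X.set_distance_nonneg[OF A_sub A_nonempty] that
    by (simp add: state_distance_def state_norm_def state_space_def)
  show ?thesis
    unfolding eISS_estimate_def
  proof (intro exI conjI ballI allI impI)
    show "0 < rate / ?p" using rate_pos p by simp
    show "0 < M" by (rule M)
    show "class_K (\<lambda>r. c * r powr (?q / ?p))" using c p q by (intro class_K_powr) auto
    fix x0 u t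
    assume x0: "x0 \<in> state_space S" and u: "u \<in> inputs S" and "0 \<le> t \<and> ereal t < flow_time S x0 u"
    then have t: "0 \<le> t" "ereal t < flow_time S x0 u" by auto
    note F = V_flow_le[OF wp x0 u t]
    let ?d = "state_distance S A (flow S x0 u t)" and ?start = "state_distance S A x0"
    let ?E = "exp (- rate * t)"
    let ?a = "?E * (mu_up * alpha_up / alpha_low) * ?start powr ?p"
    let ?b = "mu_up * gain_u_up / (rate * alpha_low) * input_norm S u powr ?q"
    have ab: "0 \<le> ?a" "0 \<le> ?b" using mu_up pos alpha_low rate_pos by auto
    have "alpha_low * ?d powr ?p \<le> V (flow S x0 u t)" by (rule V_coercive(1)[OF F(1)])
    also have "\<dots> \<le> ?E * V x0 + gain_const u / rate" by (rule F(2))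
    also have "\<dots> \<le> ?E * (mu_up * alpha_up * ?start powr ?p) + gain_const u / rate"
      by (intro add_right_mono mult_left_mono V_coercive(2)[OF x0]) simp
    also have "\<dots> = alpha_low * (?a + ?b)"
      using alpha_low rate_pos by (simp add: gain_const_def field_simps)
    finally have "?d powr ?p \<le> ?a + ?b" using alpha_low by simp
    then have "(?d powr ?p) powr (1 / ?p) \<le> (?a + ?b) powr (1 / ?p)"
      using p by (intro powr_mono2) auto
    also have "\<dots> \<le> ?a powr (1 / ?p) + ?b powr (1 / ?p)"
      by (rule powr_add_le_add_powr[OF ab p])
    also have "?a powr (1 / ?p) = M * exp (- (rate / ?p) * t) * ?start"
    proof -
      have "?E powr (1 / ?p) = exp (- (rate / ?p) * t)" by (simp add: powr_def)
      then show ?thesis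
        using mu_up pos alpha_low p sd0[OF x0]
        by (simp add: powr_mult powr_divide powr_inverse_cancel M_def)
    qed
    also have "?b powr (1 / ?p) = c * input_norm S u powr (?q / ?p)"
      using mu_up pos alpha_low rate_pos by (simp add: powr_mult powr_divide powr_powr c_def)
    finally show "?d \<le> M * exp (- (rate / ?p) * t) * ?start + c * input_norm S u powr (?q / ?p)"
      using p sd0[OF F(1)] by (simp add: powr_inverse_cancel)
  qed
qed

lemma eISS_Lyapunov_function_V:
  assumes wp: "well_posed S" and pos: "0 < alpha_up" "0 < gain_u_up"
  shows "eISS_Lyapunov_function S A V"
  unfolding eISS_Lyapunov_function_def
proof (intro conjI)
  show "\<forall>x\<in>state_space S. 0 \<le> V x" using V_nonneg by blast
  show "continuous_map (subtopology (state_top S) (state_space S - A)) euclideanreal V"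
    by (rule continuous_map_from_subtopology[OF V_continuous])
  let ?g = "\<lambda>r. mu_up * gain_u_up * r powr exp_q S"
  have m: "0 < mu_up * alpha_up" "0 < mu_up * gain_u_up" "0 < exp_p S" "0 < exp_q S"
    using mu_up pos X.p U.p by auto
  show "\<exists>w1>0. \<exists>w2>0. \<exists>b>0. \<exists>\<kappa>>0. \<exists>g. class_K g \<and> (\<forall>c. \<exists>r\<ge>0. c < g r) \<and>
        (\<forall>x\<in>state_space S. w1 * state_distance S A x powr b \<le> V x \<and>
                           V x \<le> w2 * state_distance S A x powr b) \<and>
        (\<forall>x\<in>state_space S - A. \<forall>u\<in>inputs S.
           orbital_dini S V u x \<le> ereal (- \<kappa> * V x + g (input_norm S u)))"
    by (rule exI[of _ alpha_low], intro conjI alpha_low, rule exI[of _ "mu_up * alpha_up"], intro conjI m,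
        rule exI[of _ "exp_p S"], intro conjI m, rule exI[of _ rate], intro conjI rate_pos,
        rule exI[of _ ?g])
       (use class_K_powr[OF m(2,4)] powr_unbounded[OF m(2,4)] V_coercive
          orbital_dini_V_le[OF wp] in \<open>auto simp: gain_const_def\<close>)
qed (use A_nonempty A_closed in auto)

end

section \<open>The small-gain theorem\<close>

theorem theoremV1:
  fixes S :: network
    and As :: "nat \<Rightarrow> vect set"
    and Vs :: "nat \<Rightarrow> vect \<Rightarrow> real"
    and \<alpha>l \<alpha>u lam \<gamma>u :: "nat \<Rightarrow> real"
    and \<gamma> :: "nat \<Rightarrow> nat \<Rightarrow> real"
    and \<alpha>_low \<alpha>_up lam_low \<gamma>u_up :: real
    and A :: "vseq set"
  assumes setting: "infinite_network S"
    and wp: "well_posed S"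
    and A_i: "\<And>i. As i \<noteq> {} \<and> closedin (sub_state_top S i) (As i)"
    and V_i: "\<And>i. continuous_map (sub_state_top S i) euclideanreal (Vs i)"
             "\<And>i x. x \<in> sub_states S i \<Longrightarrow> 0 \<le> Vs i x"
    and pos: "\<And>i. 0 < \<alpha>l i" "\<And>i. 0 < \<alpha>u i" "\<And>i. 0 < lam i" "\<And>i. 0 < \<gamma>u i"
             "\<And>i j. j \<in> neighbors S i \<Longrightarrow> 0 < \<gamma> i j"
    and \<gamma>_zero: "\<And>i j. j \<notin> neighbors S i \<Longrightarrow> \<gamma> i j = 0"
    and coercive: "\<And>i x. x \<in> sub_states S i \<Longrightarrow>
          \<alpha>l i * set_distance (norm_x S i) (As i) x powr exp_p S \<le> Vs i x \<and>
          Vs i x \<le> \<alpha>u i * set_distance (norm_x S i) (As i) x powr exp_p S"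
    and dissipative: "\<And>i x0 w v.
          x0 \<in> sub_states S i - As i \<Longrightarrow> w \<in> internal_inputs S \<Longrightarrow> v \<in> Linf_sub_inputs S i \<Longrightarrow>
          AE t in lebesgue. 0 \<le> t \<and> ereal t < sub_max_time S i x0 w v \<longrightarrow>
            upper_dini (\<lambda>s. Vs i (sub_flow S i x0 w v s)) t
              \<le> ereal (- lam i * Vs i (sub_flow S i x0 w v t))
                + (\<Sum>j. ereal (\<gamma> i j * Vs j (w t j)))
                + ereal (\<gamma>u i * norm_u S i (v t) powr exp_q S)"
    and dini_finite: "\<And>i x0 w v t.
          x0 \<in> sub_states S i - As i \<Longrightarrow> w \<in> internal_inputs S \<Longrightarrow> v \<in> Linf_sub_inputs S i \<Longrightarrow>
          0 \<le> t \<Longrightarrow> ereal t < sub_max_time S i x0 w v \<Longrightarrow>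
            lower_dini (\<lambda>s. Vs i (sub_flow S i x0 w v s)) t < \<infinity>"
    and uniform_pos: "0 < \<alpha>_low" "0 < \<alpha>_up" "0 < lam_low" "0 < \<gamma>u_up"
    and uniform: "\<And>i. \<alpha>_low \<le> \<alpha>l i \<and> \<alpha>l i \<le> \<alpha>u i \<and> \<alpha>u i \<le> \<alpha>_up"
                 "\<And>i. lam_low \<le> lam i" "\<And>i. \<gamma>u i \<le> \<gamma>u_up"
    and bounded_gain: "(SUP j. \<Sum>i. ennreal (\<gamma> i j)) < \<infinity>"
    and small_gain: "l1_spectral_radius (\<lambda>i j. \<gamma> i j / lam i) < 1"
    and A_def: "A = {x \<in> state_space S. \<forall>i. x i \<in> As i}"
    and A_nonempty: "A \<noteq> {}"
  shows "(\<exists>\<mu> \<mu>_low \<mu>_up V.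
            0 < \<mu>_low \<and> 0 < \<mu>_up \<and> (\<forall>i. \<mu>_low \<le> \<mu> i \<and> \<mu> i \<le> \<mu>_up) \<and>
            (\<forall>x\<in>state_space S. (\<lambda>i. \<mu> i * Vs i (x i)) sums V x) \<and>
            eISS_Lyapunov_function S A V \<and>
            continuous_map (subtopology (state_top S) (state_space S - A)) euclideanreal V \<and>
            (\<exists>lam_inf>0. \<forall>x0\<in>state_space S - A. \<forall>u\<in>inputs S.
               orbital_dini S V u x0
                 \<le> ereal (- lam_inf * V x0 + \<mu>_up * \<gamma>u_up * input_norm S u powr exp_q S)) \<and>
            (\<forall>x\<in>state_space S.
               \<mu>_low * \<alpha>_low * state_distance S A x powr exp_p S \<le> V x \<and>
               V x \<le> \<mu>_up * \<alpha>_up * state_distance S A x powr exp_p S))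
         \<and> eISS_estimate S A
         \<and> (forward_complete S \<longrightarrow> eISS S A)"
proof -
  \<comment> \<open>The supremum of the column sums is finite by \<open>bounded_gain\<close>, so the
    conversion to a real number is faithful.\<close>
  define K where "K = enn2real (SUP j. \<Sum>i. ennreal (\<gamma> i j))"
  have \<gamma>0: "0 \<le> \<gamma> i j" for i j
    using pos(5)[of j i] \<gamma>_zero[of j i] by (cases "j \<in> neighbors S i") auto
  have colK: "(\<Sum>i<n. \<gamma> i j) \<le> K" for n j
  proof -
    have "ennreal (\<Sum>i<n. \<gamma> i j) = (\<Sum>i<n. ennreal (\<gamma> i j))" using \<gamma>0 by (simp add: sum_ennreal)
    also have "\<dots> \<le> (\<Sum>i. ennreal (\<gamma> i j))" by (rule sum_le_suminf) auto
    also have "\<dots> \<le> (SUP j. \<Sum>i. ennreal (\<gamma> i j))" by (rule SUP_upper) simp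
    also have "\<dots> = ennreal K" unfolding K_def using bounded_gain by simp
    finally show ?thesis by (simp add: K_def ennreal_le_iff)
  qed
  obtain th mu C where th: "0 \<le> th" "th < 1" and mu: "\<And>i. 1 \<le> mu i" "\<And>i. mu i \<le> C"
    and wt: "\<And>n j. (\<Sum>i<n. mu i * \<gamma> i j) \<le> th * (lam j * mu j)"
    using network_weights[of \<gamma> K lam_low lam, OF \<gamma>0 colK uniform_pos(3) uniform(2) small_gain] by blast
  have A_i1: "As i \<noteq> {}" and A_i2: "closedin (sub_state_top S i) (As i)" and \<gamma>u0: "0 \<le> \<gamma>u i" for i
    using A_i[of i] pos(4)[of i] by auto
  interpret dissipative_network S As Vs \<alpha>_low \<alpha>_up A mu C lam \<gamma>u \<gamma> K th lam_low \<gamma>u_up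
  proof unfold_locales
    fix i x assume x: "x \<in> sub_states S i"
    let ?d = "set_distance (norm_x S i) (As i) x powr exp_p S"
    show "\<alpha>_low * ?d \<le> Vs i x"
      using coercive[OF x] mult_right_mono[of \<alpha>_low "\<alpha>l i" ?d] uniform(1)[of i] by simp
    show "Vs i x \<le> \<alpha>_up * ?d"
      using coercive[OF x] mult_right_mono[of "\<alpha>u i" \<alpha>_up ?d] uniform(1)[of i] by simp
  qed (fact setting A_i1 A_i2 V_i(1) uniform_pos uniform(2,3) A_def A_nonempty mu \<gamma>0 colK th wt \<gamma>u0
       | (rule dissipative, assumption+) | (rule dini_finite, assumption+))+
  have C: "0 < C" using mu(1)[of 0] mu(2)[of 0] by linarith
  note est = eISS_estimate_A[OF wp uniform_pos(2,4)]
  have dini: "\<exists>lam_inf>0. \<forall>x0\<in>state_space S - A. \<forall>u\<in>inputs S.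
          orbital_dini S V u x0 \<le> ereal (- lam_inf * V x0 + C * \<gamma>u_up * input_norm S u powr exp_q S)"
    using rate_pos orbital_dini_V_le[OF wp] unfolding gain_const_def by blast
  have bounds: "\<forall>x\<in>state_space S. 1 * \<alpha>_low * state_distance S A x powr exp_p S \<le> V x \<and>
          V x \<le> C * \<alpha>_up * state_distance S A x powr exp_p S"
    using V_coercive by simp
  have mus: "\<forall>i. 1 \<le> mu i \<and> mu i \<le> C" using mu by blast
  have sums: "\<forall>x\<in>state_space S. (\<lambda>i. mu i * Vs i (x i)) sums V x" using V_sums by blast
  note V_props = zero_less_one C mus sums eISS_Lyapunov_function_V[OF wp uniform_pos(2,4)]
    continuous_map_from_subtopology[OF V_continuous] dini bounds
  \<comment> \<open>\<open>est\<close> holds at all times of existence; forward completeness turns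
    it into a statement for all nonnegative times.\<close>
  have "forward_complete S \<longrightarrow> eISS S A"
    using A_nonempty A_closed est unfolding eISS_def by blast
  \<comment> \<open>The weights of \<open>network_weights\<close> are at least 1, so 1 serves as
    their lower bound and \<open>C\<close> as the upper one.\<close>
  then show ?thesis
    using est
    by (intro conjI[OF exI[of _ mu, OF exI[of _ 1, OF exI[of _ C, OF exI[of _ V]]]]] conjI V_props) auto
qed

end
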